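(* Let $\mathcal{OT}$ be the oriented graph whose nodes are all weighted circular graphs $\Gamma$ (up to isomorphism) with $n\ge 6$ vertices having exactly one weight $-1$, and whose oriented edges are the pairs $(\Gamma,\Gamma')$ of nodes such that $\Gamma'$ is a combinatorial blow-up of $\Gamma$. Then $\mathcal{OT}$ is a disjoint union of infinite complete binary rooted trees $\mathcal{OT}(a)$ parametrized by their root nodes $\Gamma(a)$, $a\in\mathbb{Z}_{>0}$.
   Context: Weighted circular graphs. Let $N\cong\mathbb{Z}^2$. A complete regular $2$-dimensional fan $\Sigma$ in $N_{\mathbb{R}}$ has rays with primitive generators $\nu_i$ ($i\in\mathbb{Z}/n\mathbb{Z}$, $n\ge 3$) in cyclic order, and each pair $\nu_i,\nu_{i+1}$ is a $\mathbb{Z}$-basis of $N$. Its weighted circular graph $\Gamma$ is the cycle with vertices $\nu_i$ (neighbours $\nu_i,\nu_{i+1}$) and integer weights $w_i$ defined by $\nu_{i-1}+\nu_{i+1}+w_i\nu_i=0$. All weighted circular graphs considered arise from complete regular fans in this way, and isomorphism means isomorphism of weighted graphs. Combinatorial blow-up. Blowing up an edge $[\nu_i,\nu_{i+1}]$ means subdividing the cone $\mathbb{R}_{\ge0}\nu_i+\mathbb{R}_{\ge0}\nu_{i+1}$ by the new ray generated by $\nu'=\nu_i+\nu_{i+1}$; on weights, a new vertex of weight $-1$ is inserted between $\nu_i$ and $\nu_{i+1}$, the weights $w_i,w_{i+1}$ are each decreased by $1$, and all other weights are unchanged. For an integer $a\ge1$, $\Gamma(a)$ denotes the weighted circular graph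 with $6$ vertices whose weights in cyclic order are $(-1,-2,a,0,-a-1,-2)$. An infinite complete binary rooted tree is one in which every node has exactly two children (edges oriented from parent to child). *)

theory Defs
  imports "HOL-Analysis.Analysis" "Graph_Theory.Graph_Theory"
begin

section \<open>Fans in the plane\<close>

text \<open>The lattice \<open>N\<close> is \<^typ>\<open>int \<times> int\<close>, and its real span is \<^typ>\<open>real \<times> real\<close>.\<close>

type_synonym lattice = "int \<times> int"
type_synonym plane = "real \<times> real"

definition real_pt :: "lattice \<Rightarrow> plane" where
  "real_pt u = (real_of_int (fst u), real_of_int (snd u))"

definition zscale :: "int \<Rightarrow> lattice \<Rightarrow> lattice" where
  "zscale k u = (k * fst u, k * snd u)"

definition zbasis :: "lattice \<Rightarrow> lattice \<Rightarrow> bool" where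
  "zbasis u v \<longleftrightarrow> (\<forall>x. \<exists>!p. x = zscale (fst p) u + zscale (snd p) v)"

definition primitive :: "lattice \<Rightarrow> bool" where
  "primitive u \<longleftrightarrow> coprime (fst u) (snd u)"

definition lcone :: "lattice set \<Rightarrow> plane set" where
  "lcone S = convex_cone hull (real_pt ` S)"

definition strongly_convex_rational_cone :: "plane set \<Rightarrow> bool" where
  "strongly_convex_rational_cone \<sigma> \<longleftrightarrow>
     (\<exists>S. finite S \<and> \<sigma> = lcone S) \<and> (\<forall>x. x \<in> \<sigma> \<and> - x \<in> \<sigma> \<longrightarrow> x = 0)"

text \<open>In the library the empty set is a face of every convex set, whereas faces of cones are
  nonempty; for nonempty faces of polyhedral cones the two notions agree.\<close>

definition fan :: "plane set set \<Rightarrow> bool" where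
  "fan \<Sigma> \<longleftrightarrow> finite \<Sigma> \<and>
     (\<forall>\<sigma>\<in>\<Sigma>. strongly_convex_rational_cone \<sigma>) \<and>
     (\<forall>\<sigma>\<in>\<Sigma>. \<forall>\<tau>. \<tau> face_of \<sigma> \<and> \<tau> \<noteq> {} \<longrightarrow> \<tau> \<in> \<Sigma>) \<and>
     (\<forall>\<sigma>\<in>\<Sigma>. \<forall>\<sigma>'\<in>\<Sigma>. (\<sigma> \<inter> \<sigma>') face_of \<sigma> \<and> (\<sigma> \<inter> \<sigma>') face_of \<sigma>')"

definition regular_cone :: "plane set \<Rightarrow> bool" where
  "regular_cone \<sigma> \<longleftrightarrow> (\<exists>u v S. zbasis u v \<and> S \<subseteq> {u, v} \<and> \<sigma> = lcone S)"

definition complete_regular_fan :: "plane set set \<Rightarrow> bool" where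
  "complete_regular_fan \<Sigma> \<longleftrightarrow> fan \<Sigma> \<and> \<Union>\<Sigma> = UNIV \<and> (\<forall>\<sigma>\<in>\<Sigma>. regular_cone \<sigma>)"

text \<open>The list \<open>\<nu>s\<close> enumerates the primitive generators of the rays of \<open>\<Sigma>\<close> in cyclic order:
  the two-dimensional cones are exactly those spanned by cyclically consecutive entries.\<close>

definition cyclic_generators :: "plane set set \<Rightarrow> lattice list \<Rightarrow> bool" where
  "cyclic_generators \<Sigma> \<nu>s \<longleftrightarrow> distinct \<nu>s \<and> 3 \<le> length \<nu>s \<and>
     set \<nu>s = {u. primitive u \<and> lcone {u} \<in> \<Sigma>} \<and>
     {\<sigma>\<in>\<Sigma>. dim \<sigma> = 2} = {lcone {\<nu>s ! i, \<nu>s ! (Suc i mod length \<nu>s)} | i. i < length \<nu>s}"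

section \<open>Weighted circular graphs\<close>

record 'v wgraph =
  wverts :: "'v set"
  wedges :: "'v set set"
  weight :: "'v \<Rightarrow> int"

definition wgraph_iso :: "'v wgraph \<Rightarrow> 'w wgraph \<Rightarrow> bool" where
  "wgraph_iso G H \<longleftrightarrow> (\<exists>f. bij_betw f (wverts G) (wverts H) \<and>
     wedges H = (\<lambda>e. f ` e) ` wedges G \<and>
     (\<forall>v\<in>wverts G. weight H (f v) = weight G v))"

text \<open>The vertices of a weighted circular graph are the generators \<open>\<nu>\<^sub>i\<close> themselves. The values of
  \<^const>\<open>weight\<close> away from the vertices are irrelevant and left unconstrained.\<close>

definition weighted_circular_graph :: "lattice wgraph \<Rightarrow> bool" where
  "weighted_circular_graph \<Gamma> \<longleftrightarrow>
     (\<exists>\<Sigma> \<nu>s. complete_regular_fan \<Sigma> \<and> cyclic_generators \<Sigma> \<nu>s \<and>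
        wverts \<Gamma> = set \<nu>s \<and>
        wedges \<Gamma> = {{\<nu>s ! i, \<nu>s ! (Suc i mod length \<nu>s)} | i. i < length \<nu>s} \<and>
        (\<forall>i < length \<nu>s.
           let n = length \<nu>s; l = \<nu>s ! i; m = \<nu>s ! ((i + 1) mod n); r = \<nu>s ! ((i + 2) mod n)
           in l + r + zscale (weight \<Gamma> m) m = 0))"

text \<open>Blow-up of the edge \<open>{u, v}\<close>; since \<open>u + v\<close> is a lattice vector, the new vertex is the
  generator of the ray subdividing the cone spanned by \<open>u\<close> and \<open>v\<close>.\<close>

definition blow_up :: "lattice \<Rightarrow> lattice \<Rightarrow> lattice wgraph \<Rightarrow> lattice wgraph" where
  "blow_up u v \<Gamma> =
     \<lparr> wverts = insert (u + v) (wverts \<Gamma>),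
       wedges = (wedges \<Gamma> - {{u, v}}) \<union> {{u, u + v}, {u + v, v}},
       weight = (weight \<Gamma>)(u := weight \<Gamma> u - 1, v := weight \<Gamma> v - 1, u + v := - 1) \<rparr>"

definition weighted_cycle :: "int list \<Rightarrow> nat wgraph" where
  "weighted_cycle ws =
     \<lparr> wverts = {..<length ws},
       wedges = {{i, Suc i mod length ws} | i. i < length ws},
       weight = (\<lambda>i. ws ! i) \<rparr>"

section \<open>The oriented graph of isomorphism classes\<close>

definition wcg_iso_rel :: "lattice wgraph rel" where
  "wcg_iso_rel = {(G, H). weighted_circular_graph G \<and> weighted_circular_graph H \<and> wgraph_iso G H}"

definition OT_nodes :: "lattice wgraph set set" where
  "OT_nodes = {\<Gamma>. weighted_circular_graph \<Gamma> \<and> 6 \<le> card (wverts \<Gamma>) \<and>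
     card {v \<in> wverts \<Gamma>. weight \<Gamma> v = - 1} = 1} // wcg_iso_rel"

definition OT :: "lattice wgraph set pair_pre_digraph" where
  "OT = \<lparr> pverts = OT_nodes,
          parcs = {(C, D). C \<in> OT_nodes \<and> D \<in> OT_nodes \<and>
            (\<exists>\<Gamma>\<in>C. \<exists>u v. {u, v} \<in> wedges \<Gamma> \<and> blow_up u v \<Gamma> \<in> D)} \<rparr>"

text \<open>The isomorphism class, among weighted circular graphs of fans, of the six-cycle with the
  given weights. That it is nonempty for positive \<open>a\<close>, i.e. that a fan realises these weights,
  is not built into the definition.\<close>

definition Gamma_class :: "int \<Rightarrow> lattice wgraph set" where
  "Gamma_class a = {\<Gamma>. weighted_circular_graph \<Gamma> \<and>
     wgraph_iso \<Gamma> (weighted_cycle [- 1, - 2, a, 0, - a - 1, - 2])}"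

text \<open>A directed graph is a tree rooted at \<open>r\<close>, with edges oriented from parent to child, iff each
  vertex is the end of exactly one directed walk from \<open>r\<close>. Such a tree in which every node has
  two children is automatically infinite.\<close>

definition infinite_complete_binary_tree :: "'a pair_pre_digraph \<Rightarrow> 'a \<Rightarrow> bool" where
  "infinite_complete_binary_tree T r \<longleftrightarrow> pair_wf_digraph T \<and> r \<in> pverts T \<and>
     (\<forall>v\<in>pverts T. \<exists>!p. pre_digraph.awalk (with_proj T) r p v) \<and>
     (\<forall>v\<in>pverts T. card {c. (v, c) \<in> parcs T} = 2)"

end

theory Submission
  imports Defs
begin

text \<open>A complete regular fan is encoded by the set \<open>R\<close> of its arcs \<open>(\<nu>\<^sub>i, \<nu>\<^sub>i\<^sub>+\<^sub>1)\<close>, oriented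
  counterclockwise: every arc has determinant \<open>1\<close>, and the half-open cones of distinct arcs are
  disjoint. That these cones then cover the punctured plane, and that \<open>R\<close> is a single cycle, is
  automatic.

  A vertex of weight \<open>-1\<close> is the sum of its two neighbours. If \<open>e\<close> and \<open>-e\<close> are vertices and at
  least two vertices lie strictly on one side of the line they span, then among these a highest one
  has weight \<open>-1\<close>; a vertex of maximal norm reduces the general case to this one, so every fan with
  at least five rays has a weight \<open>-1\<close>. Two adjacent weights \<open>-1\<close> force a pair of opposite
  vertices, hence a third \<open>-1\<close> as soon as there are at least six rays. So contracting the only
  weight \<open>-1\<close> of a graph with at least seven vertices leaves exactly one \<open>-1\<close>, and this is the
  unique parent. With six vertices the contraction is a blow-up of a four-cycle with weights
  \<open>0, b, 0, -b\<close>, which leaves only the graphs \<open>\<Gamma>(a)\<close>.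

  By induction along the parents, both neighbours of the vertex of weight \<open>-1\<close> have weight at most
  \<open>-2\<close>, and the two weights differ unless the graph is a root. So exactly the two blow-ups at this vertex stay
  inside the graph, and they are not isomorphic, because no automorphism swaps the neighbours.\<close>

text \<open>Weights are determinants throughout: for consecutive generators \<open>u\<close>,
  \<open>z\<close>, \<open>w\<close> the weight of \<open>z\<close> is \<open>- det2 u w\<close>,
  and blow-ups change weights by bilinearity. Storing the arcs as a set makes blow-up and
  contraction set operations without index arithmetic. Connectedness then has to be proved; it comes
  from the covering lemma, since two separate cycles would each cover the plane, against
  disjointness of the cones. Half-open cones make this disjointness exact: every vertex belongs to
  the cone of its outgoing arc and to no other. The argument with maximal norm also meets three
  generators with sum 0, where no opposite pair is at hand; there another linear form replaces the
  height. Nodes are isomorphism classes, and an isomorphism is merely a map of vertices, not a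
  linear one. What makes it manageable is that the new vertex is the only weight \<open>-1\<close>
  of a child: an isomorphism between children matches the new vertices and so restricts to the
  parents. Uniqueness of the parent and distinctness of the two children both rest on this.\<close>

declare split_paired_All [simp del] split_paired_Ex [simp del]

section \<open>Cyclic systems of half-open unimodular cones\<close>

definition cross :: "plane \<Rightarrow> plane \<Rightarrow> real" where
  "cross p q = fst p * snd q - snd p * fst q"

definition det2 :: "lattice \<Rightarrow> lattice \<Rightarrow> int" where
  "det2 u v = fst u * snd v - snd u * fst v"

text \<open>For \<open>det2 u v = 1\<close> this is the cone of \<open>u\<close> and
  \<open>v\<close> with the ray of \<open>u\<close> kept and the ray of \<open>v\<close> and the
  origin removed, so that consecutive cones fit together and are still disjoint.\<close>

definition hcone :: "lattice \<Rightarrow> lattice \<Rightarrow> plane set" where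
  "hcone u v = {p. 0 \<le> cross (real_pt u) p \<and> 0 < cross p (real_pt v)}"

lemma cross_real_pt: "cross (real_pt u) (real_pt v) = of_int (det2 u v)"
  by (simp add: cross_def real_pt_def det2_def)

lemma real_pt_in_hcone: "real_pt z \<in> hcone u v \<longleftrightarrow> 0 \<le> det2 u z \<and> 0 < det2 z v"
  by (simp add: hcone_def cross_real_pt)

lemma real_pt_eq_0 [simp]: "real_pt u = 0 \<longleftrightarrow> u = 0"
  by (simp add: real_pt_def prod_eq_iff)

lemma det2_simps [simp]:
  "det2 u u = 0" "det2 0 u = 0" "det2 u 0 = 0"
  "det2 (- u) v = - det2 u v" "det2 u (- v) = - det2 u v"
  "det2 (u + v) w = det2 u w + det2 v w" "det2 u (v + w) = det2 u v + det2 u w"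
  "det2 (zscale k u) w = k * det2 u w" "det2 u (zscale k w) = k * det2 u w"
  by (simp_all add: det2_def zscale_def algebra_simps)

lemma det2_swap: "det2 u v = - det2 v u"
  by (simp add: det2_def)

lemma det2_eq_1_nonzero: "det2 u v = 1 \<Longrightarrow> u \<noteq> 0 \<and> v \<noteq> 0 \<and> u \<noteq> v"
  by auto

lemma plucker: "det2 a b * det2 c d - det2 a c * det2 b d + det2 a d * det2 b c = 0"
  by (simp add: det2_def algebra_simps)

text \<open>Cramer's rule for three vectors of the plane. It turns the weight of \<open>z\<close>
  between neighbours \<open>u\<close> and \<open>w\<close> into \<open>- det2 u w\<close>.\<close>

lemma add_eq_zscale_det2:
  assumes "det2 u z = 1" "det2 z w = 1"
  shows "u + w = zscale (det2 u w) z"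
proof -
  have "det2 u w * fst z = det2 z w * fst u + det2 u z * fst w"
    "det2 u w * snd z = det2 z w * snd u + det2 u z * snd w"
    by (simp_all add: det2_def algebra_simps)
  then show ?thesis
    using assms by (simp add: prod_eq_iff zscale_def)
qed

lemma unimodular_expansion:
  assumes "det2 u v = 1"
  shows "z = zscale (det2 z v) u + zscale (det2 u z) v"
proof -
  have "det2 u v * fst z = det2 z v * fst u + det2 u z * fst v"
    "det2 u v * snd z = det2 z v * snd u + det2 u z * snd v"
    by (simp_all add: det2_def algebra_simps)
  then show ?thesis
    using assms by (simp add: prod_eq_iff zscale_def)
qed

lemma zscale_simps [simp]: "zscale 0 u = 0" "zscale 1 u = u" "zscale (- 1) u = - u" "zscale k 0 = 0"
  "zscale (- k) u = - zscale k u" 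
  by (simp_all add: zscale_def prod_eq_iff)

section \<open>Covering the plane by a left-turning system of cones\<close>

text \<open>\<open>g u\<close> is the cotangent of the angle from \<open>u\<close> to
  \<open>p\<close>. As long as the vectors stay strictly on one side of the line of
  \<open>p\<close>, each left turn increases it strictly, so a maximiser over a finite set cannot
  turn left within the set.\<close>

lemma no_finite_left_turning_set:
  fixes p :: plane
  assumes "finite B" "B \<noteq> {}"
    and turn: "\<And>u. u \<in> B \<Longrightarrow> \<exists>v\<in>B. det2 u v > 0"
    and sign: "\<And>u v. u \<in> B \<Longrightarrow> v \<in> B \<Longrightarrow> cross (real_pt u) p * cross (real_pt v) p > 0"
  shows False
proof -
  define g where "g u = (real_pt u \<bullet> p) / cross (real_pt u) p" for u
  have "Max (g ` B) \<in> g ` B"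
    using assms(1,2) by (intro Max_in) simp_all
  then obtain u where "u \<in> B" "g u = Max (g ` B)" by (metis imageE)
  then have u: "u \<in> B" "\<And>v. v \<in> B \<Longrightarrow> g v \<le> g u"
    using assms(1) by simp_all
  obtain v where v: "v \<in> B" "det2 u v > 0"
    using turn u by blast
  have p: "p \<bullet> p > 0"
    using sign[OF u(1) u(1)] by (cases "p = 0") (auto simp: cross_def)
  have c: "cross (real_pt u) p * cross (real_pt v) p > 0"
    using sign u(1) v(1) by blast
  have "g v - g u = of_int (det2 u v) * (p \<bullet> p) / (cross (real_pt u) p * cross (real_pt v) p)"
  proof -
    have "(real_pt v \<bullet> p) * cross (real_pt u) p - (real_pt u \<bullet> p) * cross (real_pt v) p
       = of_int (det2 u v) * (p \<bullet> p)"
      by (simp add: cross_def real_pt_def det2_def inner_prod_def algebra_simps)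
    moreover have "cross (real_pt u) p \<noteq> 0" "cross (real_pt v) p \<noteq> 0"
      using c by auto
    ultimately show ?thesis
      by (simp add: g_def field_simps)
  qed
  moreover have "\<dots> > 0"
    using c p v by simp
  ultimately show False
    using u(2)[OF v(1)] by simp
qed

lemma cross_eq_0_cases:
  fixes p q :: plane
  assumes "cross q p = 0" "p \<noteq> 0"
  shows "\<exists>c. q = c *\<^sub>R p"
proof (cases "fst p = 0")
  case True
  then have "snd p \<noteq> 0" using assms(2) by (simp add: prod_eq_iff)
  then have "q = (snd q / snd p) *\<^sub>R p"
    using assms(1) True by (simp add: prod_eq_iff cross_def)
  then show ?thesis by blast
next
  case False
  then have "q = (fst q / fst p) *\<^sub>R p"
    using assms(1) by (simp add: prod_eq_iff cross_def mult.commute nonzero_eq_divide_eq)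
  then show ?thesis by blast
qed

lemma cross_scaleR [simp]: "cross (c *\<^sub>R p) q = c * cross p q" "cross p (c *\<^sub>R q) = c * cross p q"
  by (simp_all add: cross_def algebra_simps)

lemma cross_add [simp]: "cross (a + b) q = cross a q + cross b q" "cross q (a + b) = cross q a + cross q b"
  by (simp_all add: cross_def algebra_simps)

lemma cross_self [simp]: "cross p p = 0"
  by (simp add: cross_def)

lemma cross_swap: "cross p q = - cross q p"
  by (simp add: cross_def)

text \<open>A cyclic sequence of positively oriented cones cannot get past the direction of \<open>p\<close>
  without covering it, and cannot turn left forever while staying on one side of \<open>p\<close>.\<close>

lemma hcones_cover:
  fixes p :: plane
  assumes fin: "finite R" and ne: "R \<noteq> {}" and ran: "Range R \<subseteq> Domain R"
    and det: "\<And>u v. (u, v) \<in> R \<Longrightarrow> det2 u v = 1" and p: "p \<noteq> 0"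
  shows "\<exists>(u, v)\<in>R. p \<in> hcone u v"
proof (rule ccontr)
  assume none: "\<not> ?thesis"
  have step: "0 \<le> cross (real_pt v) p" if "(u, v) \<in> R" "0 \<le> cross (real_pt u) p" for u v
  proof (rule ccontr)
    assume "\<not> 0 \<le> cross (real_pt v) p"
    then have "p \<in> hcone u v"
      using that(2) cross_swap[of p "real_pt v"] by (simp add: hcone_def)
    then show False using none that(1) by blast
  qed
  have fD: "finite (Domain R)"
    using fin by (simp add: finite_Domain)
  have succ: "\<exists>v. (u, v) \<in> R \<and> v \<in> Domain R" if "u \<in> Domain R" for u
    using that ran by blast
  \<comment> \<open>No vertex lies on the ray of \<open>p\<close> itself: the arc leaving it would
    end strictly to the left of \<open>p\<close>, against \<open>step\<close>.\<close>
  have zero: False if uv: "(u, v) \<in> R" and c0: "cross (real_pt u) p = 0" and pos: "0 \<le> c" and u: "real_pt u = c *\<^sub>R p" for u v c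
  proof -
    have "c * cross p (real_pt v) = 1"
      using det[OF uv] cross_real_pt[of u v] u by simp
    then have "cross p (real_pt v) > 0"
      using pos zero_less_mult_iff[of c "cross p (real_pt v)"] by simp
    then show False
      using step[OF uv] c0 cross_swap[of p "real_pt v"] by simp
  qed
  show False
  proof (cases "\<exists>u\<in>Domain R. 0 \<le> cross (real_pt u) p")
    case False
    have "\<exists>v\<in>Domain R. det2 u v > 0" if "u \<in> Domain R" for u
      using succ[OF that] det by (metis zero_less_one)
    moreover have "cross (real_pt u) p * cross (real_pt v) p > 0"
      if "u \<in> Domain R" "v \<in> Domain R" for u v
      using False that by (intro mult_neg_neg) (simp_all add: not_le)
    moreover have "Domain R \<noteq> {}" using ne by (simp add: Domain_empty_iff)
    ultimately show False
      using fD no_finite_left_turning_set[of "Domain R" p] by blast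
  next
    case True
    then obtain a where a: "a \<in> Domain R" "0 \<le> cross (real_pt a) p" by blast
    \<comment> \<open>The turning lemma needs a strict sign, so vertices on the line of
      \<open>p\<close> are dropped. By \<open>zero\<close> they lie on the ray opposite to
      \<open>p\<close>; such a vertex is never reached from \<open>B\<close> and is followed by one
      in \<open>B\<close>.\<close>
    define B where "B = {u \<in> Domain R. 0 < cross (real_pt u) p}"
    have stepB: "w \<in> B" if uv: "(u, v) \<in> R" and u: "0 < cross (real_pt u) p" and "w = v" for u v w
    proof -
      have v: "v \<in> Domain R" "0 \<le> cross (real_pt v) p"
        using step[OF uv] uv u ran by (blast, simp)
      have "cross (real_pt v) p \<noteq> 0"
      proof
        assume c0: "cross (real_pt v) p = 0"
        then obtain c where c: "real_pt v = c *\<^sub>R p"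
          using cross_eq_0_cases p by blast
        have "c * cross (real_pt u) p = 1"
          using det[OF uv] cross_real_pt[of u v] c by simp
        then have "c > 0"
          using u zero_less_mult_iff[of c "cross (real_pt u) p"] by simp
        moreover obtain w where vw: "(v, w) \<in> R"
          using v by blast
        ultimately show False
          using zero[OF vw c0 _ c] by simp
      qed
      then show ?thesis
        using v \<open>w = v\<close> by (simp add: B_def order_less_le)
    qed
    have "B \<noteq> {}"
    proof (cases "cross (real_pt a) p = 0")
      case False
      then have "a \<in> B" using a by (simp add: B_def)
      then show ?thesis by blast
    next
      case True
      obtain b where b: "(a, b) \<in> R" "b \<in> Domain R" using succ a by blast
      obtain c where c: "real_pt a = c *\<^sub>R p" using True cross_eq_0_cases p by blast
      have "c < 0"
        using zero[OF b(1) True _ c] not_le by blast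
      moreover have "c * cross p (real_pt b) = 1"
        using det[OF b(1)] cross_real_pt[of a b] c by simp
      ultimately have "cross p (real_pt b) < 0"
        using zero_less_mult_iff[of c "cross p (real_pt b)"] by simp
      then have "b \<in> B"
        using b(2) cross_swap[of p "real_pt b"] by (simp add: B_def)
      then show ?thesis by blast
    qed
    moreover have "finite B" using fD by (simp add: B_def)
    moreover have "\<exists>v\<in>B. det2 u v > 0" if "u \<in> B" for u
    proof -
      have u: "u \<in> Domain R" "0 < cross (real_pt u) p" using that by (simp_all add: B_def)
      obtain v where "(u, v) \<in> R" using u(1) by blast
      then show ?thesis using stepB[OF _ u(2) refl] det[of u v] by (metis zero_less_one)
    qed
    moreover have "cross (real_pt u) p * cross (real_pt v) p > 0" if "u \<in> B" "v \<in> B" for u v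
      using that by (simp add: B_def)
    ultimately show False
      using no_finite_left_turning_set[of B p] by blast
  qed
qed

section \<open>Vertices and neighbours in an arc system\<close>

locale circ_fan =
  fixes R :: "lattice rel"
  assumes fin: "finite R" and ne: "R \<noteq> {}" and Range_eq: "Range R = Domain R"
    and det: "(u, v) \<in> R \<Longrightarrow> det2 u v = 1"
    and disj: "(u, v) \<in> R \<Longrightarrow> (u', v') \<in> R \<Longrightarrow> p \<in> hcone u v \<Longrightarrow> p \<in> hcone u' v' \<Longrightarrow> u = u' \<and> v = v'"
begin

text \<open>Weight \<open>-1\<close> expressed through arcs alone, because the locale carries no
  weights; \<open>exc_iff\<close> makes the link.\<close>

definition exc :: "lattice \<Rightarrow> bool" where
  "exc z \<longleftrightarrow> (\<exists>u w. (u, z) \<in> R \<and> (z, w) \<in> R \<and> u + w = z)"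

lemma finV: "finite (Domain R)"
  using fin by (simp add: finite_Domain)

lemma succE: assumes "u \<in> Domain R" obtains v where "(u, v) \<in> R" "v \<in> Domain R"
  using assms Range_eq by blast

lemma predE: assumes "u \<in> Domain R" obtains v where "(v, u) \<in> R" "v \<in> Domain R"
  using assms Range_eq by blast

lemma inV: "(u, v) \<in> R \<Longrightarrow> u \<in> Domain R \<and> v \<in> Domain R"
  using Range_eq by blast

lemma V_nonzero: "z \<in> Domain R \<Longrightarrow> z \<noteq> 0"
proof
  assume "z \<in> Domain R" "z = 0"
  then obtain v where "(0, v) \<in> R" by blast
  then show False using det[of 0 v] by simp
qed

text \<open>A vertex lies in the half-open cone of the arc leaving it, hence in no other. Positional
  arguments below are mostly sign checks followed by this lemma.\<close>

lemma vertex_in_hcone: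
  assumes "z \<in> Domain R" "(u, v) \<in> R" "0 \<le> det2 u z" "0 < det2 z v"
  shows "z = u"
proof -
  obtain s where "(z, s) \<in> R" using assms succE by blast
  then show ?thesis
    using disj[of z s u v "real_pt z"] assms det by (simp add: real_pt_in_hcone)
qed

lemma ray_unique:
  assumes "z \<in> Domain R" "w \<in> Domain R" "z = zscale k w" "k \<ge> 0"
  shows "z = w"
proof -
  obtain s where s: "(w, s) \<in> R" using assms succE by blast
  have "k \<noteq> 0" using assms V_nonzero[of z] by fastforce
  then show ?thesis
    using vertex_in_hcone[OF assms(1) s] assms det[OF s] by simp
qed

lemma succ_unique: "(u, v) \<in> R \<Longrightarrow> (u, v') \<in> R \<Longrightarrow> v = v'"
  using disj[of u v u v' "real_pt u"] det by (simp add: real_pt_in_hcone)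

text \<open>The cones omit their second ray, so disjointness says nothing directly about two arcs
  ending in \<open>v\<close>. But whichever of \<open>u\<close> and \<open>u'\<close> is further
  counterclockwise lies in the half-open cone of the other arc.\<close>

lemma pred_unique:
  assumes "(u, v) \<in> R" "(u', v) \<in> R"
  shows "u = u'"
proof (cases "det2 u u' \<ge> 0")
  case True
  then show ?thesis
    using vertex_in_hcone[of u' u v] assms det by auto
next
  case False
  then show ?thesis
    using vertex_in_hcone[of u u' v] assms det det2_swap[of u u'] by auto
qed

text \<open>The arcs leaving \<open>A\<close> satisfy the hypotheses of \<open>hcones_cover\<close>
  by themselves, so their cones already contain every vertex, and a vertex lies only in the cone of
  its own arc. This is the connectedness of the cycle.\<close>

lemma closed_subset_eq:
  assumes "A \<subseteq> Domain R" "A \<noteq> {}" "\<And>u v. u \<in> A \<Longrightarrow> (u, v) \<in> R \<Longrightarrow> v \<in> A"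
  shows "A = Domain R"
proof -
  let ?S = "R \<inter> A \<times> UNIV"
  have "z \<in> A" if z: "z \<in> Domain R" for z
  proof -
    have "\<exists>(u, v)\<in>?S. real_pt z \<in> hcone u v"
    proof (rule hcones_cover)
      show "Range ?S \<subseteq> Domain ?S"
      proof
        fix y assume "y \<in> Range ?S"
        then have "y \<in> A" using assms by blast
        then show "y \<in> Domain ?S" using assms(1) by blast
      qed
      show "?S \<noteq> {}" using assms(1,2) by blast
      show "real_pt z \<noteq> 0" using V_nonzero[OF z] by simp
      show "finite ?S" using fin by blast
      show "det2 u v = 1" if "(u, v) \<in> ?S" for u v using det that by blast
    qed
    then obtain u v where uv: "u \<in> A" "(u, v) \<in> R" "real_pt z \<in> hcone u v" by blast
    then show ?thesis
      using vertex_in_hcone[OF z uv(2)] by (simp add: real_pt_in_hcone)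
  qed
  then show ?thesis using assms(1) by blast
qed

text \<open>If no maximiser of \<open>h\<close> is exceptional, then each is the midpoint of its two neighbours, so the
  set of maximisers is closed under passing to the successor.\<close>

lemma exceptional_at_maximum:
  fixes h :: "lattice \<Rightarrow> int"
  assumes add: "\<And>p q. h (p + q) = h p + h q" and scale: "\<And>k p. h (zscale k p) = k * h p"
    and m: "m > 0" "\<And>z. z \<in> Domain R \<Longrightarrow> h z \<le> m"
    and a: "a \<in> Domain R" "h a = m" and b: "b \<in> Domain R" "h b \<noteq> m"
    and nb: "\<And>u z w. (u, z) \<in> R \<Longrightarrow> (z, w) \<in> R \<Longrightarrow> h z = m \<Longrightarrow> h u + h w > 0"
  shows "\<exists>z\<in>Domain R. h z = m \<and> exc z"
proof (rule ccontr)
  assume none: "\<not> ?thesis"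
  let ?M = "{z \<in> Domain R. h z = m}"
  have "w \<in> ?M" if z: "z \<in> ?M" and zw: "(z, w) \<in> R" for z w
  proof -
    obtain u where uz: "(u, z) \<in> R" "u \<in> Domain R" using z predE by blast
    define c where "c = det2 u w"
    have eq: "u + w = zscale c z"
      using add_eq_zscale_det2[of u z w] det uz zw c_def by simp
    have hs: "h u + h w = c * m"
      using arg_cong[OF eq, of h] z by (simp add: add scale)
    have le: "h u \<le> m" "h w \<le> m" "w \<in> Domain R"
      using m(2) uz zw inV by blast+
    have "c > 0"
      using nb[OF uz(1) zw] z hs m(1) by (simp add: zero_less_mult_iff)
    moreover have "c \<noteq> 1"
    proof
      assume "c = 1"
      then have "exc z" unfolding exc_def using eq uz zw zscale_simps(2) by metis
      then show False using none z by blast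
    qed
    ultimately have "c * m \<ge> 2 * m"
      using m(1) by (intro mult_right_mono) auto
    then show ?thesis using hs le by auto
  qed
  then have "?M = Domain R"
    using a closed_subset_eq[of ?M] by blast
  then show False using b by blast
qed

section \<open>Existence of weights \<open>-1\<close>\<close>

text \<open>\<open>det2 z e\<close> measures the height above the line of \<open>e\<close>. A
  highest vertex has neighbours of nonnegative height, because \<open>e\<close> and
  \<open>- e\<close> are vertices themselves, and not both of height 0, because a second vertex lies
  above the line; so \<open>exceptional_at_maximum\<close> applies.\<close>

lemma exceptional_in_half_plane:
  assumes e: "e \<in> Domain R" "- e \<in> Domain R"
    and y: "y1 \<in> Domain R" "y2 \<in> Domain R" "y1 \<noteq> y2" "det2 y1 e > 0" "det2 y2 e > 0"
  shows "\<exists>z\<in>Domain R. det2 z e > 0 \<and> exc z"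
proof -
  define h where "h z = det2 z e" for z
  define m where "m = Max (h ` Domain R)"
  have m_ge: "h z \<le> m" if "z \<in> Domain R" for z
    using that finV by (simp add: m_def)
  then have m_pos: "m > 0"
    using y(1,4) unfolding h_def by (metis less_le_trans)
  have "m \<in> h ` Domain R"
    unfolding m_def using finV e by (intro Max_in) auto
  then obtain a where a: "a \<in> Domain R" "h a = m" by blast
  have nb: "h u + h w > 0" if uz: "(u, z) \<in> R" and zw: "(z, w) \<in> R" and hz: "h z = m" for u z w
  proof -
    have "h w \<ge> 0"
    proof (rule ccontr)
      assume "\<not> h w \<ge> 0"
      then have "e = z"
        using vertex_in_hcone[OF e(1) zw] hz m_pos det2_swap[of e w] by (simp add: h_def)
      then show False using hz m_pos h_def by simp
    qed
    moreover have "h u \<ge> 0"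
    proof (rule ccontr)
      assume "\<not> h u \<ge> 0"
      then have "- e = u"
        using vertex_in_hcone[OF e(2) uz] hz m_pos det2_swap[of e z] by (simp add: h_def)
      then have "h u = 0" by (auto simp: h_def)
      then show False using \<open>\<not> h u \<ge> 0\<close> by simp
    qed
    \<comment> \<open>Neighbours on the line must be opposite, so the two cones at \<open>z\<close>
      fill the half-plane and leave no room for a vertex besides \<open>z\<close>.\<close>
    moreover have False if hu: "h u = 0" and hw: "h w = 0"
    proof -
      have "det2 u w * m = 0"
        using arg_cong[OF add_eq_zscale_det2[OF det[OF uz] det[OF zw]], of h] hu hw hz by (simp add: h_def)
      then have w: "w = - u"
        using m_pos add_eq_zscale_det2[OF det[OF uz] det[OF zw]] by (simp add: add_eq_0_iff)
      have "y = z" if y: "y \<in> Domain R" "h y > 0" for y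
      proof -
        have "h y = det2 u y * m"
          using plucker[of u z y e] det[OF uz] hu hz by (simp add: h_def)
        then have uy: "det2 u y > 0"
          using y m_pos by (simp add: zero_less_mult_iff)
        show ?thesis
        proof (cases "det2 y z > 0")
          case True
          then show ?thesis using vertex_in_hcone[OF y(1) uz] uy by simp
        next
          case False
          then show ?thesis
            using vertex_in_hcone[OF y(1) zw] uy det2_swap[of z y] det2_swap[of y u] w by simp
        qed
      qed
      then show False using y by (metis h_def)
    qed
    ultimately show ?thesis by force
  qed
  have "\<exists>z\<in>Domain R. h z = m \<and> exc z"
    by (rule exceptional_at_maximum[where a = a and b = e]) (use m_pos m_ge a e nb in \<open>auto simp: h_def\<close>)
  then show ?thesis using m_pos h_def by force
qed

text \<open>The two half-open cones cover the closed half-plane up to the origin and the ray of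
  \<open>w\<close>, on which \<open>ray_unique\<close> leaves only \<open>w\<close> itself.\<close>

lemma opposite_vertices_cover:
  assumes "(u, v) \<in> R" "w = - u" "w \<in> Domain R" "(v, w) \<in> R" and z: "z \<in> Domain R" "det2 z u \<le> 0"
  shows "z \<in> {u, v, w}"
proof (cases "det2 z v > 0")
  case True
  then show ?thesis using vertex_in_hcone[OF z(1) assms(1)] z(2) det2_swap[of u z] by simp
next
  case F: False
  show ?thesis
  proof (cases "det2 z u = 0")
    case True
    then have "z = zscale (det2 v z) w"
      using unimodular_expansion[OF det[OF assms(1)], of z] det2_swap[of u z] det2_swap[of v z] assms(2)
      by (simp add: zscale_def prod_eq_iff)
    moreover have "0 \<le> det2 v z" using F det2_swap[of v z] by simp
    ultimately have "z = w"
      using ray_unique[OF z(1) assms(3)] by blast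
    then show ?thesis by blast
  next
    case False
    then show ?thesis
      using vertex_in_hcone[OF z(1) assms(4)] F z(2) det2_swap[of v z] assms(2) by simp
  qed
qed

lemma two_outside:
  assumes "finite F" "card F + 2 \<le> card (Domain R)"
  obtains y1 y2 where "y1 \<in> Domain R" "y2 \<in> Domain R" "y1 \<noteq> y2" "y1 \<notin> F" "y2 \<notin> F"
proof -
  have "card (Domain R - F) \<ge> 2"
    using assms diff_card_le_card_Diff[OF assms(1), of "Domain R"] by linarith
  then obtain T where "T \<subseteq> Domain R - F" "card T = 2"
    by (meson obtain_subset_with_card_n)
  moreover then obtain y1 y2 where "T = {y1, y2}" "y1 \<noteq> y2"
    unfolding card_2_iff by blast
  ultimately show thesis
    using that[of y1 y2] by blast
qed

text \<open>At a vertex \<open>v\<close> of maximal norm the parallelogram law bounds the weight: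
  \<open>u + w = zscale b v\<close> with distinct \<open>u\<close>, \<open>w\<close> no longer than
  \<open>v\<close> gives \<open>b * b < 4\<close>. The three values of \<open>b\<close> mean that
  \<open>v\<close> is exceptional, that its neighbours are opposite, or that
  \<open>u + v + w = 0\<close>.\<close>

lemma exceptional_exists:
  assumes n: "5 \<le> card (Domain R)"
  shows "\<exists>z\<in>Domain R. exc z"
proof -
  define q where "q z = fst z * fst z + snd z * snd z" for z :: lattice
  have "Max (q ` Domain R) \<in> q ` Domain R"
    using finV ne by (intro Max_in) auto
  then obtain v where v: "v \<in> Domain R" "q v = Max (q ` Domain R)" by force
  then have qv: "q z \<le> q v" if "z \<in> Domain R" for z
    using finV that by simp
  obtain u where uv: "(u, v) \<in> R" "u \<in> Domain R" using v predE by blast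
  obtain w where vw: "(v, w) \<in> R" "w \<in> Domain R" using v succE by blast
  define b where "b = det2 u w"
  have eq: "u + w = zscale b v"
    using add_eq_zscale_det2[OF det[OF uv(1)] det[OF vw(1)]] b_def by simp
  have uw: "u \<noteq> w" using det[OF uv(1)] det[OF vw(1)] det2_swap[of v w] by auto
  have "q (u + w) + q (u - w) = 2 * q u + 2 * q w"
    by (simp add: q_def algebra_simps)
  moreover have "q (u - w) > 0"
  proof -
    have "fst (u - w) \<noteq> 0 \<or> snd (u - w) \<noteq> 0" using uw by (auto simp: prod_eq_iff)
    then show ?thesis unfolding q_def by (metis not_sum_squares_lt_zero not_less_iff_gr_or_eq sum_squares_eq_zero_iff)
  qed
  moreover have "q (u + w) = b * b * q v"
    by (simp add: eq q_def zscale_def algebra_simps)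
  ultimately have "b * b * q v < 4 * q v"
    using qv[OF uv(2)] qv[OF vw(2)] by linarith
  moreover have "q v \<ge> 0" by (simp add: q_def)
  ultimately have "b * b < 4" by (meson mult_less_cancel_right_disj not_le)
  then have b_cases: "b = - 1 \<or> b = 0 \<or> b = 1"
  proof -
    have "\<not> b \<ge> 2" 
      using \<open>b * b < 4\<close> mult_mono[of 2 b 2 b] by auto
    moreover have "\<not> b \<le> - 2" 
      using \<open>b * b < 4\<close> mult_mono[of 2 "- b" 2 "- b"] by auto
    ultimately show ?thesis by linarith
  qed
  have card3: "card {u, v, w} \<le> 3" by (simp add: card_insert_if)
  obtain y1 y2 where y: "y1 \<in> Domain R" "y2 \<in> Domain R" "y1 \<noteq> y2" "y1 \<notin> {u, v, w}" "y2 \<notin> {u, v, w}"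
  proof -
    have "finite {u, v, w}" "card {u, v, w} + 2 \<le> card (Domain R)" using card3 n by (simp, linarith)
    from two_outside[OF this] show thesis using that by blast
  qed
  consider "b = 1" | "b = 0" | "b = - 1" using b_cases by blast
  then show ?thesis
  proof cases
    case 1
    then have "exc v" unfolding exc_def using eq uv(1) vw(1) zscale_simps(2) by metis
    then show ?thesis using v(1) by blast
  next
    case 2
    then have w: "w = - u" using eq by (simp add: add_eq_0_iff)
    have "det2 y1 u > 0" "det2 y2 u > 0"
      using opposite_vertices_cover[OF uv(1) w vw(2,1)] y by (meson not_le)+
    then show ?thesis
      using exceptional_in_half_plane[of u y1 y2] y uv vw w by blast
  next
    case 3
    then have "u + w = - v" using eq by (simp only: zscale_simps)
    then have sum0: "u + v + w = 0" by (metis add.assoc add.commute add.right_inverse)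
    have s0: "det2 u z + det2 v z + det2 w z = 0" for z
      using arg_cong[OF sum0, of "\<lambda>p. det2 p z"] by simp
    \<comment> \<open>The coordinate sum in the basis \<open>w\<close>, \<open>u\<close>. All
      vertices besides \<open>u\<close>, \<open>v\<close>, \<open>w\<close> lie inside the cone of
      \<open>w\<close> and \<open>u\<close>, where both coordinates are positive integers; so
      \<open>h\<close> is at least 2 there, 1 at \<open>u\<close> and \<open>w\<close>, and negative
      only at \<open>v\<close>.\<close>
    define h where "h z = det2 z u + det2 w z" for z
    have uvw: "det2 u v = 1" "det2 v w = 1" "det2 w u = 1"
      using det[OF uv(1)] det[OF vw(1)] s0[of u] det2_swap[of u v] by auto
    have outside: "h z \<ge> 2" if z: "z \<in> Domain R" "z \<notin> {u, v, w}" for z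
    proof -
      have n1: "\<not> (0 \<le> det2 u z \<and> 0 < det2 z v)" "\<not> (0 \<le> det2 v z \<and> 0 < det2 z w)"
        using vertex_in_hcone[OF z(1) uv(1)] vertex_in_hcone[OF z(1) vw(1)] z(2) by blast+
      have nz: "\<not> (det2 w z = 0 \<and> det2 z u \<ge> 0)"
      proof
        assume a: "det2 w z = 0 \<and> det2 z u \<ge> 0"
        then have "z = zscale (det2 z u) w"
          using unimodular_expansion[OF uvw(3), of z] by simp
        then show False using ray_unique[OF z(1) vw(2)] a z(2) by blast
      qed
      show ?thesis
        using n1 nz s0[of z] det2_swap[of z u] det2_swap[of z v] det2_swap[of z w] unfolding h_def by linarith
    qed
    define m where "m = Max (h ` Domain R)"
    have m_ge: "h z \<le> m" if "z \<in> Domain R" for z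
      using that finV by (simp add: m_def)
    have m2: "m \<ge> 2" using outside[of y1] m_ge[of y1] y by linarith
    have "m \<in> h ` Domain R"
      unfolding m_def using finV ne by (intro Max_in) (simp_all add: Domain_empty_iff)
    then obtain a where a: "a \<in> Domain R" "h a = m" by blast
    have huvw: "h u = 1" "h v = - 2" "h w = 1"
      using uvw det2_swap[of v u] det2_swap[of w v] by (simp_all add: h_def)
    have h1: "h z \<ge> 1" if "z \<in> Domain R" "z \<noteq> v" for z
      using outside[of z] huvw that by (cases "z = u \<or> z = w") auto
    \<comment> \<open>A maximiser is neither \<open>u\<close> nor \<open>w\<close>, hence not
      adjacent to \<open>v\<close>, the only vertex where \<open>h\<close> is below 1.\<close>
    have nb: "h x + h y > 0" if "(x, z) \<in> R" "(z, y) \<in> R" "h z = m" for x y z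
    proof -
      have "x \<noteq> v" "y \<noteq> v"
      proof -
        have "z \<noteq> u" "z \<noteq> w" using that(3) huvw m2 by auto
        then show "x \<noteq> v" "y \<noteq> v"
          using that(1,2) succ_unique[of v z w] pred_unique[of z v u] uv(1) vw(1) by blast+
      qed
      then have "h x \<ge> 1" "h y \<ge> 1" using h1 inV that by blast+
      then show ?thesis by simp
    qed
    have "\<exists>z\<in>Domain R. h z = m \<and> exc z"
      by (rule exceptional_at_maximum[where a = a and b = v])
        (use m2 m_ge a v(1) nb huvw in \<open>simp_all add: h_def algebra_simps\<close>)
    then show ?thesis by blast
  qed
qed

text \<open>The two equations give \<open>w = - t\<close>, and the arcs from \<open>t\<close> to
  \<open>w\<close> fill one closed half-plane. At least two of six vertices lie strictly beyond it,
  where \<open>exceptional_in_half_plane\<close> yields one with \<open>det2 z t > 0\<close>; at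
  \<open>u\<close> and \<open>v\<close> this determinant is negative.\<close>

lemma third_exceptional:
  assumes R: "(t, u) \<in> R" "(u, v) \<in> R" "(v, w) \<in> R" and e: "t + v = u" "u + w = v"
    and n: "6 \<le> card (Domain R)"
  shows "\<exists>z\<in>Domain R. z \<noteq> u \<and> z \<noteq> v \<and> exc z"
proof -
  have "v + (t + w) = (t + v) + w" by (simp only: ac_simps)
  then have "v + (t + w) = v" by (simp only: e)
  then have w: "w = - t" by (simp only: add_cancel_left_right add_eq_0_iff)
  have D: "t \<in> Domain R" "u \<in> Domain R" "v \<in> Domain R" "w \<in> Domain R" using R inV by blast+
  have tv: "det2 t v = 1" using det[OF R(1)] e(1)[symmetric] by simp
  have up: "z \<in> {t, u, v, w}" if z: "z \<in> Domain R" "det2 z t \<le> 0" for z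
  proof (rule ccontr)
    assume no: "z \<notin> {t, u, v, w}"
    have 1: "\<not> (0 \<le> det2 t z \<and> 0 < det2 z u)" "\<not> (0 \<le> det2 u z \<and> 0 < det2 z v)"
      "\<not> (0 \<le> det2 v z \<and> 0 < det2 z w)"
      using vertex_in_hcone[OF z(1)] R no by blast+
    then have "det2 z t = 0" "0 \<le> det2 v z"
      using z(2) w det2_swap[of t z] det2_swap[of u z] det2_swap[of v z] by auto
    then have "z = zscale (det2 v z) w"
      using unimodular_expansion[OF tv, of z] det2_swap[of t z] det2_swap[of v z] w
      by (simp add: zscale_def prod_eq_iff)
    then show False using ray_unique[OF z(1) D(4)] \<open>0 \<le> det2 v z\<close> no by blast
  qed
  have "card {t, u, v, w} \<le> 4" by (simp add: card_insert_if)
  then have "card {t, u, v, w} + 2 \<le> card (Domain R)" using n by linarith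
  then obtain y1 y2 where y: "y1 \<in> Domain R" "y2 \<in> Domain R" "y1 \<noteq> y2" "y1 \<notin> {t, u, v, w}" "y2 \<notin> {t, u, v, w}"
  proof -
    have "finite {t, u, v, w}" by simp
    from two_outside[OF this \<open>card {t, u, v, w} + 2 \<le> card (Domain R)\<close>] show thesis using that by blast
  qed
  have "det2 y1 t > 0" "det2 y2 t > 0"
    using up y by (meson not_le)+
  then have "\<exists>z\<in>Domain R. det2 z t > 0 \<and> exc z"
    using exceptional_in_half_plane[of t y1 y2] D w y by blast
  moreover have "det2 u t < 0" "det2 v t < 0"
    using det[OF R(1)] tv det2_swap[of t u] det2_swap[of t v] by simp_all
  ultimately show ?thesis by (metis less_asym)
qed

lemma sum_not_vertex: "(u, v) \<in> R \<Longrightarrow> u + v \<notin> Domain R"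
  using vertex_in_hcone[of "u + v" u v] det[of u v] V_nonzero[of v] inV[of u v] by auto

lemma not_both_arcs: "(u, v) \<in> R \<Longrightarrow> (v, u) \<notin> R"
  using det[of u v] det[of v u] det2_swap[of u v] by auto

end

section \<open>Blow-up and contraction of arc systems\<close>

definition blow_arcs :: "lattice \<Rightarrow> lattice \<Rightarrow> lattice rel \<Rightarrow> lattice rel" where
  "blow_arcs u v R = R - {(u, v)} \<union> {(u, u + v), (u + v, v)}"

lemma hcone_subdivision:
  "p \<in> hcone u v \<longleftrightarrow> p \<in> hcone u (u + v) \<or> p \<in> hcone (u + v) v"
  "\<not> (p \<in> hcone u (u + v) \<and> p \<in> hcone (u + v) v)"
proof -
  have "real_pt (u + v) = real_pt u + real_pt v" by (simp add: real_pt_def)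
  then show "p \<in> hcone u v \<longleftrightarrow> p \<in> hcone u (u + v) \<or> p \<in> hcone (u + v) v"
    "\<not> (p \<in> hcone u (u + v) \<and> p \<in> hcone (u + v) v)"
    using cross_swap[of p "real_pt u"] cross_swap[of p "real_pt v"]
    unfolding hcone_def mem_Collect_eq cross_add by auto
qed

context circ_fan
begin

lemma Domain_blow_arcs: "(u, v) \<in> R \<Longrightarrow> Domain (blow_arcs u v R) = insert (u + v) (Domain R)"
  and Range_blow_arcs: "(u, v) \<in> R \<Longrightarrow> Range (blow_arcs u v R) = insert (u + v) (Range R)"
  unfolding blow_arcs_def by blast+

text \<open>Both new cones lie inside the old cone of \<open>u\<close> and \<open>v\<close>, so they
  inherit disjointness from all other arcs, and \<open>hcone_subdivision\<close> separates them from
  each other.\<close>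

lemma circ_fan_blow_arcs:
  assumes uv: "(u, v) \<in> R"
  shows "circ_fan (blow_arcs u v R)"
proof
  show "finite (blow_arcs u v R)" "blow_arcs u v R \<noteq> {}"
    using fin by (simp_all add: blow_arcs_def)
  show "Range (blow_arcs u v R) = Domain (blow_arcs u v R)"
    by (simp add: Domain_blow_arcs Range_blow_arcs uv Range_eq)
  show "det2 a b = 1" if "(a, b) \<in> blow_arcs u v R" for a b
    using that det[OF uv] det[of a b] by (auto simp only: blow_arcs_def det2_simps Un_iff Diff_iff insert_iff prod.inject empty_iff)
  show "a = a' \<and> b = b'"
    if ab: "(a, b) \<in> blow_arcs u v R" "(a', b') \<in> blow_arcs u v R" and p: "p \<in> hcone a b" "p \<in> hcone a' b'" for a b a' b' p
  proof -
    have old: "(a, b) \<in> R \<and> (a, b) \<noteq> (u, v) \<or> (a, b) = (u, u + v) \<or> (a, b) = (u + v, v)"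
      "(a', b') \<in> R \<and> (a', b') \<noteq> (u, v) \<or> (a', b') = (u, u + v) \<or> (a', b') = (u + v, v)"
      using ab unfolding blow_arcs_def by blast+
    then have "p \<in> hcone u v \<or> (a, b) \<in> R \<and> (a, b) \<noteq> (u, v)" "p \<in> hcone u v \<or> (a', b') \<in> R \<and> (a', b') \<noteq> (u, v)"
      using p hcone_subdivision(1)[of p u v] by blast+
    then show ?thesis
      using old p disj[OF uv, of a b p] disj[OF uv, of a' b' p] disj[of a b a' b' p] hcone_subdivision(2)[of p u v]
      by auto
  qed
qed

text \<open>The two removed cones together make up the cone of \<open>u\<close> and
  \<open>v\<close>, so the new arc meets no other cone; it is unimodular because
  \<open>det2 u (u + v) = det2 u v\<close>.\<close>

lemma contract_arcs:
  assumes R: "(u, m) \<in> R" "(m, v) \<in> R" and m: "m = u + v"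
  defines "S \<equiv> R - {(u, m), (m, v)} \<union> {(u, v)}"
  shows "circ_fan S" "Domain S = Domain R - {m}" "blow_arcs u v S = R" "(u, v) \<in> S"
proof -
  have uv: "det2 u v = 1" using det[OF R(1)] m by simp
  have ne': "u \<noteq> m" "v \<noteq> m" "u \<noteq> v"
    using uv det[OF R(1)] det[OF R(2)] det2_eq_1_nonzero by blast+
  \<comment> \<open>Otherwise blowing up again would delete an arc that was there before the
    contraction, and \<open>blow_arcs u v S\<close> would not give back \<open>R\<close>.\<close>
  have nuv: "(u, v) \<notin> R" using sum_not_vertex[of u v] m inV[OF R(2)] by blast
  show D: "Domain S = Domain R - {m}"
  proof (intro equalityI subsetI)
    fix x assume "x \<in> Domain S"
    then obtain y where y: "(x, y) \<in> S" by blast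
    then have "x \<in> Domain R" using inV[OF R(1)] S_def by blast
    moreover have "x \<noteq> m" using y succ_unique[OF R(2)] ne' unfolding S_def by blast
    ultimately show "x \<in> Domain R - {m}" by blast
  next
    fix x assume x: "x \<in> Domain R - {m}"
    then obtain y where "(x, y) \<in> R" by blast
    then show "x \<in> Domain S" using x S_def by blast
  qed
  have Ra: "Range S = Domain R - {m}"
  proof (intro equalityI subsetI)
    fix x assume "x \<in> Range S"
    then obtain y where y: "(y, x) \<in> S" by blast
    then have "x \<in> Domain R" using inV R S_def by blast
    moreover have "x \<noteq> m" using y pred_unique[OF R(1)] ne' unfolding S_def by blast
    ultimately show "x \<in> Domain R - {m}" by blast
  next
    fix x assume x: "x \<in> Domain R - {m}"
    then obtain y where "(y, x) \<in> R" using Range_eq by blast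
    then show "x \<in> Range S" using x S_def by blast
  qed
  show "(u, v) \<in> S" by (simp add: S_def)
  show "blow_arcs u v S = R"
    unfolding blow_arcs_def S_def using R nuv m by blast
  show "circ_fan S"
  proof
    show "finite S" "S \<noteq> {}" using fin by (simp_all add: S_def)
    show "Range S = Domain S" using D Ra by simp
    show "det2 a b = 1" if "(a, b) \<in> S" for a b
      using that uv det[of a b] unfolding S_def by blast
    show "a = a' \<and> b = b'"
      if ab: "(a, b) \<in> S" "(a', b') \<in> S" and p: "p \<in> hcone a b" "p \<in> hcone a' b'" for a b a' b' p
    proof -
      have sub: "p \<in> hcone u v \<Longrightarrow> p \<in> hcone u m \<or> p \<in> hcone m v"
        using hcone_subdivision(1)[of p u v] m by blast
      have old: "(a, b) \<in> R \<and> (a, b) \<noteq> (u, m) \<and> (a, b) \<noteq> (m, v) \<or> (a, b) = (u, v)"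
        "(a', b') \<in> R \<and> (a', b') \<noteq> (u, m) \<and> (a', b') \<noteq> (m, v) \<or> (a', b') = (u, v)"
        using ab unfolding S_def by blast+
      then show ?thesis
        using p sub disj[OF R(1), of a b p] disj[OF R(2), of a b p] disj[OF R(1), of a' b' p] disj[OF R(2), of a' b' p]
          disj[of a b a' b' p] by auto
    qed
  qed
qed

end

section \<open>Cycles of four and five vectors\<close>

text \<open>Cramer's rule at \<open>x1\<close> and at \<open>x3\<close> gives \<open>x0 + x2\<close>
  as \<open>d\<close> times \<open>x1\<close> and as \<open>- d\<close> times \<open>x3\<close>,
  where \<open>d = det2 x0 x2\<close>; so \<open>d = 0\<close>, or \<open>x1\<close> and
  \<open>x3\<close> are parallel. In terms of weights, two opposite ones vanish.\<close>

lemma four_cycle: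
  assumes "det2 x0 x1 = 1" "det2 x1 x2 = 1" "det2 x2 x3 = 1" "det2 x3 x0 = 1"
  shows "det2 x0 x2 = 0 \<or> det2 x1 x3 = 0"
proof (rule ccontr)
  assume a: "\<not> ?thesis"
  have "x0 + x2 = zscale (det2 x0 x2) x1" "x2 + x0 = zscale (det2 x2 x0) x3"
    using add_eq_zscale_det2 assms by blast+
  then have "zscale (det2 x0 x2) x1 = zscale (- det2 x0 x2) x3"
    using det2_swap[of x2 x0] by (simp only: add.commute)
  from arg_cong[OF this, of "\<lambda>p. det2 p x3"] show False using a by simp
qed

text \<open>\<open>x0\<close> is the sum of its neighbours, so \<open>x1\<close>, \<open>x2\<close>,
  \<open>x3\<close>, \<open>x4\<close> form a four-cycle, and bilinearity expresses the weights at
  \<open>x1\<close> and \<open>x4\<close> through it.\<close>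

lemma five_cycle:
  assumes "det2 x0 x1 = 1" "det2 x1 x2 = 1" "det2 x2 x3 = 1" "det2 x3 x4 = 1" "det2 x4 x0 = 1"
    and x0: "det2 x4 x1 = 1"
  shows "(det2 x1 x3 = 0 \<or> det2 x2 x4 = 0) \<and> det2 x0 x2 = 1 - det2 x2 x4 \<and> det2 x3 x0 = 1 - det2 x1 x3"
proof -
  have "x0 = x1 + x4"
    using add_eq_zscale_det2[OF assms(5,1)] x0 by (simp add: add.commute)
  then show ?thesis
    using four_cycle[of x1 x2 x3 x4] assms det2_swap[of x4 x2] det2_swap[of x3 x1] by simp
qed

text \<open>Contract the exceptional one of \<open>u\<close> and \<open>v\<close>. Of the two
  opposite pairs in the remaining four-cycle whose weights may vanish, one would give weight
  \<open>-1\<close> to \<open>w\<close> or \<open>t\<close>, which is excluded; the other makes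
  \<open>u\<close> and \<open>v\<close> both exceptional.\<close>

lemma five_cycle_exceptional:
  assumes "det2 u v = 1" "det2 v w = 1" "det2 w z = 1" "det2 z t = 1" "det2 t u = 1"
    and "det2 t v = 1 \<or> det2 u w = 1" "det2 v z \<noteq> 1" "det2 z u \<noteq> 1"
  shows "det2 t v = 1 \<and> det2 u w = 1 \<and> det2 w t = 0 \<and> det2 v z = 1 - det2 z u"
  using assms(6)
proof
  assume "det2 t v = 1"
  from five_cycle[OF assms(1-5) this] show ?thesis using assms(7,8) \<open>det2 t v = 1\<close> by auto
next
  assume "det2 u w = 1"
  from five_cycle[OF assms(2-5,1) this] show ?thesis using assms(7,8) \<open>det2 u w = 1\<close> by auto
qed

section \<open>Two-dimensional cones and their faces\<close>

lemma lcone_pair: "lcone {u, v} = {s *\<^sub>R real_pt u + t *\<^sub>R real_pt v | s t. 0 \<le> s \<and> 0 \<le> t}"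
  unfolding lcone_def
proof (rule hull_unique, goal_cases)
  case 1
  have "real_pt u \<in> {s *\<^sub>R real_pt u + t *\<^sub>R real_pt v | s t. 0 \<le> s \<and> 0 \<le> t}"
    by (intro CollectI exI[of _ 1] exI[of _ 0]) simp
  moreover have "real_pt v \<in> {s *\<^sub>R real_pt u + t *\<^sub>R real_pt v | s t. 0 \<le> s \<and> 0 \<le> t}"
    by (intro CollectI exI[of _ 0] exI[of _ 1]) simp
  ultimately show ?case by simp
next
  case 2
  show ?case
    unfolding convex_cone_iff
  proof (intro conjI ballI allI impI)
    show "0 \<in> {s *\<^sub>R real_pt u + t *\<^sub>R real_pt v | s t. 0 \<le> s \<and> 0 \<le> t}"
      by (intro CollectI exI[of _ 0]) simp
  next
    fix x y assume "x \<in> {s *\<^sub>R real_pt u + t *\<^sub>R real_pt v | s t. 0 \<le> s \<and> 0 \<le> t}"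
      "y \<in> {s *\<^sub>R real_pt u + t *\<^sub>R real_pt v | s t. 0 \<le> s \<and> 0 \<le> t}"
    then obtain s t s' t' where "x = s *\<^sub>R real_pt u + t *\<^sub>R real_pt v" "y = s' *\<^sub>R real_pt u + t' *\<^sub>R real_pt v"
      "0 \<le> s" "0 \<le> t" "0 \<le> s'" "0 \<le> t'" by blast
    then show "x + y \<in> {s *\<^sub>R real_pt u + t *\<^sub>R real_pt v | s t. 0 \<le> s \<and> 0 \<le> t}"
      by (intro CollectI exI[of _ "s + s'"] exI[of _ "t + t'"]) (simp add: algebra_simps)
  next
    fix x and c :: real assume "x \<in> {s *\<^sub>R real_pt u + t *\<^sub>R real_pt v | s t. 0 \<le> s \<and> 0 \<le> t}" "0 \<le> c"
    then obtain s t where "x = s *\<^sub>R real_pt u + t *\<^sub>R real_pt v" "0 \<le> s" "0 \<le> t" by blast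
    then show "c *\<^sub>R x \<in> {s *\<^sub>R real_pt u + t *\<^sub>R real_pt v | s t. 0 \<le> s \<and> 0 \<le> t}"
      using \<open>0 \<le> c\<close> by (intro CollectI exI[of _ "c * s"] exI[of _ "c * t"]) (simp add: algebra_simps)
  qed
next
  case (3 S)
  show ?case
  proof
    fix x assume "x \<in> {s *\<^sub>R real_pt u + t *\<^sub>R real_pt v | s t. 0 \<le> s \<and> 0 \<le> t}"
    then obtain s t where "x = s *\<^sub>R real_pt u + t *\<^sub>R real_pt v" "0 \<le> s" "0 \<le> t" by blast
    then show "x \<in> S"
      using 3 by (simp add: convex_cone_add convex_cone_scaleR)
  qed
qed

lemma lcone_single: "lcone {u} = {s *\<^sub>R real_pt u | s. 0 \<le> s}"
proof -
  have "lcone {u} = {s *\<^sub>R real_pt u + t *\<^sub>R real_pt u | s t. 0 \<le> s \<and> 0 \<le> t}"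
    using lcone_pair[of u u] by simp
  also have "\<dots> = {s *\<^sub>R real_pt u | s. 0 \<le> s}"
  proof (intro equalityI subsetI)
    fix x assume "x \<in> {s *\<^sub>R real_pt u + t *\<^sub>R real_pt u | s t. 0 \<le> s \<and> 0 \<le> t}"
    then obtain s t where "x = s *\<^sub>R real_pt u + t *\<^sub>R real_pt u" "0 \<le> s" "0 \<le> t" by blast
    then show "x \<in> {s *\<^sub>R real_pt u | s. 0 \<le> s}"
      by (intro CollectI exI[of _ "s + t"]) (simp add: scaleR_add_left)
  next
    fix x assume "x \<in> {s *\<^sub>R real_pt u | s. 0 \<le> s}"
    then obtain s where "x = s *\<^sub>R real_pt u" "0 \<le> s" by blast
    then show "x \<in> {s *\<^sub>R real_pt u + t *\<^sub>R real_pt u | s t. 0 \<le> s \<and> 0 \<le> t}"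
      by (intro CollectI exI[of _ s] exI[of _ 0]) simp
  qed
  finally show ?thesis .
qed

lemma lcone_empty: "lcone {} = {0}"
  by (simp add: lcone_def)

lemma convex_lcone: "convex (lcone S)"
  by (simp add: lcone_def convex_convex_cone_hull)

lemma lcone_mono: "S \<subseteq> T \<Longrightarrow> lcone S \<subseteq> lcone T"
  by (simp add: lcone_def hull_mono image_mono)

lemma real_pt_in_lcone: "u \<in> S \<Longrightarrow> real_pt u \<in> lcone S"
  by (simp add: lcone_def hull_inc)

lemma unimodular_real_expansion:
  assumes "det2 u v = 1"
  shows "p = cross p (real_pt v) *\<^sub>R real_pt u + cross (real_pt u) p *\<^sub>R real_pt v"
proof -
  have d: "cross (real_pt u) (real_pt v) = 1" using assms by (simp add: cross_real_pt)
  have "cross (real_pt u) (real_pt v) * fst p = cross p (real_pt v) * fst (real_pt u) + cross (real_pt u) p * fst (real_pt v)"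
    "cross (real_pt u) (real_pt v) * snd p = cross p (real_pt v) * snd (real_pt u) + cross (real_pt u) p * snd (real_pt v)"
    unfolding cross_def by algebra+
  then show ?thesis unfolding d by (simp add: prod_eq_iff)
qed

lemma in_lcone_pair:
  assumes "det2 u v = 1"
  shows "p \<in> lcone {u, v} \<longleftrightarrow> 0 \<le> cross (real_pt u) p \<and> 0 \<le> cross p (real_pt v)"
proof
  assume "p \<in> lcone {u, v}"
  then obtain s t where st: "p = s *\<^sub>R real_pt u + t *\<^sub>R real_pt v" "0 \<le> s" "0 \<le> t"
    unfolding lcone_pair by blast
  have "cross (real_pt u) (real_pt v) = 1" using assms by (simp add: cross_real_pt)
  then show "0 \<le> cross (real_pt u) p \<and> 0 \<le> cross p (real_pt v)"
    using st by simp
next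
  assume "0 \<le> cross (real_pt u) p \<and> 0 \<le> cross p (real_pt v)"
  then show "p \<in> lcone {u, v}"
    unfolding lcone_pair using unimodular_real_expansion[OF assms, of p] by blast
qed

lemma in_lcone_left:
  assumes "det2 u v = 1"
  shows "p \<in> lcone {u} \<longleftrightarrow> 0 = cross (real_pt u) p \<and> 0 \<le> cross p (real_pt v)"
proof
  assume "p \<in> lcone {u}"
  then obtain s where st: "p = s *\<^sub>R real_pt u" "0 \<le> s"
    unfolding lcone_single by blast
  have "cross (real_pt u) (real_pt v) = 1" using assms by (simp add: cross_real_pt)
  then show "0 = cross (real_pt u) p \<and> 0 \<le> cross p (real_pt v)"
    using st by simp
next
  assume a: "0 = cross (real_pt u) p \<and> 0 \<le> cross p (real_pt v)"
  then have "p = cross p (real_pt v) *\<^sub>R real_pt u"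
    using unimodular_real_expansion[OF assms, of p] by simp
  then show "p \<in> lcone {u}"
    unfolding lcone_single using a by blast
qed

lemma in_lcone_right:
  assumes "det2 u v = 1"
  shows "p \<in> lcone {v} \<longleftrightarrow> 0 \<le> cross (real_pt u) p \<and> 0 = cross p (real_pt v)"
proof
  assume "p \<in> lcone {v}"
  then obtain s where st: "p = s *\<^sub>R real_pt v" "0 \<le> s"
    unfolding lcone_single by blast
  have "cross (real_pt u) (real_pt v) = 1" using assms by (simp add: cross_real_pt)
  then show "0 \<le> cross (real_pt u) p \<and> 0 = cross p (real_pt v)"
    using st by simp
next
  assume a: "0 \<le> cross (real_pt u) p \<and> 0 = cross p (real_pt v)"
  then have "p = cross (real_pt u) p *\<^sub>R real_pt v"
    using unimodular_real_expansion[OF assms, of p] by simp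
  then show "p \<in> lcone {v}"
    unfolding lcone_single using a by blast
qed

lemma rays_of_lcone_pair:
  assumes "det2 u v = 1"
  shows "lcone {u} face_of lcone {u, v}" "lcone {v} face_of lcone {u, v}" "{0} face_of lcone {u, v}"
proof -
  \<comment> \<open>The determinants are rewritten as inner products, so that the criterion for
    faces cut out by supporting hyperplanes applies.\<close>
  have c1: "cross (real_pt u) p = (- snd (real_pt u), fst (real_pt u)) \<bullet> p" for p
    by (simp add: cross_def inner_prod_def)
  have c2: "cross p (real_pt v) = (snd (real_pt v), - fst (real_pt v)) \<bullet> p" for p
    by (simp add: cross_def inner_prod_def)
  have "lcone {u, v} \<inter> {p. (- snd (real_pt u), fst (real_pt u)) \<bullet> p = 0} face_of lcone {u, v}"
    by (intro face_of_Int_supporting_hyperplane_ge convex_lcone) (simp add: in_lcone_pair[OF assms] c1[symmetric])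
  moreover have "lcone {u, v} \<inter> {p. (- snd (real_pt u), fst (real_pt u)) \<bullet> p = 0} = lcone {u}"
    by (rule set_eqI) (auto simp: in_lcone_pair[OF assms] in_lcone_left[OF assms] c1[symmetric])
  ultimately show 1: "lcone {u} face_of lcone {u, v}" by simp
  have "lcone {u, v} \<inter> {p. (snd (real_pt v), - fst (real_pt v)) \<bullet> p = 0} face_of lcone {u, v}"
    by (intro face_of_Int_supporting_hyperplane_ge convex_lcone) (simp add: in_lcone_pair[OF assms] c2[symmetric])
  moreover have "lcone {u, v} \<inter> {p. (snd (real_pt v), - fst (real_pt v)) \<bullet> p = 0} = lcone {v}"
    by (rule set_eqI) (auto simp: in_lcone_pair[OF assms] in_lcone_right[OF assms] c2[symmetric])
  ultimately show 2: "lcone {v} face_of lcone {u, v}" by simp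
  have "lcone {u} \<inter> lcone {v} = {0}"
  proof (intro equalityI subsetI)
    fix p assume "p \<in> lcone {u} \<inter> lcone {v}"
    then have "cross (real_pt u) p = 0" "cross p (real_pt v) = 0"
      using in_lcone_left[OF assms] in_lcone_right[OF assms] by fastforce+
    then show "p \<in> {0}"
      using unimodular_real_expansion[OF assms, of p] by simp
  next
    fix p assume "p \<in> {0::plane}"
    then show "p \<in> lcone {u} \<inter> lcone {v}"
      by (simp add: in_lcone_left[OF assms] in_lcone_right[OF assms] cross_def)
  qed
  then show "{0} face_of lcone {u, v}"
    using face_of_Int[OF 1 2] by simp
qed

text \<open>A nonzero point of the face is inner to the segment from 0 to any multiple of it by
  \<open>c > 1\<close>. This segment lies in the cone, so its ends belong to the face.\<close>

lemma conic_face: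
  fixes C :: "'a::real_vector set"
  assumes F: "F face_of C" "F \<noteq> {}" and C: "conic C"
  shows "0 \<in> F" "conic F"
proof -
  have FC: "F \<subseteq> C" and conv: "convex F" using F by (auto simp: face_of_def)
  have seg: "x \<in> open_segment 0 (c *\<^sub>R x)" if "x \<noteq> 0" "c > 1" for x :: 'a and c
    unfolding in_segment using that by (intro conjI exI[of _ "1 / c"]) (auto simp: field_simps)
  obtain x where x: "x \<in> F" using F by blast
  have ext: "0 \<in> F \<and> c *\<^sub>R y \<in> F" if "y \<in> F" "c > 1" "y \<noteq> 0" for y c
  proof -
    have "0 \<in> C" "c *\<^sub>R y \<in> C" using C that FC conicD[of C y 0] conicD[of C y c] by auto
    then show ?thesis using face_ofD[OF F(1) seg[OF that(3,2)]] that(1) by blast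
  qed
  show 0: "0 \<in> F" using x ext[of x 2] by (cases "x = 0") auto
  show "conic F"
    unfolding conic_def
  proof (intro allI impI)
    fix y and c :: real assume y: "y \<in> F" "0 \<le> c"
    show "c *\<^sub>R y \<in> F"
    proof (cases "c \<le> 1")
      case True
      then show ?thesis
        using convexD[OF conv 0 y(1), of "1 - c" c] y(2) by simp
    next
      case False
      then show ?thesis using ext[of y c] y 0 by (cases "y = 0") auto
    qed
  qed
qed

lemma faces_of_lcone_pair:
  assumes d: "det2 u v = 1" and F: "F face_of lcone {u, v}" "F \<noteq> {}"
  shows "F = {0} \<or> F = lcone {u} \<or> F = lcone {v} \<or> F = lcone {u, v}"
proof -
  have con: "0 \<in> F" "conic F"
    using conic_face[OF F] by (simp_all add: lcone_def conic_convex_cone_hull)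
  have FC: "F \<subseteq> lcone {u, v}" and conv: "convex F" using F by (auto simp: face_of_def)
  have add: "x + y \<in> F" if "x \<in> F" "y \<in> F" for x y
    using convexD[OF conv that, of "1/2" "1/2"] conicD[OF con(2), of "(1/2) *\<^sub>R x + (1/2) *\<^sub>R y" 2]
    by (simp add: scaleR_add_right)
  have cuv: "cross (real_pt u) (real_pt v) = 1" using d by (simp add: cross_real_pt)
  have nz: "real_pt u \<noteq> 0" "real_pt v \<noteq> 0" using det2_eq_1_nonzero[OF d] by simp_all
  have ru: "lcone {u} \<subseteq> F" if "real_pt u \<in> F"
    using that conicD[OF con(2)] unfolding lcone_single by blast
  have rv: "lcone {v} \<subseteq> F" if "real_pt v \<in> F"
    using that conicD[OF con(2)] unfolding lcone_single by blast
  have onray: "real_pt w \<in> F" if "s *\<^sub>R real_pt w \<in> F" "s > 0" for s w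
    using conicD[OF con(2) that(1), of "1 / s"] that(2) by simp
  have inner: "real_pt u \<in> F \<and> real_pt v \<in> F"
    if p: "p \<in> F" "0 < cross (real_pt u) p" "0 < cross p (real_pt v)" for p
  proof -
    \<comment> \<open>The coordinates are doubled so that \<open>p\<close> is the midpoint of
      \<open>a\<close> and \<open>b\<close>; a face containing \<open>p\<close> then contains points
      of both boundary rays.\<close>
    define a b where "a = (2 * cross p (real_pt v)) *\<^sub>R real_pt u" and "b = (2 * cross (real_pt u) p) *\<^sub>R real_pt v"
    have "p = (1 - 1/2) *\<^sub>R a + (1/2) *\<^sub>R b"
      using unimodular_real_expansion[OF d, of p] by (simp add: a_def b_def)
    moreover have "a \<noteq> b"
    proof
      assume "a = b"
      then have "cross (real_pt u) a = cross (real_pt u) b" by simp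
      then show False using p cuv by (simp add: a_def b_def)
    qed
    ultimately have "p \<in> open_segment a b"
      unfolding in_segment by (intro conjI exI[of _ "1/2"]) simp_all
    moreover have "a \<in> lcone {u, v}" "b \<in> lcone {u, v}"
      using p cuv by (simp_all add: in_lcone_pair[OF d] a_def b_def)
    ultimately have "a \<in> F" "b \<in> F" using face_ofD[OF F(1)] p(1) by blast+
    then show ?thesis using onray p(2,3) unfolding a_def b_def by simp
  qed
  have both: "F = lcone {u, v}" if "real_pt u \<in> F" "real_pt v \<in> F"
    using FC that add conicD[OF con(2)] unfolding lcone_pair by blast
  show ?thesis
  proof (cases "real_pt u \<in> F \<and> real_pt v \<in> F")
    case True
    then show ?thesis using both by blast
  next
    case no: False
    have cases: "p \<in> lcone {u} \<or> p \<in> lcone {v}" if "p \<in> F" for p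
      using inner[of p] no that FC in_lcone_pair[OF d, of p] in_lcone_left[OF d, of p] in_lcone_right[OF d, of p]
      by fastforce
    have u: "p = 0 \<or> real_pt w \<in> F" if p: "p \<in> F" "p \<in> lcone {w}" for p w
    proof -
      obtain s where "p = s *\<^sub>R real_pt w" "0 \<le> s" using p(2) unfolding lcone_single by blast
      then show ?thesis using onray[of s w] p(1) by (cases "s = 0") auto
    qed
    have z: "0 \<in> lcone {w}" for w unfolding lcone_def by (rule convex_cone_hull_contains_0)
    show ?thesis
    proof (cases "real_pt u \<in> F")
      case True
      then have "F = lcone {u}" using ru cases u[of _ v] no z by blast
      then show ?thesis by blast
    next
      case nu: False
      show ?thesis
      proof (cases "real_pt v \<in> F")
        case True
        then have "F = lcone {v}" using rv cases u[of _ u] no z by blast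
        then show ?thesis by blast
      next
        case False
        then have "F = {0}" using nu cases u con by blast
        then show ?thesis by blast
      qed
    qed
  qed
qed

lemma face_through_interior:
  assumes "det2 u v = 1" "F face_of lcone {u, v}" "p \<in> F" "0 < cross (real_pt u) p" "0 < cross p (real_pt v)"
  shows "F = lcone {u, v}"
proof -
  have "p \<notin> {0}" "p \<notin> lcone {u}" "p \<notin> lcone {v}"
    using assms(4,5) in_lcone_left[OF assms(1), of p] in_lcone_right[OF assms(1), of p] by (auto simp: cross_def)
  then show ?thesis
    using faces_of_lcone_pair[OF assms(1,2)] assms(3) by blast
qed

lemma dim_lcone_le: "finite S \<Longrightarrow> dim (lcone S) \<le> card S"
proof -
  assume S: "finite S"
  have "lcone S \<subseteq> span (real_pt ` S)"
    unfolding lcone_def by (intro hull_minimal span_superset convex_cone_span)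
  then have "dim (lcone S) \<le> card (real_pt ` S)"
    using S by (intro dim_le_card) simp_all
  then show ?thesis using card_image_le[OF S, of real_pt] by linarith
qed

lemma dim_lcone_pair:
  assumes "det2 u v = 1"
  shows "dim (lcone {u, v}) = 2"
proof -
  have "UNIV \<subseteq> span (lcone {u, v})"
  proof
    fix p :: plane
    have "real_pt u \<in> span (lcone {u, v})" "real_pt v \<in> span (lcone {u, v})"
      by (simp_all add: span_base real_pt_in_lcone)
    then have "cross p (real_pt v) *\<^sub>R real_pt u + cross (real_pt u) p *\<^sub>R real_pt v \<in> span (lcone {u, v})"
      by (intro span_add span_scale)
    then show "p \<in> span (lcone {u, v})"
      using unimodular_real_expansion[OF assms, of p] by simp
  qed
  then have "dim (lcone {u, v}) = dim (UNIV :: plane set)"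
    by (intro antisym dim_mono) (simp_all add: dim_subset)
  then show ?thesis by (simp add: dim_UNIV)
qed

section \<open>Lattice bases and primitive vectors\<close>

lemma zbasis_imp_det2:
  assumes "zbasis u v"
  shows "det2 u v = 1 \<or> det2 u v = - 1"
proof -
  obtain p where p: "(1, 0) = zscale (fst p) u + zscale (snd p) v"
    using assms unfolding zbasis_def by blast
  obtain q where q: "(0, 1) = zscale (fst q) u + zscale (snd q) v"
    using assms unfolding zbasis_def by blast
  have "1 = det2 (1, 0) (0, 1)" by (simp add: det2_def)
  also have "\<dots> = (fst p * snd q - snd p * fst q) * det2 u v"
    unfolding p q using det2_swap[of v u] by (simp add: algebra_simps)
  finally have "det2 u v dvd 1" by (metis dvd_triv_right)
  then show ?thesis by (auto simp: zdvd1_eq)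
qed

lemma det2_imp_zbasis:
  assumes "det2 u v = 1"
  shows "zbasis u v"
  unfolding zbasis_def
proof
  fix x
  show "\<exists>!p. x = zscale (fst p) u + zscale (snd p) v"
  proof (rule ex1I[of _ "(det2 x v, det2 u x)"])
    show "x = zscale (fst (det2 x v, det2 u x)) u + zscale (snd (det2 x v, det2 u x)) v"
      using unimodular_expansion[OF assms, of x] by simp
  next
    fix p assume p: "x = zscale (fst p) u + zscale (snd p) v"
    have "det2 x v = fst p" "det2 u x = snd p" unfolding p by (simp_all add: assms)
    then show "p = (det2 x v, det2 u x)" by simp
  qed
qed

lemma det2_imp_primitive: "det2 u v = 1 \<Longrightarrow> primitive u"
proof -
  assume "det2 u v = 1"
  then have "snd v * fst u + (- fst v) * snd u = 1" by (simp add: det2_def algebra_simps)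
  then show ?thesis unfolding primitive_def by (metis coprimeI dvd_add dvd_mult)
qed

lemma primitive_on_ray:
  assumes "det2 a b = 1" "primitive u" "real_pt u \<in> lcone {a}"
  shows "u = a"
proof -
  have k: "det2 a u = 0" "0 \<le> det2 u b"
    using assms(3) unfolding in_lcone_left[OF assms(1)] cross_real_pt by simp_all
  then have u: "u = zscale (det2 u b) a"
    using unimodular_expansion[OF assms(1), of u] by simp
  then have "det2 u b dvd fst u" "det2 u b dvd snd u"
    by (metis dvd_triv_left fst_conv snd_conv zscale_def)+
  then have "det2 u b dvd 1"
    using assms(2) unfolding primitive_def by (metis coprime_common_divisor)
  then have "det2 u b = 1" using k(2) by auto
  then show ?thesis using u by simp
qed

section \<open>Weighted circular graphs and cyclic systems of cones\<close>

text \<open>The graph forgets the orientation that the arcs of \<open>R\<close> carry. The last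
  condition is the defining relation of the weights in the form given by
  \<open>weight_equation\<close>.\<close>

definition gfan :: "lattice rel \<Rightarrow> lattice wgraph \<Rightarrow> bool" where
  "gfan R \<Gamma> \<longleftrightarrow> circ_fan R \<and> wverts \<Gamma> = Domain R \<and> wedges \<Gamma> = {{u, v} | u v. (u, v) \<in> R} \<and>
     (\<forall>u v w. (u, v) \<in> R \<longrightarrow> (v, w) \<in> R \<longrightarrow> weight \<Gamma> v = - det2 u w)"

lemma weight_equation:
  assumes "det2 u v = 1" "det2 v w = 1"
  shows "u + w + zscale k v = 0 \<longleftrightarrow> k = - det2 u w"
proof
  assume a: "u + w + zscale k v = 0"
  from arg_cong[OF this, of "\<lambda>p. det2 u p"] show "k = - det2 u w" using assms by simp
next
  assume "k = - det2 u w"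
  then show "u + w + zscale k v = 0"
    using add_eq_zscale_det2[OF assms] by simp
qed

section \<open>From fans to arc systems\<close>

lemma cyclic_successors:
  assumes "distinct xs" "xs \<noteq> []"
  defines "S \<equiv> {(xs ! i, xs ! (Suc i mod length xs)) | i. i < length xs}"
  shows "finite S" "Domain S = set xs" "Range S = set xs"
    "\<And>a b c. (a, b) \<in> S \<Longrightarrow> (b, c) \<in> S \<Longrightarrow>
       \<exists>i<length xs. a = xs ! i \<and> b = xs ! ((i + 1) mod length xs) \<and> c = xs ! ((i + 2) mod length xs)"
proof -
  have n: "length xs > 0" using assms by simp
  show "finite S" unfolding S_def by simp
  show "Domain S = set xs"
    unfolding S_def set_conv_nth by blast
  show "Range S = set xs"
  proof (intro equalityI subsetI)
    fix x assume "x \<in> Range S"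
    then obtain i where "i < length xs" "x = xs ! (Suc i mod length xs)" unfolding S_def by blast
    then show "x \<in> set xs" using n by simp
  next
    fix x assume "x \<in> set xs"
    then obtain j where j: "j < length xs" "x = xs ! j" by (metis in_set_conv_nth)
    define i where "i = (if j = 0 then length xs - 1 else j - 1)"
    have "i < length xs" "Suc i mod length xs = j" using j by (auto simp: i_def)
    then have "(xs ! i, x) \<in> S" using j unfolding S_def by blast
    then show "x \<in> Range S" by blast
  qed
  fix a b c assume "(a, b) \<in> S" "(b, c) \<in> S"
  then obtain i j where i: "i < length xs" "a = xs ! i" "b = xs ! (Suc i mod length xs)"
    and j: "j < length xs" "b = xs ! j" "c = xs ! (Suc j mod length xs)"
    unfolding S_def by blast
  have "j = Suc i mod length xs"
    using i j n assms(1) by (metis mod_less_divisor nth_eq_iff_index_eq)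
  then have "c = xs ! ((i + 2) mod length xs)"
    using j(3) by (simp add: mod_Suc_eq)
  then show "\<exists>i<length xs. a = xs ! i \<and> b = xs ! ((i + 1) mod length xs) \<and> c = xs ! ((i + 2) mod length xs)"
    using i by auto
qed

text \<open>\<open>u\<close> is a nonnegative combination of \<open>a\<close> and \<open>b\<close>,
  and neither of them lies to its right; so one occurring with nonzero coefficient lies on the ray
  of \<open>u\<close> and equals \<open>u\<close> by primitivity. The same works for
  \<open>v\<close>.\<close>

lemma lcone_pair_generators:
  assumes d: "det2 u v = 1" and prim: "primitive a" "primitive b" and eq: "lcone {a, b} = lcone {u, v}"
  shows "{a, b} = {u, v}"
proof -
  have ab: "real_pt a \<in> lcone {u, v}" "real_pt b \<in> lcone {u, v}"
    unfolding eq[symmetric] by (simp_all add: real_pt_in_lcone)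
  have pos: "0 \<le> cross (real_pt u) (real_pt a)" "0 \<le> cross (real_pt u) (real_pt b)"
    "0 \<le> cross (real_pt a) (real_pt v)" "0 \<le> cross (real_pt b) (real_pt v)"
    using ab unfolding in_lcone_pair[OF d] by simp_all
  have nz: "u \<noteq> 0" "v \<noteq> 0" "u \<noteq> v" using det2_eq_1_nonzero[OF d] by blast+
  have left: "w = u" if "w = a \<or> w = b" "cross (real_pt u) (real_pt w) = 0" for w
  proof (rule primitive_on_ray[OF d])
    show "primitive w" using that prim by blast
    show "real_pt w \<in> lcone {u}" using that pos unfolding in_lcone_left[OF d] by auto
  qed
  \<comment> \<open>\<open>primitive_on_ray\<close> expects the generator of the ray in first place,
    so \<open>v\<close> is completed to a basis by \<open>- u\<close>.\<close>
  have d': "det2 v (- u) = 1" using d det2_swap[of u v] by simp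
  have right: "w = v" if "w = a \<or> w = b" "cross (real_pt w) (real_pt v) = 0" for w
  proof (rule primitive_on_ray[OF d'])
    show "primitive w" using that prim by blast
    show "real_pt w \<in> lcone {v}" using that pos unfolding in_lcone_right[OF d] by auto
  qed
  have "real_pt u \<in> lcone {a, b}" "real_pt v \<in> lcone {a, b}"
    unfolding eq by (simp_all add: real_pt_in_lcone)
  then obtain s t s' t' where u: "real_pt u = s *\<^sub>R real_pt a + t *\<^sub>R real_pt b" "0 \<le> s" "0 \<le> t"
    and v: "real_pt v = s' *\<^sub>R real_pt a + t' *\<^sub>R real_pt b" "0 \<le> s'" "0 \<le> t'"
    unfolding lcone_pair by blast
  have "s * cross (real_pt u) (real_pt a) + t * cross (real_pt u) (real_pt b) = 0"
    using arg_cong[OF u(1), of "cross (real_pt u)"] by simp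
  then have "s * cross (real_pt u) (real_pt a) = 0" "t * cross (real_pt u) (real_pt b) = 0"
    using u pos by (simp_all add: add_nonneg_eq_0_iff)
  moreover have "s \<noteq> 0 \<or> t \<noteq> 0" using u(1) nz by force
  ultimately have 1: "a = u \<or> b = u" using left by fastforce
  have "s' * cross (real_pt a) (real_pt v) + t' * cross (real_pt b) (real_pt v) = 0"
    using arg_cong[OF v(1), of "\<lambda>p. cross p (real_pt v)"] by simp
  then have "s' * cross (real_pt a) (real_pt v) = 0" "t' * cross (real_pt b) (real_pt v) = 0"
    using v pos by (simp_all add: add_nonneg_eq_0_iff)
  moreover have "s' \<noteq> 0 \<or> t' \<noteq> 0" using v(1) nz by force
  ultimately have "a = v \<or> b = v" using right by fastforce
  then show ?thesis using 1 nz by blast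
qed

lemma regular_cone_dim_2:
  assumes "regular_cone \<sigma>" "dim \<sigma> = 2"
  obtains u v where "det2 u v = 1" "\<sigma> = lcone {u, v}"
proof -
  obtain u v S where uv: "zbasis u v" "S \<subseteq> {u, v}" "\<sigma> = lcone S"
    using assms(1) unfolding regular_cone_def by blast
  have fS: "finite S" using uv(2) finite_subset by blast
  have "2 \<le> card S"
    using dim_lcone_le[OF fS] assms(2) uv(3) by simp
  moreover have "card {u, v} \<le> 2" by (simp add: card_insert_if)
  ultimately have "S = {u, v}"
    using uv(2) by (meson card_seteq finite.emptyI finite_insert le_trans)
  then have s: "\<sigma> = lcone {u, v}" "\<sigma> = lcone {v, u}" using uv(3) by (simp_all add: insert_commute)
  then show thesis
    using zbasis_imp_det2[OF uv(1)] that[of u v] that[of v u] det2_swap[of u v] by auto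
qed

lemma eventually_interior:
  fixes a b :: real
  assumes "0 < a \<or> a = 0 \<and> 0 < b"
  shows "\<forall>\<^sub>F e in at_right 0. 0 < a + e * b"
  using assms
proof
  assume "0 < a"
  moreover have "((\<lambda>e. a + e * b) \<longlongrightarrow> a + 0 * b) (at_right 0)"
    by (intro tendsto_intros)
  ultimately show ?thesis by (simp add: order_tendstoD(1))
next
  assume "a = 0 \<and> 0 < b"
  then show ?thesis
    using eventually_at_right_less[of "0::real"] by (auto elim: eventually_mono)
qed

text \<open>Turning \<open>p\<close> slightly to the left moves it from the half-open cone into the interior.\<close>

lemma eventually_in_interior:
  assumes d: "det2 u v = 1" and p: "p \<in> hcone u v"
  defines "q \<equiv> (- snd p, fst p)"
  shows "\<forall>\<^sub>F e in at_right 0. 0 < cross (real_pt u) (p + e *\<^sub>R q) \<and> 0 < cross (p + e *\<^sub>R q) (real_pt v)"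
proof (intro eventually_conj)
  have p': "0 \<le> cross (real_pt u) p" "0 < cross p (real_pt v)" using p by (simp_all add: hcone_def)
  have "0 < cross (real_pt u) q" if z: "cross (real_pt u) p = 0"
  proof -
    have "p = cross p (real_pt v) *\<^sub>R real_pt u"
      using unimodular_real_expansion[OF d, of p] z by simp
    then have "cross p q = cross p (real_pt v) * cross (real_pt u) q" by (metis cross_scaleR(1))
    moreover have "cross p q = fst p * fst p + snd p * snd p" by (simp add: cross_def q_def)
    moreover have "p \<noteq> 0" using p'(2) by (auto simp: cross_def)
    then have "fst p * fst p + snd p * snd p > 0"
      by (simp add: prod_eq_iff sum_squares_gt_zero_iff)
    ultimately show ?thesis using p'(2) by (metis zero_less_mult_pos)
  qed
  then show "\<forall>\<^sub>F e in at_right 0. 0 < cross (real_pt u) (p + e *\<^sub>R q)"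
    using eventually_interior[of "cross (real_pt u) p" "cross (real_pt u) q"] p'(1) by fastforce
  show "\<forall>\<^sub>F e in at_right 0. 0 < cross (p + e *\<^sub>R q) (real_pt v)"
    using eventually_interior[of "cross p (real_pt v)" "cross q (real_pt v)"] p'(2) by simp
qed

text \<open>A common point may lie on a common boundary ray and then decides nothing. Turned
  slightly to the left it becomes interior to both cones, and a face containing an interior point is
  the whole cone; so the two cones coincide.\<close>

lemma hcones_disjoint_if_faces:
  assumes d: "det2 u v = 1" "det2 u' v' = 1"
    and f: "(lcone {u, v} \<inter> lcone {u', v'}) face_of lcone {u, v}" "(lcone {u, v} \<inter> lcone {u', v'}) face_of lcone {u', v'}"
    and p: "p \<in> hcone u v" "p \<in> hcone u' v'"
    and prim: "primitive v" "primitive v'"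
  shows "u = u' \<and> v = v'"
proof -
  obtain e where e: "0 < cross (real_pt u) (p + e *\<^sub>R (- snd p, fst p))" "0 < cross (p + e *\<^sub>R (- snd p, fst p)) (real_pt v)"
    "0 < cross (real_pt u') (p + e *\<^sub>R (- snd p, fst p))" "0 < cross (p + e *\<^sub>R (- snd p, fst p)) (real_pt v')"
    using eventually_happens[OF eventually_conj[OF eventually_in_interior[OF d(1) p(1)] eventually_in_interior[OF d(2) p(2)]]]
    by auto
  let ?q = "p + e *\<^sub>R (- snd p, fst p)"
  have "?q \<in> lcone {u, v} \<inter> lcone {u', v'}"
    using e by (simp add: in_lcone_pair[OF d(1)] in_lcone_pair[OF d(2)])
  then have "lcone {u, v} = lcone {u', v'}"
    using face_through_interior[OF d(1) f(1) _ e(1,2)] face_through_interior[OF d(2) f(2) _ e(3,4)] by simp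
  then have "{u, v} = {u', v'}"
    using lcone_pair_generators[OF d(2), of u v] det2_imp_primitive d prim by blast
  then show ?thesis
    using d det2_swap[of u v] by (auto simp: doubleton_eq_iff)
qed

text \<open>The definition of the graph does not say which way round \<open>\<nu>s\<close> runs. The
  weight relation makes consecutive determinants equal, so they are all 1 or all \<open>-1\<close>,
  and in the second case the arcs are reversed.\<close>

lemma weighted_circular_graph_imp_gfan:
  assumes "weighted_circular_graph \<Gamma>"
  shows "\<exists>R. gfan R \<Gamma>"
proof -
  obtain \<Sigma> \<nu>s where S: "complete_regular_fan \<Sigma>" and cg: "cyclic_generators \<Sigma> \<nu>s" and V: "wverts \<Gamma> = set \<nu>s"
    and E: "wedges \<Gamma> = {{\<nu>s ! i, \<nu>s ! (Suc i mod length \<nu>s)} | i. i < length \<nu>s}"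
    and W: "\<And>i. i < length \<nu>s \<Longrightarrow>
        \<nu>s ! i + \<nu>s ! ((i + 2) mod length \<nu>s) +
        zscale (weight \<Gamma> (\<nu>s ! ((i + 1) mod length \<nu>s))) (\<nu>s ! ((i + 1) mod length \<nu>s)) = 0"
    using assms unfolding weighted_circular_graph_def Let_def by blast
  define n where "n = length \<nu>s"
  have n: "3 \<le> n" and dist: "distinct \<nu>s" and nz: "\<nu>s \<noteq> []"
    using cg unfolding cyclic_generators_def n_def by auto
  have prim: "primitive u" if "u \<in> set \<nu>s" for u
    using cg that unfolding cyclic_generators_def by blast
  define S0 where "S0 = {(\<nu>s ! i, \<nu>s ! (Suc i mod length \<nu>s)) | i. i < length \<nu>s}"
  note S0 = cyclic_successors[OF dist nz, folded S0_def]
  have inS: "a \<in> set \<nu>s \<and> b \<in> set \<nu>s" if "(a, b) \<in> S0" for a b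
    using that S0(2,3) by blast
  have cone: "lcone {a, b} \<in> \<Sigma> \<and> dim (lcone {a, b}) = 2" if "(a, b) \<in> S0" for a b
    using that cg unfolding cyclic_generators_def S0_def by blast
  have pm: "det2 a b = 1 \<or> det2 a b = - 1" if ab: "(a, b) \<in> S0" for a b
  proof -
    have "regular_cone (lcone {a, b})" using cone[OF ab] S unfolding complete_regular_fan_def by blast
    then obtain u v where uv: "det2 u v = 1" "lcone {a, b} = lcone {u, v}"
      using regular_cone_dim_2 cone[OF ab] by metis
    then have "{a, b} = {u, v}"
      using lcone_pair_generators prim inS[OF ab] by metis
    then show ?thesis using uv(1) det2_swap[of a b] by (auto simp: doubleton_eq_iff)
  qed
  have const: "det2 a b = det2 b c" and wt: "a + c + zscale (weight \<Gamma> b) b = 0" if ab: "(a, b) \<in> S0" and bc: "(b, c) \<in> S0" for a b c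
  proof -
    obtain i where "i < length \<nu>s" "a = \<nu>s ! i" "b = \<nu>s ! ((i + 1) mod length \<nu>s)" "c = \<nu>s ! ((i + 2) mod length \<nu>s)"
      using S0(4)[OF ab bc] by blast
    then show e: "a + c + zscale (weight \<Gamma> b) b = 0" using W by simp
    from arg_cong[OF e, of "\<lambda>p. det2 p b"] show "det2 a b = det2 b c"
      using det2_swap[of b c] by simp
  qed
  have "det2 (\<nu>s ! i) (\<nu>s ! (Suc i mod n)) = det2 (\<nu>s ! 0) (\<nu>s ! (Suc 0 mod n))" if "i < n" for i
    using that
  proof (induction i)
    case (Suc i)
    have "(\<nu>s ! i, \<nu>s ! (Suc i mod n)) \<in> S0" "(\<nu>s ! (Suc i), \<nu>s ! (Suc (Suc i) mod n)) \<in> S0"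
      using Suc.prems unfolding S0_def n_def[symmetric] by (blast dest: Suc_lessD)+
    then show ?case using const Suc by simp
  qed simp
  then obtain d where d: "\<And>a b. (a, b) \<in> S0 \<Longrightarrow> det2 a b = d"
    unfolding S0_def n_def by blast
  have "S0 \<noteq> {}" using S0(2) nz by auto
  then have d1: "d = 1 \<or> d = - 1" using pm d by (metis equals0I surj_pair)
  define R where "R = (if d = 1 then S0 else S0\<inverse>)"
  have RS: "(a, b) \<in> S0 \<or> (b, a) \<in> S0" if "(a, b) \<in> R" for a b
    using that unfolding R_def by (auto split: if_splits)
  have det: "det2 a b = 1" if "(a, b) \<in> R" for a b
    using that d d1 det2_swap[of a b] unfolding R_def by (auto split: if_splits)
  have coneR: "lcone {a, b} \<in> \<Sigma>" if "(a, b) \<in> R" for a b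
    using RS[OF that] cone[of a b] cone[of b a] by (auto simp: insert_commute)
  have inR: "a \<in> set \<nu>s \<and> b \<in> set \<nu>s" if "(a, b) \<in> R" for a b
    using RS[OF that] inS by blast
  have dom: "Domain R = set \<nu>s" "Range R = set \<nu>s" using S0(2,3) unfolding R_def by simp_all
  have "circ_fan R"
  proof
    show "finite R" "R \<noteq> {}" using S0(1) \<open>S0 \<noteq> {}\<close> by (auto simp: R_def)
    show "Range R = Domain R" using dom by simp
    show "det2 u v = 1" if "(u, v) \<in> R" for u v using det that .
    fix u v u' v' p assume R: "(u, v) \<in> R" "(u', v') \<in> R" and p: "p \<in> hcone u v" "p \<in> hcone u' v'"
    have f: "(lcone {u, v} \<inter> lcone {u', v'}) face_of lcone {u, v}" "(lcone {u, v} \<inter> lcone {u', v'}) face_of lcone {u', v'}"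
      using coneR[OF R(1)] coneR[OF R(2)] S unfolding complete_regular_fan_def fan_def by blast+
    show "u = u' \<and> v = v'"
      using hcones_disjoint_if_faces[OF det[OF R(1)] det[OF R(2)] f p] prim inR[OF R(1)] inR[OF R(2)] by blast
  qed
  moreover have "wedges \<Gamma> = {{u, v} | u v. (u, v) \<in> R}"
  proof -
    have "{{u, v} | u v. (u, v) \<in> S0\<inverse>} = {{u, v} | u v. (u, v) \<in> S0}"
      by (auto simp: insert_commute)
    moreover have "wedges \<Gamma> = {{u, v} | u v. (u, v) \<in> S0}"
      unfolding E S0_def by blast
    ultimately show ?thesis unfolding R_def by simp
  qed
  moreover have "weight \<Gamma> v = - det2 u w" if "(u, v) \<in> R" "(v, w) \<in> R" for u v w
  proof -
    have "u + w + zscale (weight \<Gamma> v) v = 0"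
      using that wt[of u v w] wt[of w v u] unfolding R_def by (auto split: if_splits simp: add.commute)
    then show ?thesis
      using weight_equation[OF det[OF that(1)] det[OF that(2)]] by simp
  qed
  ultimately have "gfan R \<Gamma>" unfolding gfan_def using V dom by simp
  then show ?thesis by blast
qed

section \<open>From arc systems to fans\<close>

context circ_fan
begin

lemma arc_exists: "\<exists>u v. (u, v) \<in> R"
  using ne by (metis equals0I surj_pair)

text \<open>A longest path of arcs without repeated vertices closes up to a cycle through all vertices.\<close>

lemma arc_list:
  obtains xs where "distinct xs" "3 \<le> length xs" "set xs = Domain R"
    "R = {(xs ! i, xs ! (Suc i mod length xs)) | i. i < length xs}"
proof -
  define P where "P xs \<longleftrightarrow> xs \<noteq> [] \<and> distinct xs \<and> set xs \<subseteq> Domain R \<and>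
    (\<forall>i. Suc i < length xs \<longrightarrow> (xs ! i, xs ! Suc i) \<in> R)" for xs
  have bound: "length xs < Suc (card (Domain R))" if "P xs" for xs
    using that card_mono[OF finV, of "set xs"] distinct_card[of xs] unfolding P_def by simp
  obtain a where "a \<in> Domain R" using arc_exists by blast
  then have "P [a]" unfolding P_def by simp
  then obtain xs where xs: "P xs" and max: "\<And>ys. P ys \<Longrightarrow> length ys \<le> length xs"
    using ex_has_greatest_nat[of P "[a]" length "Suc (card (Domain R))"] bound by blast
  define n where "n = length xs"
  have dist: "distinct xs" and sub: "set xs \<subseteq> Domain R" and n0: "n > 0"
    and step: "\<And>i. Suc i < n \<Longrightarrow> (xs ! i, xs ! Suc i) \<in> R"
    using xs unfolding P_def n_def by auto
  define z where "z = xs ! (n - 1)"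
  have z: "z \<in> set xs" unfolding z_def n_def using n0 n_def by simp
  then obtain y where y: "(z, y) \<in> R" "y \<in> Domain R" using sub succE by blast
  have "y \<in> set xs"
  proof (rule ccontr)
    assume no: "y \<notin> set xs"
    have "P (xs @ [y])"
      unfolding P_def
    proof (intro conjI allI impI)
      show "distinct (xs @ [y])" using dist no by simp
      show "set (xs @ [y]) \<subseteq> Domain R" using sub y by simp
      fix i assume i: "Suc i < length (xs @ [y])"
      show "((xs @ [y]) ! i, (xs @ [y]) ! Suc i) \<in> R"
      proof (cases "Suc i < n")
        case True
        then show ?thesis using step[OF True] n_def by (simp add: nth_append)
      next
        case False
        then have "Suc i = n" using i n_def by simp
        moreover then have "i = n - 1" by simp
        ultimately show ?thesis using y(1) n_def by (simp add: nth_append z_def)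
      qed
    qed simp
    then show False using max by fastforce
  qed
  then obtain j where j: "j < n" "xs ! j = y" unfolding n_def by (metis in_set_conv_nth)
  \<comment> \<open>If \<open>j > 0\<close>, then \<open>xs ! (j - 1)\<close> would be a second
    predecessor of \<open>y\<close> besides the last entry \<open>z\<close>.\<close>
  have "j = 0"
  proof (rule ccontr)
    assume "j \<noteq> 0"
    then have "(xs ! (j - 1), y) \<in> R" using step[of "j - 1"] j by simp
    then have "xs ! (j - 1) = z" using pred_unique y(1) by blast
    then have "j - 1 = n - 1"
      using nth_eq_iff_index_eq[OF dist, of "j - 1" "n - 1"] j(1) n_def z_def by simp
    then show False using j(1) \<open>j \<noteq> 0\<close> by simp
  qed
  have arcs: "(xs ! i, xs ! (Suc i mod n)) \<in> R" if "i < n" for i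
  proof (cases "Suc i < n")
    case True
    then show ?thesis using step by simp
  next
    case False
    then have "Suc i = n" using that by simp
    moreover then have "i = n - 1" by simp
    ultimately show ?thesis using y(1) j \<open>j = 0\<close> z_def by simp
  qed
  have D: "set xs = Domain R"
  proof (rule closed_subset_eq[OF sub])
    show "set xs \<noteq> {}" using z by (metis emptyE)
    fix u v assume u: "u \<in> set xs" "(u, v) \<in> R"
    then obtain i where i: "i < n" "u = xs ! i" unfolding n_def by (metis in_set_conv_nth)
    then have "v = xs ! (Suc i mod n)" using arcs succ_unique u by blast
    then show "v \<in> set xs" using n0 n_def by simp
  qed
  have R: "R = {(xs ! i, xs ! (Suc i mod n)) | i. i < n}"
  proof (intro equalityI subrelI)
    fix u v assume uv: "(u, v) \<in> R"
    then have "u \<in> set xs" using D by blast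
    then obtain i where i: "i < n" "u = xs ! i" unfolding n_def by (metis in_set_conv_nth)
    then have "v = xs ! (Suc i mod n)" using arcs succ_unique uv by blast
    then show "(u, v) \<in> {(xs ! i, xs ! (Suc i mod n)) | i. i < n}" using i by blast
  next
    fix u v assume "(u, v) \<in> {(xs ! i, xs ! (Suc i mod n)) | i. i < n}"
    then show "(u, v) \<in> R" using arcs by blast
  qed
  have "n \<noteq> 1" using arcs[of 0] det[of "xs ! 0" "xs ! 0"] by auto
  moreover have "n \<noteq> 2"
  proof
    assume "n = 2"
    then have "(xs ! 0, xs ! 1) \<in> R" "(xs ! 1, xs ! 0) \<in> R" using arcs[of 0] arcs[of 1] by simp_all
    then show False using not_both_arcs by blast
  qed
  ultimately have "3 \<le> n" using n0 by simp
  then show thesis using that dist D R unfolding n_def by blast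
qed

text \<open>Taking all nonempty faces makes closedness under faces an instance of transitivity; the
  explicit list of cones is recovered in \<open>cones_cases\<close>.\<close>

definition cones :: "plane set set" where
  "cones = {F. F \<noteq> {} \<and> (\<exists>u v. (u, v) \<in> R \<and> F face_of lcone {u, v})}"

lemma cones_cases:
  assumes "F \<in> cones"
  obtains u v where "(u, v) \<in> R" "F = {0} \<or> F = lcone {u} \<or> F = lcone {v} \<or> F = lcone {u, v}" "F face_of lcone {u, v}"
  using assms faces_of_lcone_pair[OF det] unfolding cones_def by blast

lemma finite_cones: "finite cones"
proof (rule finite_subset)
  show "cones \<subseteq> {{0}} \<union> (\<lambda>u. lcone {u}) ` Domain R \<union> (\<lambda>e. lcone {fst e, snd e}) ` R"
  proof
    fix F assume "F \<in> cones"
    then obtain u v where uv: "(u, v) \<in> R" "F = {0} \<or> F = lcone {u} \<or> F = lcone {v} \<or> F = lcone {u, v}"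
      by (rule cones_cases)
    moreover have "lcone {u, v} \<in> (\<lambda>e. lcone {fst e, snd e}) ` R"
      using imageI[OF uv(1), of "\<lambda>e. lcone {fst e, snd e}"] by simp
    ultimately show "F \<in> {{0}} \<union> (\<lambda>u. lcone {u}) ` Domain R \<union> (\<lambda>e. lcone {fst e, snd e}) ` R"
      using inV[OF uv(1)] by blast
  qed
qed (use fin finV in simp)

text \<open>Apart from the origin, a closed cone exceeds its half-open version by the ray of
  \<open>v\<close>, which belongs to the half-open cone of the next arc.\<close>

lemma lcone_pair_cases:
  assumes uv: "(u, v) \<in> R" and p: "p \<in> lcone {u, v}" "p \<noteq> 0"
  shows "p \<in> hcone u v \<or> (\<exists>w. (v, w) \<in> R \<and> p \<in> hcone v w \<and> p \<in> lcone {v})"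
proof (cases "cross p (real_pt v) > 0")
  case True
  then show ?thesis using p in_lcone_pair[OF det[OF uv]] by (simp add: hcone_def)
next
  case False
  then have z: "cross p (real_pt v) = 0" "0 \<le> cross (real_pt u) p" using p in_lcone_pair[OF det[OF uv]] by simp_all
  then have pv: "p = cross (real_pt u) p *\<^sub>R real_pt v"
    using unimodular_real_expansion[OF det[OF uv], of p] by simp
  then have pos: "0 < cross (real_pt u) p" using z p(2) by (metis order_le_less scaleR_zero_left)
  obtain w where w: "(v, w) \<in> R" using inV[OF uv] by blast
  have "cross p (real_pt w) = cross (real_pt u) p"
    by (subst pv) (simp add: cross_real_pt det[OF w])
  then have "p \<in> hcone v w"
    using pos z(1) cross_swap[of p "real_pt v"] by (simp add: hcone_def)
  moreover have "p \<in> lcone {v}" using z by (simp add: in_lcone_right[OF det[OF uv]])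
  ultimately show ?thesis using w by blast
qed

lemma zero_in_lcone: "0 \<in> lcone S"
  by (simp add: lcone_def convex_cone_hull_contains_0)

text \<open>A nonzero point lies in at most one half-open cone. For different arcs, comparing where
  \<open>lcone_pair_cases\<close> puts a common point shows that it lies on a shared ray, so the
  intersection is the origin or one ray.\<close>

lemma lcone_pair_Int:
  assumes R: "(u, v) \<in> R" "(u', v') \<in> R"
  shows "(lcone {u, v} \<inter> lcone {u', v'}) face_of lcone {u, v}"
proof (cases "u = u' \<and> v = v'")
  case True
  then show ?thesis by (simp add: face_of_refl convex_lcone)
next
  case False
  let ?I = "lcone {u, v} \<inter> lcone {u', v'}"
  have ray: "(u = v' \<and> p \<in> lcone {u}) \<or> (v = u' \<and> p \<in> lcone {v})" if p: "p \<in> ?I" "p \<noteq> 0" for p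
  proof -
    have c: "p \<in> hcone u v \<or> (\<exists>w. (v, w) \<in> R \<and> p \<in> hcone v w \<and> p \<in> lcone {v})"
      "p \<in> hcone u' v' \<or> (\<exists>w. (v', w) \<in> R \<and> p \<in> hcone v' w \<and> p \<in> lcone {v'})"
      using lcone_pair_cases[OF R(1)] lcone_pair_cases[OF R(2)] p by blast+
    have diff: "\<not> (p \<in> hcone u v \<and> p \<in> hcone u' v')"
      using disj[OF R, of p] False by blast
    show ?thesis
    proof (cases "p \<in> hcone u v")
      case True
      then obtain w where w: "(v', w) \<in> R" "p \<in> hcone v' w" "p \<in> lcone {v'}" using c(2) diff by blast
      then have "u = v'" using disj[OF R(1) w(1) True w(2)] by simp
      then show ?thesis using w(3) by simp
    next
      case nuv: False
      then obtain w where w: "(v, w) \<in> R" "p \<in> hcone v w" "p \<in> lcone {v}" using c(1) by blast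
      show ?thesis
      proof (cases "p \<in> hcone u' v'")
        case True
        then have "v = u'" using disj[OF w(1) R(2) w(2) True] by simp
        then show ?thesis using w(3) by simp
      next
        case nuv': False
        then obtain w' where w': "(v', w') \<in> R" "p \<in> hcone v' w'" using c(2) by blast
        then have "v = v'" using disj[OF w(1) w'(1) w(2) w'(2)] by simp
        then show ?thesis using False pred_unique[of u v u'] R by simp
      qed
    qed
  qed
  note faces = rays_of_lcone_pair[OF det[OF R(1)]]
  have "?I = {0} \<or> ?I = lcone {u} \<or> ?I = lcone {v}"
  proof (cases "u = v'")
    case True
    then have "v \<noteq> u'" using not_both_arcs R by blast
    then have "?I \<subseteq> lcone {u}" using ray zero_in_lcone by blast
    moreover have "lcone {u} \<subseteq> ?I" using True lcone_mono[of "{u}" "{u, v}"] lcone_mono[of "{u}" "{u', v'}"] by blast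
    ultimately show ?thesis by blast
  next
    case nu: False
    show ?thesis
    proof (cases "v = u'")
      case True
      then have "?I \<subseteq> lcone {v}" using ray nu zero_in_lcone by blast
      moreover have "lcone {v} \<subseteq> ?I" using True lcone_mono[of "{v}" "{u, v}"] lcone_mono[of "{v}" "{u', v'}"] by blast
      ultimately show ?thesis by blast
    next
      case False
      then have "?I = {0}" using ray nu zero_in_lcone by blast
      then show ?thesis by blast
    qed
  qed
  then show ?thesis using faces by (elim disjE) simp_all
qed

lemma lcone_pair_in_cones: "(u, v) \<in> R \<Longrightarrow> lcone {u, v} \<in> cones"
  using face_of_refl[OF convex_lcone, of "{u, v}"] zero_in_lcone[of "{u, v}"] unfolding cones_def by blast

lemma complete_regular_fan_cones: "complete_regular_fan cones"
  unfolding complete_regular_fan_def fan_def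
proof (intro conjI ballI allI impI)
  show "finite cones" by (rule finite_cones)
next
  fix \<sigma> assume s: "\<sigma> \<in> cones"
  obtain u v where uv: "(u, v) \<in> R" "\<sigma> = {0} \<or> \<sigma> = lcone {u} \<or> \<sigma> = lcone {v} \<or> \<sigma> = lcone {u, v}"
    using s by (rule cones_cases)
  then obtain S where S: "S \<subseteq> {u, v}" "\<sigma> = lcone S"
    by (metis insert_subset empty_subsetI insertI1 insertI2 lcone_empty singletonI subset_refl)
  show "regular_cone \<sigma>"
    unfolding regular_cone_def using S det2_imp_zbasis[OF det[OF uv(1)]] by blast
  show "strongly_convex_rational_cone \<sigma>"
    unfolding strongly_convex_rational_cone_def
  proof (intro conjI allI impI)
    show "\<exists>S. finite S \<and> \<sigma> = lcone S" using S finite_subset by blast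
    fix x assume "x \<in> \<sigma> \<and> - x \<in> \<sigma>"
    then have "x \<in> lcone {u, v}" "- x \<in> lcone {u, v}" using S lcone_mono by blast+
    then have "cross (real_pt u) x = 0" "cross x (real_pt v) = 0"
      unfolding in_lcone_pair[OF det[OF uv(1)]] by (simp_all add: cross_def)
    then show "x = 0" using unimodular_real_expansion[OF det[OF uv(1)], of x] by simp
  qed
next
  fix \<sigma> \<tau> assume "\<sigma> \<in> cones" "\<tau> face_of \<sigma> \<and> \<tau> \<noteq> {}"
  then show "\<tau> \<in> cones" unfolding cones_def using face_of_trans by blast
next
  fix \<sigma> \<sigma>' assume s: "\<sigma> \<in> cones" "\<sigma>' \<in> cones"
  \<comment> \<open>The face \<open>\<sigma>'\<close> of \<open>?C'\<close> is carried over to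
    \<open>?C\<close> through the common face \<open>?C \<inter> ?C'\<close>; there it can be
    intersected with \<open>\<sigma>\<close>.\<close>
  have one: "(\<sigma> \<inter> \<sigma>') face_of \<sigma>" if s: "\<sigma> \<in> cones" "\<sigma>' \<in> cones" for \<sigma> \<sigma>'
  proof -
    obtain u v u' v' where R: "(u, v) \<in> R" "(u', v') \<in> R" and f: "\<sigma> face_of lcone {u, v}" "\<sigma>' face_of lcone {u', v'}"
      using s unfolding cones_def by blast
    let ?C = "lcone {u, v}" and ?C' = "lcone {u', v'}"
    have I: "(?C \<inter> ?C') face_of ?C" "(?C \<inter> ?C') face_of ?C'"
      using lcone_pair_Int[OF R] lcone_pair_Int[OF R(2,1)] by (simp_all add: Int_commute)
    have sub: "\<sigma> \<subseteq> ?C" "\<sigma>' \<subseteq> ?C'" using f face_of_imp_subset by blast+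
    have "(\<sigma>' \<inter> (?C \<inter> ?C')) face_of ?C'" using face_of_Int[OF f(2) I(2)] .
    then have "(\<sigma>' \<inter> (?C \<inter> ?C')) face_of (?C \<inter> ?C')" using face_of_subset by blast
    then have "(\<sigma>' \<inter> (?C \<inter> ?C')) face_of ?C" using face_of_trans I(1) by blast
    then have "(\<sigma> \<inter> (\<sigma>' \<inter> (?C \<inter> ?C'))) face_of ?C" using face_of_Int[OF f(1)] by blast
    moreover have "\<sigma> \<inter> (\<sigma>' \<inter> (?C \<inter> ?C')) = \<sigma> \<inter> \<sigma>'" using sub by blast
    ultimately have "(\<sigma> \<inter> \<sigma>') face_of ?C" by simp
    then show ?thesis using face_of_subset sub by blast
  qed
  show "(\<sigma> \<inter> \<sigma>') face_of \<sigma>" using one[OF s] .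
  show "(\<sigma> \<inter> \<sigma>') face_of \<sigma>'" using one[OF s(2,1)] by (simp add: Int_commute)
next
  have "p \<in> \<Union>cones" for p
  proof (cases "p = 0")
    case True
    obtain u v where "(u, v) \<in> R" using arc_exists by blast
    then show ?thesis using lcone_pair_in_cones zero_in_lcone True by blast
  next
    case False
    then obtain u v where uv: "(u, v) \<in> R" "p \<in> hcone u v"
      using hcones_cover[OF fin ne _ det False] Range_eq by blast
    then have "p \<in> lcone {u, v}" by (simp add: in_lcone_pair[OF det[OF uv(1)]] hcone_def)
    then show ?thesis using lcone_pair_in_cones uv by blast
  qed
  then show "\<Union>cones = UNIV" by blast
qed

lemma dim_2_cones: "{\<sigma> \<in> cones. dim \<sigma> = 2} = {lcone {u, v} | u v. (u, v) \<in> R}"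
proof (intro equalityI subsetI)
  fix \<sigma> assume s: "\<sigma> \<in> {\<sigma> \<in> cones. dim \<sigma> = 2}"
  then have s': "\<sigma> \<in> cones" "dim \<sigma> = 2" by simp_all
  from s'(1) obtain u v where uv: "(u, v) \<in> R" "\<sigma> = {0} \<or> \<sigma> = lcone {u} \<or> \<sigma> = lcone {v} \<or> \<sigma> = lcone {u, v}"
    by (rule cones_cases)
  have "\<sigma> \<noteq> {0}" "\<sigma> \<noteq> lcone {u}" "\<sigma> \<noteq> lcone {v}"
    using s'(2) dim_lcone_le[of "{u}"] dim_lcone_le[of "{v}"] by auto
  then show "\<sigma> \<in> {lcone {u, v} | u v. (u, v) \<in> R}"
    using uv by blast
next
  fix \<sigma> assume "\<sigma> \<in> {lcone {u, v} | u v. (u, v) \<in> R}"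
  then show "\<sigma> \<in> {\<sigma> \<in> cones. dim \<sigma> = 2}"
    using lcone_pair_in_cones dim_lcone_pair det by blast
qed

lemma rays_of_cones: "Domain R = {u. primitive u \<and> lcone {u} \<in> cones}"
proof (intro equalityI subsetI)
  fix u assume "u \<in> Domain R"
  then obtain v where uv: "(u, v) \<in> R" by blast
  then have "lcone {u} \<in> cones"
    using rays_of_lcone_pair(1)[OF det[OF uv]] zero_in_lcone unfolding cones_def by blast
  then show "u \<in> {u. primitive u \<and> lcone {u} \<in> cones}"
    using det2_imp_primitive[OF det[OF uv]] by blast
next
  fix u assume "u \<in> {u. primitive u \<and> lcone {u} \<in> cones}"
  then have prim: "primitive u" and s: "lcone {u} \<in> cones" by simp_all
  from s obtain a b where ab: "(a, b) \<in> R"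
    "lcone {u} = {0} \<or> lcone {u} = lcone {a} \<or> lcone {u} = lcone {b} \<or> lcone {u} = lcone {a, b}"
    by (rule cones_cases)
  \<comment> \<open>The arc after \<open>b\<close> is needed because \<open>primitive_on_ray\<close>
    wants \<open>b\<close> as the first vector of a unimodular pair.\<close>
  obtain c where bc: "(b, c) \<in> R" using inV[OF ab(1)] by blast
  have u: "real_pt u \<in> lcone {u}" by (simp add: real_pt_in_lcone)
  have "lcone {u} \<noteq> {0}"
  proof
    assume "lcone {u} = {0}"
    then have "u = 0" using u by simp
    then show False using prim by (simp add: primitive_def)
  qed
  moreover have "lcone {u} \<noteq> lcone {a, b}"
    using dim_lcone_le[of "{u}"] dim_lcone_pair[OF det[OF ab(1)]] by auto
  ultimately have "real_pt u \<in> lcone {a} \<or> real_pt u \<in> lcone {b}"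
    using ab(2) u by blast
  then have "u = a \<or> u = b"
    using primitive_on_ray[OF det[OF ab(1)] prim] primitive_on_ray[OF det[OF bc] prim] by blast
  then show "u \<in> Domain R" using inV[OF ab(1)] by blast
qed

end

lemma gfan_imp_weighted_circular_graph:
  assumes "gfan R \<Gamma>"
  shows "weighted_circular_graph \<Gamma>"
proof -
  interpret circ_fan R using assms by (simp add: gfan_def)
  obtain xs where xs: "distinct xs" "3 \<le> length xs" "set xs = Domain R"
    "R = {(xs ! i, xs ! (Suc i mod length xs)) | i. i < length xs}"
    by (rule arc_list)
  have "cyclic_generators cones xs"
    unfolding cyclic_generators_def dim_2_cones
  proof (intro conjI)
    show "set xs = {u. primitive u \<and> lcone {u} \<in> cones}" using rays_of_cones xs(3) by simp
    show "{lcone {u, v} | u v. (u, v) \<in> R} = {lcone {xs ! i, xs ! (Suc i mod length xs)} | i. i < length xs}"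
      by (subst xs(4)) blast
  qed (use xs in simp_all)
  moreover have "wedges \<Gamma> = {{xs ! i, xs ! (Suc i mod length xs)} | i. i < length xs}"
  proof -
    have "wedges \<Gamma> = {{u, v} | u v. (u, v) \<in> R}" using assms by (simp add: gfan_def)
    then show ?thesis by (subst (asm) xs(4)) blast
  qed
  moreover have "xs ! i + xs ! ((i + 2) mod length xs) +
      zscale (weight \<Gamma> (xs ! ((i + 1) mod length xs))) (xs ! ((i + 1) mod length xs)) = 0" if i: "i < length xs" for i
  proof -
    let ?n = "length xs"
    have step: "(xs ! k, xs ! (Suc k mod ?n)) \<in> R" if "k < ?n" for k
    proof -
      have "(xs ! k, xs ! (Suc k mod ?n)) \<in> {(xs ! i, xs ! (Suc i mod ?n)) | i. i < ?n}"
        using that by blast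
      then show ?thesis by (subst xs(4))
    qed
    have "(i + 1) mod ?n < ?n" using i by (intro mod_less_divisor) linarith
    from step[OF this] have s2: "(xs ! ((i + 1) mod ?n), xs ! ((i + 2) mod ?n)) \<in> R"
      by (simp add: mod_Suc_eq)
    have s1: "(xs ! i, xs ! ((i + 1) mod ?n)) \<in> R"
      using step[OF i] by simp
    have "weight \<Gamma> (xs ! ((i + 1) mod ?n)) = - det2 (xs ! i) (xs ! ((i + 2) mod ?n))"
      using assms s1 s2 unfolding gfan_def by blast
    then show ?thesis
      by (rule iffD2[OF weight_equation[OF det[OF s1] det[OF s2]]])
  qed
  moreover have "wverts \<Gamma> = set xs" using assms xs(3) by (simp add: gfan_def)
  ultimately show ?thesis
    unfolding weighted_circular_graph_def Let_def
    by (intro exI[of _ cones] exI[of _ xs] conjI complete_regular_fan_cones) blast+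
qed

lemma weighted_circular_graph_iff_gfan: "weighted_circular_graph \<Gamma> \<longleftrightarrow> (\<exists>R. gfan R \<Gamma>)"
  using weighted_circular_graph_imp_gfan gfan_imp_weighted_circular_graph by blast

section \<open>Isomorphisms and blow-ups\<close>

text \<open>The map is kept explicit because later arguments trace the images of single
  vertices.\<close>

definition iso_via :: "('v \<Rightarrow> 'w) \<Rightarrow> 'v wgraph \<Rightarrow> 'w wgraph \<Rightarrow> bool" where
  "iso_via f G H \<longleftrightarrow> bij_betw f (wverts G) (wverts H) \<and> wedges H = (\<lambda>e. f ` e) ` wedges G \<and>
     (\<forall>v\<in>wverts G. weight H (f v) = weight G v)"

lemma wgraph_iso_iff: "wgraph_iso G H \<longleftrightarrow> (\<exists>f. iso_via f G H)"
  by (simp add: wgraph_iso_def iso_via_def)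

lemma iso_via_inj: "iso_via f G H \<Longrightarrow> x \<in> wverts G \<Longrightarrow> y \<in> wverts G \<Longrightarrow> f x = f y \<Longrightarrow> x = y"
  unfolding iso_via_def by (meson bij_betw_imp_inj_on inj_onD)

lemma iso_via_verts: "iso_via f G H \<Longrightarrow> x \<in> wverts G \<Longrightarrow> f x \<in> wverts H"
  unfolding iso_via_def by (meson bij_betwE)

lemma iso_via_edge: "iso_via f G H \<Longrightarrow> {x, y} \<in> wedges G \<Longrightarrow> {f x, f y} \<in> wedges H"
  unfolding iso_via_def using imageI[of "{x, y}" "wedges G" "\<lambda>e. f ` e"] by simp

lemma wgraph_iso_refl: "wgraph_iso G G"
  unfolding wgraph_iso_iff iso_via_def by (intro exI[of _ id]) simp

lemma wgraph_iso_trans: "wgraph_iso G H \<Longrightarrow> wgraph_iso H K \<Longrightarrow> wgraph_iso G K"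
proof -
  assume "wgraph_iso G H" "wgraph_iso H K"
  then obtain f g where f: "iso_via f G H" and g: "iso_via g H K" unfolding wgraph_iso_iff by blast
  have "iso_via (g \<circ> f) G K"
    unfolding iso_via_def
  proof (intro conjI ballI)
    show "bij_betw (g \<circ> f) (wverts G) (wverts K)" using f g
      by (intro bij_betw_trans[of f _ "wverts H"]) (simp_all add: iso_via_def)
    show "wedges K = (`) (g \<circ> f) ` wedges G"
      using f g unfolding iso_via_def by (simp add: image_comp[symmetric] image_image)
    show "weight K ((g \<circ> f) v) = weight G v" if "v \<in> wverts G" for v
      using f g that iso_via_verts[OF f that] unfolding iso_via_def by simp
  qed
  then show ?thesis unfolding wgraph_iso_iff by blast
qed

text \<open>The record type allows edges that leave the vertex set, where the inverse map need not
  undo \<open>f\<close>; the hypothesis \<open>edges\<close> excludes this.\<close>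

lemma wgraph_iso_sym:
  assumes iso: "wgraph_iso G H" and edges: "\<And>e. e \<in> wedges G \<Longrightarrow> e \<subseteq> wverts G"
  shows "wgraph_iso H G"
proof -
  obtain f where f: "iso_via f G H" using iso unfolding wgraph_iso_iff by blast
  let ?g = "inv_into (wverts G) f"
  have b: "bij_betw f (wverts G) (wverts H)" using f by (simp add: iso_via_def)
  then have inj: "inj_on f (wverts G)" by (rule bij_betw_imp_inj_on)
  have "iso_via ?g H G"
    unfolding iso_via_def
  proof (intro conjI ballI)
    show "bij_betw ?g (wverts H) (wverts G)" using b by (rule bij_betw_inv_into)
    have "wedges H = (\<lambda>e. f ` e) ` wedges G" using f by (simp add: iso_via_def)
    then have "(\<lambda>e. ?g ` e) ` wedges H = (\<lambda>e. ?g ` f ` e) ` wedges G" by (simp add: image_image)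
    also have "\<dots> = (\<lambda>e. e) ` wedges G"
      by (intro image_cong refl) (use edges inj in \<open>simp add: inv_into_image_cancel\<close>)
    finally show "wedges G = (\<lambda>e. ?g ` e) ` wedges H" by simp
    show "weight G (?g v) = weight H v" if "v \<in> wverts H" for v
    proof -
      have "?g v \<in> wverts G" "f (?g v) = v"
        using b that by (metis bij_betw_imp_surj_on inv_into_into, metis bij_betw_imp_surj_on f_inv_into_f)
      then show ?thesis using f unfolding iso_via_def by metis
    qed
  qed
  then show ?thesis unfolding wgraph_iso_iff by blast
qed

lemma iso_via_minus_ones:
  assumes "iso_via f G H" "{x \<in> wverts G. weight G x = - 1} = {m}" "{x \<in> wverts H. weight H x = - 1} = {m'}"
  shows "f m = m'"
proof -
  have "m \<in> wverts G" "weight G m = - 1" using assms(2) by blast+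
  then have "f m \<in> wverts H" "weight H (f m) = - 1"
    using assms(1) iso_via_verts[OF assms(1)] by (simp_all add: iso_via_def)
  then show ?thesis using assms(3) by blast
qed

lemma iso_via_minus_one_card:
  assumes "iso_via f G H"
  shows "card {x \<in> wverts H. weight H x = - 1} = card {x \<in> wverts G. weight G x = - 1}"
    "card (wverts H) = card (wverts G)"
proof -
  have b: "bij_betw f (wverts G) (wverts H)" using assms by (simp add: iso_via_def)
  then show "card (wverts H) = card (wverts G)" by (simp add: bij_betw_same_card)
  have w: "weight H (f x) = weight G x" if "x \<in> wverts G" for x
    using assms that by (simp add: iso_via_def)
  have "f ` {x \<in> wverts G. weight G x = - 1} = {x \<in> wverts H. weight H x = - 1}"
  proof (intro equalityI subsetI)
    fix y assume "y \<in> f ` {x \<in> wverts G. weight G x = - 1}"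
    then show "y \<in> {x \<in> wverts H. weight H x = - 1}" using w iso_via_verts[OF assms] by force
  next
    fix y assume y: "y \<in> {x \<in> wverts H. weight H x = - 1}"
    then have "y \<in> f ` wverts G" using b by (simp add: bij_betw_imp_surj_on)
    then show "y \<in> f ` {x \<in> wverts G. weight G x = - 1}" using y w by force
  qed
  moreover have "inj_on f {x \<in> wverts G. weight G x = - 1}"
    using bij_betw_imp_inj_on[OF b] by (rule inj_on_subset) blast
  then have "card (f ` {x \<in> wverts G. weight G x = - 1}) = card {x \<in> wverts G. weight G x = - 1}"
    by (rule card_image)
  ultimately show "card {x \<in> wverts H. weight H x = - 1} = card {x \<in> wverts G. weight G x = - 1}"
    by simp
qed

lemma blow_up_simps [simp]:
  "wverts (blow_up u v G) = insert (u + v) (wverts G)"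
  "wedges (blow_up u v G) = (wedges G - {{u, v}}) \<union> {{u, u + v}, {u + v, v}}"
  "weight (blow_up u v G) = (weight G)(u := weight G u - 1, v := weight G v - 1, u + v := - 1)"
  by (simp_all add: blow_up_def)

lemma blow_up_commute: "u \<noteq> v \<Longrightarrow> blow_up u v G = blow_up v u G"
  by (simp add: blow_up_def add.commute insert_commute fun_upd_twist)

lemma blow_up_eq_if_same_edge: "u \<noteq> v \<Longrightarrow> {u, v} = {a, b} \<Longrightarrow> blow_up u v G = blow_up a b G"
  using blow_up_commute[of u v G] by (auto simp: doubleton_eq_iff)

text \<open>Freshness of \<open>u + v\<close> matters: on an existing vertex \<open>blow_up\<close>
  would overwrite a weight instead of inserting a vertex.\<close>

definition blowable :: "lattice \<Rightarrow> lattice \<Rightarrow> lattice wgraph \<Rightarrow> bool" where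
  "blowable u v G \<longleftrightarrow> {u, v} \<in> wedges G \<and> u \<noteq> v \<and> u + v \<notin> wverts G \<and> (\<forall>e\<in>wedges G. e \<subseteq> wverts G)"

lemma blowableD:
  assumes "blowable u v G"
  shows "{u, v} \<in> wedges G" "u \<noteq> v" "u + v \<notin> wverts G" "e \<in> wedges G \<Longrightarrow> e \<subseteq> wverts G"
    "u \<in> wverts G" "v \<in> wverts G" "u + v \<noteq> u" "u + v \<noteq> v"
proof -
  show 1: "{u, v} \<in> wedges G" "u \<noteq> v" "u + v \<notin> wverts G" and 2: "e \<in> wedges G \<Longrightarrow> e \<subseteq> wverts G"
    using assms unfolding blowable_def by blast+
  have "\<forall>e\<in>wedges G. e \<subseteq> wverts G" using assms by (simp add: blowable_def)
  from bspec[OF this 1(1)] show u: "u \<in> wverts G" and v: "v \<in> wverts G" by simp_all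
  show "u + v \<noteq> u"
  proof
    assume "u + v = u"
    then show False using 1(3) u by simp
  qed
  show "u + v \<noteq> v"
  proof
    assume "u + v = v"
    then show False using 1(3) v by simp
  qed
qed

lemma image_remove:
  assumes "\<And>x. x \<in> A \<Longrightarrow> F x = F a \<longleftrightarrow> x = a"
  shows "F ` (A - {a}) = F ` A - {F a}"
  using assms by auto

lemma image_filter:
  assumes "\<And>x. x \<in> A \<Longrightarrow> P (F x) \<longleftrightarrow> Q x"
  shows "{y \<in> F ` A. P y} = F ` {x \<in> A. Q x}"
  using assms by auto

lemma edges_without:
  assumes "x \<in> W" "\<And>e. e \<in> W \<Longrightarrow> n \<notin> e" "n \<in> a" "n \<in> b"
  shows "W = {e \<in> W - {x} \<union> {a, b}. n \<notin> e} \<union> {x}"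
  using assms by auto

lemma blow_up_iso:
  assumes f: "iso_via f G H" and G: "blowable u v G" and H: "blowable (f u) (f v) H"
  shows "wgraph_iso (blow_up u v G) (blow_up (f u) (f v) H)"
proof -
  \<comment> \<open>\<open>f\<close> need not be additive, so its value at the new vertex is set to
    \<open>f u + f v\<close> by hand.\<close>
  let ?f = "f(u + v := f u + f v)"
  note G' = blowableD[OF G] and H' = blowableD[OF H]
  have keep: "?f x = f x" if "x \<in> wverts G" for x using that G'(3) by auto
  have keep_edge: "?f ` e = f ` e" if "e \<in> wedges G" for e
    by (rule image_cong[OF refl]) (rule keep, use G'(4)[OF that] in blast)
  have "iso_via ?f (blow_up u v G) (blow_up (f u) (f v) H)"
    unfolding iso_via_def
  proof (intro conjI ballI)
    have "bij_betw ?f (wverts G) (wverts H)"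
      using f keep bij_betw_cong[of "wverts G" ?f f] by (simp add: iso_via_def)
    then have "bij_betw ?f (wverts G \<union> {u + v}) (wverts H \<union> {f u + f v})"
      using G'(3) H'(3) by (intro bij_betw_combine) (simp_all add: bij_betw_def)
    then show "bij_betw ?f (wverts (blow_up u v G)) (wverts (blow_up (f u) (f v) H))" by simp
  next
    have inj: "f ` e = f ` {u, v} \<longleftrightarrow> e = {u, v}" if "e \<in> wedges G" for e
    proof -
      have "inj_on f (wverts G)" using f by (simp add: iso_via_def bij_betw_def)
      then show ?thesis using G'(4)[OF that] G'(5,6) by (intro inj_on_image_eq_iff) auto
    qed
    have "(\<lambda>e. ?f ` e) ` (wedges G - {{u, v}}) = (\<lambda>e. f ` e) ` (wedges G - {{u, v}})"
      by (rule image_cong[OF refl]) (rule keep_edge, simp)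
    also have "\<dots> = wedges H - {{f u, f v}}"
    proof -
      have "wedges H = (\<lambda>e. f ` e) ` wedges G" using f by (simp add: iso_via_def)
      moreover have "(\<lambda>e. f ` e) ` (wedges G - {{u, v}}) = (\<lambda>e. f ` e) ` wedges G - {f ` {u, v}}"
        by (rule image_remove) (rule inj)
      ultimately show ?thesis by simp
    qed
    finally have "(\<lambda>e. ?f ` e) ` (wedges G - {{u, v}}) = wedges H - {{f u, f v}}" .
    moreover have "?f ` {u, u + v} = {f u, f u + f v}" "?f ` {u + v, v} = {f u + f v, f v}"
      using G'(7,8) by auto
    ultimately show "wedges (blow_up (f u) (f v) H) = (\<lambda>e. ?f ` e) ` wedges (blow_up u v G)"
      by (simp add: image_Un)
  next
    fix x assume x: "x \<in> wverts (blow_up u v G)"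
    show "weight (blow_up (f u) (f v) H) (?f x) = weight (blow_up u v G) x"
    proof (cases "x = u + v")
      case True
      then show ?thesis by simp
    next
      case False
      then have xG: "x \<in> wverts G" using x by simp
      have w: "weight H (f x) = weight G x" "weight H (f u) = weight G u" "weight H (f v) = weight G v"
        using f xG G'(5,6) by (simp_all add: iso_via_def)
      have "f x = f u \<longleftrightarrow> x = u" "f x = f v \<longleftrightarrow> x = v" "f x \<noteq> f u + f v"
        using iso_via_inj[OF f xG] G'(5,6) H'(3) iso_via_verts[OF f xG] by (blast, blast, metis)
      then show ?thesis using w False H'(7,8) G'(7,8) by simp
    qed
  qed
  then show ?thesis unfolding wgraph_iso_iff by blast
qed

lemma blow_up_edges_at_new:
  assumes "blowable u v G" "{x, u + v} \<in> wedges (blow_up u v G)" "x \<noteq> u + v"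
  shows "x = u \<or> x = v"
proof -
  have "{x, u + v} \<notin> wedges G" using blowableD(3,4)[OF assms(1)] by blast
  then show ?thesis using assms(2,3) by (auto simp: doubleton_eq_iff)
qed

text \<open>The neighbours of the new vertex are exactly the ends of the blown-up edge. So an
  isomorphism matching the new vertices matches these edges too, and the same \<open>f\<close>
  serves for the old graphs.\<close>

lemma iso_contract:
  assumes f: "iso_via f (blow_up u v G) (blow_up u' v' H)" and G: "blowable u v G" and H: "blowable u' v' H"
    and new: "f (u + v) = u' + v'"
  shows "iso_via f G H" "{f u, f v} = {u', v'}"
proof -
  note G' = blowableD[OF G] and H' = blowableD[OF H]
  have inj: "f x \<noteq> f y" if "x \<in> insert (u + v) (wverts G)" "y \<in> insert (u + v) (wverts G)" "x \<noteq> y" for x y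
  proof
    assume eq: "f x = f y"
    have "x = y" by (rule iso_via_inj[OF f _ _ eq]) (simp_all only: blow_up_simps that(1,2))
    then show False using that(3) by simp
  qed
  have ne: "f x \<noteq> u' + v'" if "x \<in> wverts G" for x
  proof -
    have "x \<noteq> u + v" using that G'(3) by blast
    then show ?thesis using inj[of x "u + v"] that new by simp
  qed
  have "{f u, u' + v'} \<in> wedges (blow_up u' v' H)" "{f v, u' + v'} \<in> wedges (blow_up u' v' H)"
    using iso_via_edge[OF f, of u "u + v"] iso_via_edge[OF f, of v "u + v"] unfolding new
    by (simp_all add: insert_commute)
  then have "f u = u' \<or> f u = v'" "f v = u' \<or> f v = v'"
    using blow_up_edges_at_new[OF H] ne G'(5,6) by blast+
  moreover have "f u \<noteq> f v" using inj G'(2,5,6) by blast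
  ultimately show uv: "{f u, f v} = {u', v'}" by auto
  have "bij_betw f (insert (u + v) (wverts G)) (insert (u' + v') (wverts H))"
    using f by (simp add: iso_via_def)
  then have "bij_betw f (insert (u + v) (wverts G) - {u + v}) (insert (u' + v') (wverts H) - {f (u + v)})"
    by (rule bij_betw_DiffI) (simp_all add: bij_betw_def new)
  then have b: "bij_betw f (wverts G) (wverts H)"
    using G'(3) H'(3) new by simp
  \<comment> \<open>The old edges can be read off from the blow-up: those that avoid the new vertex,
    and the one that was removed.\<close>
  have old: "wedges G = {e \<in> wedges (blow_up u v G). u + v \<notin> e} \<union> {{u, v}}"
    unfolding blow_up_simps by (rule edges_without[OF G'(1)]) (use G'(3,4) in blast)+
  have old': "wedges H = {e \<in> wedges (blow_up u' v' H). u' + v' \<notin> e} \<union> {{u', v'}}"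
    unfolding blow_up_simps by (rule edges_without[OF H'(1)]) (use H'(3,4) in blast)+
  have E: "wedges (blow_up u' v' H) = (\<lambda>e. f ` e) ` wedges (blow_up u v G)"
    using f unfolding iso_via_def by blast
  have sub: "e \<subseteq> insert (u + v) (wverts G)" if "e \<in> wedges (blow_up u v G)" for e
    using that G'(4)[of e] G'(5,6) unfolding blow_up_simps by blast
  have mem: "u' + v' \<in> f ` e \<longleftrightarrow> u + v \<in> e" if "e \<in> wedges (blow_up u v G)" for e
  proof
    assume "u' + v' \<in> f ` e"
    then obtain x where x: "x \<in> e" "f x = f (u + v)" using new by (metis imageE)
    then have "x = u + v" using inj[of x "u + v"] sub[OF that] by blast
    then show "u + v \<in> e" using x by simp
  next
    assume "u + v \<in> e"
    then show "u' + v' \<in> f ` e" using new by (metis imageI)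
  qed
  have "{e \<in> wedges (blow_up u' v' H). u' + v' \<notin> e} = (\<lambda>e. f ` e) ` {e \<in> wedges (blow_up u v G). u + v \<notin> e}"
    unfolding E by (rule image_filter) (simp add: mem)
  then have "{e \<in> wedges (blow_up u' v' H). u' + v' \<notin> e} \<union> {{u', v'}} =
      (\<lambda>e. f ` e) ` ({e \<in> wedges (blow_up u v G). u + v \<notin> e} \<union> {{u, v}})"
    by (simp only: image_Un image_insert image_empty uv)
  then have e: "wedges H = (\<lambda>e. f ` e) ` wedges G"
    unfolding old[symmetric] old'[symmetric] .
  have "weight H (f x) = weight G x" if x: "x \<in> wverts G" for x
  proof -
    have w: "weight (blow_up u' v' H) (f x) = weight (blow_up u v G) x"
      using f x unfolding iso_via_def by simp
    have "x \<noteq> u + v" "f x \<noteq> u' + v'" using x G'(3) ne by blast+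
    moreover have "f x \<in> {u', v'} \<longleftrightarrow> x \<in> {u, v}"
      using uv inj[of x u] inj[of x v] x G'(5,6) by blast
    ultimately show ?thesis using w by (auto split: if_splits)
  qed
  then show "iso_via f G H" using b e unfolding iso_via_def by blast
qed

section \<open>Blow-ups and contractions of fans\<close>

lemma gfanD:
  assumes "gfan R \<Gamma>"
  shows "circ_fan R" "wverts \<Gamma> = Domain R" "wedges \<Gamma> = {{u, v} | u v. (u, v) \<in> R}"
    "(u, v) \<in> R \<Longrightarrow> (v, w) \<in> R \<Longrightarrow> weight \<Gamma> v = - det2 u w"
  using assms by (simp_all add: gfan_def)

lemma gfan_edge_iff:
  assumes "gfan R \<Gamma>"
  shows "{a, b} \<in> wedges \<Gamma> \<longleftrightarrow> (a, b) \<in> R \<or> (b, a) \<in> R"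
proof
  assume "{a, b} \<in> wedges \<Gamma>"
  then obtain u v where "{a, b} = {u, v}" "(u, v) \<in> R" unfolding gfanD(3)[OF assms] by blast
  then show "(a, b) \<in> R \<or> (b, a) \<in> R" unfolding doubleton_eq_iff by blast
next
  assume "(a, b) \<in> R \<or> (b, a) \<in> R"
  then show "{a, b} \<in> wedges \<Gamma>" unfolding gfanD(3)[OF assms] using insert_commute[of a b "{}"] by blast
qed

lemma gfan_edges_sub:
  assumes "gfan R \<Gamma>" "e \<in> wedges \<Gamma>"
  shows "e \<subseteq> wverts \<Gamma>"
proof -
  interpret circ_fan R using gfanD(1)[OF assms(1)] .
  show ?thesis using assms(2) inV unfolding gfanD(2,3)[OF assms(1)] by blast
qed

lemma gfan_blowable:
  assumes "gfan R \<Gamma>" "(u, v) \<in> R"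
  shows "blowable u v \<Gamma>"
proof -
  interpret circ_fan R using gfanD(1)[OF assms(1)] .
  show ?thesis
    unfolding blowable_def
  proof (intro conjI ballI)
    show "{u, v} \<in> wedges \<Gamma>" using gfan_edge_iff[OF assms(1)] assms(2) by blast
    show "u \<noteq> v" using det[OF assms(2)] det2_eq_1_nonzero by blast
    show "u + v \<notin> wverts \<Gamma>" using sum_not_vertex[OF assms(2)] gfanD(2)[OF assms(1)] by simp
    show "e \<subseteq> wverts \<Gamma>" if "e \<in> wedges \<Gamma>" for e using gfan_edges_sub[OF assms(1) that] .
  qed
qed

lemma gfan_blowable_edge:
  assumes "gfan R \<Gamma>" "{u, v} \<in> wedges \<Gamma>"
  shows "blowable u v \<Gamma>"
proof (cases "(u, v) \<in> R")
  case True
  then show ?thesis using gfan_blowable[OF assms(1)] by blast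
next
  case False
  then have "blowable v u \<Gamma>" using gfan_blowable[OF assms(1)] gfan_edge_iff[OF assms(1)] assms(2) by blast
  then show ?thesis unfolding blowable_def by (simp add: insert_commute add.commute) fast
qed

text \<open>If \<open>a\<close> precedes \<open>u\<close>, replacing the neighbour \<open>v\<close>
  of \<open>u\<close> by \<open>u + v\<close> adds \<open>det2 a u = 1\<close> to
  \<open>det2 a v\<close>, which is the drop of the weight by 1; likewise at
  \<open>v\<close>.\<close>

lemma gfan_blow_up:
  assumes g: "gfan R \<Gamma>" and uv: "(u, v) \<in> R"
  shows "gfan (blow_arcs u v R) (blow_up u v \<Gamma>)"
proof -
  interpret circ_fan R using gfanD(1)[OF g] .
  let ?R = "blow_arcs u v R"
  have ne: "u \<noteq> v" "u + v \<noteq> u" "u + v \<noteq> v" "u + v \<notin> Domain R"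
    using blowableD[OF gfan_blowable[OF g uv]] gfanD(2)[OF g] by simp_all
  have mem: "(a, b) \<in> ?R \<longleftrightarrow> (a, b) \<in> R \<and> \<not> (a = u \<and> b = v) \<or> a = u \<and> b = u + v \<or> a = u + v \<and> b = v" for a b
    unfolding blow_arcs_def by simp blast
  have fresh: "a \<noteq> u + v \<and> b \<noteq> u + v" if "(a, b) \<in> R" for a b
    using ne(4) inV[OF that] by metis
  show ?thesis
    unfolding gfan_def
  proof (intro conjI allI impI)
    show "circ_fan ?R" by (rule circ_fan_blow_arcs[OF uv])
    show "wverts (blow_up u v \<Gamma>) = Domain ?R"
      by (simp add: Domain_blow_arcs[OF uv] gfanD(2)[OF g])
    have nvu: "(v, u) \<notin> R" using not_both_arcs[OF uv] .
    have "{{a, b} | a b. (a, b) \<in> ?R} = {{a, b} | a b. (a, b) \<in> R \<and> \<not> (a = u \<and> b = v)} \<union> {{u, u + v}, {u + v, v}}"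
      unfolding mem by blast
    also have "{{a, b} | a b. (a, b) \<in> R \<and> \<not> (a = u \<and> b = v)} = wedges \<Gamma> - {{u, v}}"
      unfolding gfanD(3)[OF g]
    proof (intro equalityI subsetI)
      fix e assume "e \<in> {{a, b} | a b. (a, b) \<in> R \<and> \<not> (a = u \<and> b = v)}"
      then obtain a b where ab: "e = {a, b}" "(a, b) \<in> R" "\<not> (a = u \<and> b = v)" by blast
      have "e \<noteq> {u, v}"
      proof
        assume "e = {u, v}"
        then have "a = v \<and> b = u" using ab by (simp add: doubleton_eq_iff)
        then show False using ab(2) nvu by simp
      qed
      then show "e \<in> {{a, b} | a b. (a, b) \<in> R} - {{u, v}}" using ab by blast
    next
      fix e assume "e \<in> {{a, b} | a b. (a, b) \<in> R} - {{u, v}}"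
      then show "e \<in> {{a, b} | a b. (a, b) \<in> R \<and> \<not> (a = u \<and> b = v)}" by blast
    qed
    finally show "wedges (blow_up u v \<Gamma>) = {{a, b} | a b. (a, b) \<in> ?R}" by simp
    fix a b c assume ab: "(a, b) \<in> ?R" and bc: "(b, c) \<in> ?R"
    show "weight (blow_up u v \<Gamma>) b = - det2 a c"
    proof (cases "b = u + v")
      case True
      then have "a = u" "c = v" using ab bc fresh ne unfolding mem by blast+
      then show ?thesis using True det[OF uv] by simp
    next
      case b: False
      show ?thesis
      proof (cases "b = u")
        case True
        have au: "(a, u) \<in> R" using ab True ne unfolding mem by metis
        have "c = u + v" using bc True ne succ_unique[OF uv] unfolding mem by metis
        then show ?thesis
          using True ne gfanD(4)[OF g au uv] det[OF au] by simp
      next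
        case bu: False
        show ?thesis
        proof (cases "b = v")
          case True
          have vc: "(v, c) \<in> R" using bc True ne unfolding mem by metis
          have "a = u + v" using ab True ne pred_unique[OF uv] unfolding mem by metis
          then show ?thesis
            using True ne gfanD(4)[OF g uv vc] det[OF vc] by simp
        next
          case False
          then have "(a, b) \<in> R" "(b, c) \<in> R" using ab bc b bu unfolding mem by metis+
          then show ?thesis using gfanD(4)[OF g] False b bu by simp
        qed
      qed
    qed
  qed
qed

text \<open>The contracted graph takes its weight function from \<open>\<Gamma>\<close>, also away
  from the vertices, so blowing up returns \<open>\<Gamma>\<close> itself and not merely an
  isomorphic graph.\<close>

lemma gfan_contract:
  assumes g: "gfan R \<Gamma>" and um: "(u, m) \<in> R" and mv: "(m, v) \<in> R" and m: "m = u + v"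
  obtains S \<Gamma>0 where "gfan S \<Gamma>0" "(u, v) \<in> S" "wverts \<Gamma>0 = wverts \<Gamma> - {m}" "blow_up u v \<Gamma>0 = \<Gamma>"
    "weight \<Gamma>0 = (weight \<Gamma>)(u := weight \<Gamma> u + 1, v := weight \<Gamma> v + 1)"
    "\<forall>a b. a \<noteq> m \<longrightarrow> b \<noteq> m \<longrightarrow> (a, b) \<in> R \<longrightarrow> (a, b) \<in> S"
proof -
  interpret circ_fan R using gfanD(1)[OF g] .
  define S where "S = R - {(u, m), (m, v)} \<union> {(u, v)}"
  note con = contract_arcs[OF um mv m, folded S_def]
  interpret S: circ_fan S by (rule con(1))
  define \<Gamma>0 :: "lattice wgraph" where "\<Gamma>0 = \<lparr>wverts = Domain S, wedges = {{a, b} | a b. (a, b) \<in> S},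
    weight = (weight \<Gamma>)(u := weight \<Gamma> u + 1, v := weight \<Gamma> v + 1)\<rparr>"
  have uv: "u \<noteq> v" "u \<noteq> m" "v \<noteq> m"
    using S.det[OF con(4)] det[OF um] det[OF mv] det2_eq_1_nonzero by blast+
  have mem: "(a, b) \<in> S \<longleftrightarrow> (a, b) \<in> R \<and> \<not> (a = u \<and> b = m) \<and> \<not> (a = m \<and> b = v) \<or> a = u \<and> b = v" for a b
    unfolding S_def by simp blast
  have mS: "m \<notin> Domain S" using con(2) by simp
  have g0: "gfan S \<Gamma>0"
    unfolding gfan_def
  proof (intro conjI allI impI)
    show "circ_fan S" by (rule con(1))
    show "wverts \<Gamma>0 = Domain S" "wedges \<Gamma>0 = {{a, b} | a b. (a, b) \<in> S}" by (simp_all add: \<Gamma>0_def)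
    fix a b c assume ab: "(a, b) \<in> S" and bc: "(b, c) \<in> S"
    have w0: "weight \<Gamma>0 = (weight \<Gamma>)(u := weight \<Gamma> u + 1, v := weight \<Gamma> v + 1)" by (simp add: \<Gamma>0_def)
    have bm: "b \<noteq> m" "a \<noteq> m" "c \<noteq> m" using S.inV[OF ab] S.inV[OF bc] mS by metis+
    show "weight \<Gamma>0 b = - det2 a c"
    proof (cases "b = u")
      case True
      have au: "(a, u) \<in> R" using ab True uv unfolding mem by metis
      have "c = v" using S.succ_unique[OF con(4)] bc True by metis
      then show ?thesis using True uv w0 gfanD(4)[OF g au um] det[OF au] m by simp
    next
      case bu: False
      show ?thesis
      proof (cases "b = v")
        case True
        have vc: "(v, c) \<in> R" using bc True uv unfolding mem by metis
        have "a = u" using S.pred_unique[OF con(4)] ab True by metis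
        then show ?thesis using True uv w0 gfanD(4)[OF g mv vc] det[OF vc] m by simp
      next
        case False
        then have "(a, b) \<in> R" "(b, c) \<in> R" using ab bc bu unfolding mem by metis+
        then show ?thesis using gfanD(4)[OF g] False bu w0 by simp
      qed
    qed
  qed
  have g1: "gfan R (blow_up u v \<Gamma>0)"
    using gfan_blow_up[OF g0 con(4)] con(3) by simp
  have "wverts (blow_up u v \<Gamma>0) = wverts \<Gamma>" using gfanD(2)[OF g1] gfanD(2)[OF g] by simp
  moreover have "wedges (blow_up u v \<Gamma>0) = wedges \<Gamma>" using gfanD(3)[OF g1] gfanD(3)[OF g] by simp
  moreover have "weight (blow_up u v \<Gamma>0) = weight \<Gamma>"
  proof
    fix x
    have "weight \<Gamma> m = - 1" using gfanD(4)[OF g um mv] S.det[OF con(4)] by simp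
    then show "weight (blow_up u v \<Gamma>0) x = weight \<Gamma> x"
      using uv m by (simp add: \<Gamma>0_def)
  qed
  ultimately have eq: "blow_up u v \<Gamma>0 = \<Gamma>" by (intro wgraph.equality) simp_all
  have V: "wverts \<Gamma>0 = wverts \<Gamma> - {m}" using gfanD(2)[OF g0] gfanD(2)[OF g] con(2) by simp
  have keep: "\<forall>a b. a \<noteq> m \<longrightarrow> b \<noteq> m \<longrightarrow> (a, b) \<in> R \<longrightarrow> (a, b) \<in> S"
    unfolding mem by blast
  show thesis
    using that[OF g0 con(4) V eq _ keep] by (simp add: \<Gamma>0_def)
qed

lemma (in circ_fan) exc_iff:
  assumes "gfan R \<Gamma>" "z \<in> Domain R"
  shows "exc z \<longleftrightarrow> weight \<Gamma> z = - 1"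
proof -
  obtain u where uz: "(u, z) \<in> R" using predE[OF assms(2)] by blast
  obtain w where zw: "(z, w) \<in> R" using succE[OF assms(2)] by blast
  have w: "weight \<Gamma> z = - det2 u w" using gfanD(4)[OF assms(1) uz zw] .
  show ?thesis
  proof
    assume "exc z"
    then obtain u' w' where "(u', z) \<in> R" "(z, w') \<in> R" "u' + w' = z" unfolding exc_def by blast
    then have "u + w = z" using succ_unique[OF zw] pred_unique[OF uz] by simp
    from arg_cong[OF this, of "det2 u"] show "weight \<Gamma> z = - 1" using w det[OF uz] by simp
  next
    assume "weight \<Gamma> z = - 1"
    then have "u + w = z" using add_eq_zscale_det2[OF det[OF uz] det[OF zw]] w by simp
    then show "exc z" unfolding exc_def using uz zw by blast
  qed
qed

section \<open>Nodes and their parents\<close>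

definition node :: "lattice wgraph \<Rightarrow> lattice \<Rightarrow> bool" where
  "node \<Gamma> m \<longleftrightarrow> weighted_circular_graph \<Gamma> \<and> 6 \<le> card (wverts \<Gamma>) \<and> {v \<in> wverts \<Gamma>. weight \<Gamma> v = - 1} = {m}"

lemma nodeD:
  assumes "node \<Gamma> m"
  shows "weighted_circular_graph \<Gamma>" "6 \<le> card (wverts \<Gamma>)" "{v \<in> wverts \<Gamma>. weight \<Gamma> v = - 1} = {m}"
    "m \<in> wverts \<Gamma>" "weight \<Gamma> m = - 1" "\<And>x. x \<in> wverts \<Gamma> \<Longrightarrow> weight \<Gamma> x = - 1 \<Longrightarrow> x = m"
proof -
  show "weighted_circular_graph \<Gamma>" "6 \<le> card (wverts \<Gamma>)" and m: "{v \<in> wverts \<Gamma>. weight \<Gamma> v = - 1} = {m}"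
    using assms by (simp_all add: node_def)
  have "m \<in> {v \<in> wverts \<Gamma>. weight \<Gamma> v = - 1}" unfolding m by simp
  then show "m \<in> wverts \<Gamma>" "weight \<Gamma> m = - 1" by simp_all
  fix x assume "x \<in> wverts \<Gamma>" "weight \<Gamma> x = - 1"
  then have "x \<in> {v \<in> wverts \<Gamma>. weight \<Gamma> v = - 1}" by simp
  then show "x = m" unfolding m by simp
qed

lemma node_neighbours:
  assumes "node \<Gamma> m" "gfan R \<Gamma>"
  obtains u v where "(u, m) \<in> R" "(m, v) \<in> R" "m = u + v" "u \<noteq> v" "u \<noteq> m" "v \<noteq> m" "u \<in> wverts \<Gamma>" "v \<in> wverts \<Gamma>"
proof -
  interpret circ_fan R using gfanD(1)[OF assms(2)] .
  have m: "m \<in> Domain R" using nodeD(4)[OF assms(1)] gfanD(2)[OF assms(2)] by simp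
  then obtain u v where uv: "(u, m) \<in> R" "(m, v) \<in> R" "u + v = m"
    using exc_iff[OF assms(2) m] nodeD(5)[OF assms(1)] unfolding exc_def by blast
  have d: "det2 u v = 1" using det[OF uv(1)] uv(3)[symmetric] by simp
  have "u \<noteq> v" "u \<noteq> m" "v \<noteq> m"
    using det2_eq_1_nonzero[OF d] det2_eq_1_nonzero[OF det[OF uv(1)]] det2_eq_1_nonzero[OF det[OF uv(2)]] by blast+
  then show thesis
    by (rule that[OF uv(1,2) uv(3)[symmetric]])
      (use inV[OF uv(1)] inV[OF uv(2)] gfanD(2)[OF assms(2)] in simp_all)
qed

text \<open>Seven vertices leave six after contraction, as many as \<open>third_exceptional\<close>
  and the notion of a node require. Only the weights at \<open>u\<close> and \<open>v\<close>
  change, so every \<open>-1\<close> of the contraction sits there; one exists, and if both had it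
  there would be a third elsewhere.\<close>

lemma node_parent:
  assumes nd: "node \<Gamma> m" and g: "gfan R \<Gamma>" and um: "(u, m) \<in> R" and mv: "(m, v) \<in> R" and m: "m = u + v"
    and n: "7 \<le> card (wverts \<Gamma>)"
  obtains S \<Gamma>0 m0 where "gfan S \<Gamma>0" "(u, v) \<in> S" "node \<Gamma>0 m0" "m0 = u \<or> m0 = v" "blow_up u v \<Gamma>0 = \<Gamma>"
    "card (wverts \<Gamma>) = Suc (card (wverts \<Gamma>0))"
proof -
  obtain S \<Gamma>0 where g0: "gfan S \<Gamma>0" "(u, v) \<in> S" "wverts \<Gamma>0 = wverts \<Gamma> - {m}" "blow_up u v \<Gamma>0 = \<Gamma>"
    "weight \<Gamma>0 = (weight \<Gamma>)(u := weight \<Gamma> u + 1, v := weight \<Gamma> v + 1)"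
    "\<forall>a b. a \<noteq> m \<longrightarrow> b \<noteq> m \<longrightarrow> (a, b) \<in> R \<longrightarrow> (a, b) \<in> S"
    by (rule gfan_contract[OF g um mv m])
  interpret S: circ_fan S using gfanD(1)[OF g0(1)] .
  have fin: "finite (wverts \<Gamma>)" using n by (metis card.infinite not_numeral_le_zero)
  have card: "card (wverts \<Gamma>) = Suc (card (wverts \<Gamma>0))"
    using g0(3) card_Suc_Diff1[OF fin nodeD(4)[OF nd]] by simp
  have n0: "6 \<le> card (Domain S)" using card n gfanD(2)[OF g0(1)] by simp
  have only: "z = u \<or> z = v" if "z \<in> Domain S" "S.exc z" for z
  proof (rule ccontr)
    assume no: "\<not> ?thesis"
    have "weight \<Gamma>0 z = - 1" using S.exc_iff[OF g0(1) that(1)] that(2) by blast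
    then have "weight \<Gamma> z = - 1" using g0(5) no by simp
    moreover have "z \<in> wverts \<Gamma> - {m}" using that(1) g0(3) gfanD(2)[OF g0(1)] by simp
    ultimately show False using nodeD(6)[OF nd, of z] by blast
  qed
  have uV: "u \<in> Domain S" "v \<in> Domain S" using S.inV[OF g0(2)] by blast+
  have "\<not> (S.exc u \<and> S.exc v)"
  proof
    assume both: "S.exc u \<and> S.exc v"
    obtain t where t: "(t, u) \<in> S" "t + v = u"
      using both S.succ_unique[OF g0(2)] unfolding S.exc_def by blast
    obtain w where w: "(v, w) \<in> S" "u + w = v"
      using both S.pred_unique[OF g0(2)] unfolding S.exc_def by blast
    show False
      using S.third_exceptional[OF t(1) g0(2) w(1) t(2) w(2) n0] only by blast
  qed
  moreover obtain m0 where m0: "m0 \<in> Domain S" "S.exc m0"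
    using S.exceptional_exists n0 by fastforce
  ultimately have "z = m0" if "z \<in> Domain S" "S.exc z" for z
    using only that by blast
  then have "{x \<in> wverts \<Gamma>0. weight \<Gamma>0 x = - 1} = {m0}"
    using m0 S.exc_iff[OF g0(1)] gfanD(2)[OF g0(1)] by blast
  then have "node \<Gamma>0 m0"
    unfolding node_def using n0 gfanD(2)[OF g0(1)] gfan_imp_weighted_circular_graph[OF g0(1)] by simp
  then show thesis using that[OF g0(1,2) _ _ g0(4) card] only[OF m0] by blast
qed

lemma (in circ_fan) arc_list_from:
  assumes z: "z \<in> Domain R"
  obtains xs where "distinct xs" "set xs = Domain R" "xs ! 0 = z" "length xs = card (Domain R)" "3 \<le> length xs"
    "\<And>i. i < length xs \<Longrightarrow> (xs ! i, xs ! (Suc i mod length xs)) \<in> R"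
proof -
  obtain xs where xs: "distinct xs" "3 \<le> length xs" "set xs = Domain R"
    "R = {(xs ! i, xs ! (Suc i mod length xs)) | i. i < length xs}"
    by (rule arc_list)
  let ?n = "length xs"
  obtain k where k: "k < ?n" "xs ! k = z" using z xs(3) by (metis in_set_conv_nth)
  have step: "(xs ! i, xs ! (Suc i mod ?n)) \<in> R" if "i < ?n" for i
  proof -
    have "(xs ! i, xs ! (Suc i mod ?n)) \<in> {(xs ! i, xs ! (Suc i mod ?n)) | i. i < ?n}" using that by blast
    then show ?thesis by (subst xs(4))
  qed
  have n0: "0 < ?n" using k by linarith
  show thesis
  proof (rule that[of "rotate k xs"])
    show "rotate k xs ! 0 = z" using nth_rotate[of 0 xs k] n0 k by simp
    show "length (rotate k xs) = card (Domain R)" using distinct_card[OF xs(1)] xs(3) by simp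
    fix i assume "i < length (rotate k xs)"
    then have i: "i < ?n" by simp
    have "(xs ! ((k + i) mod ?n), xs ! (Suc ((k + i) mod ?n) mod ?n)) \<in> R"
      using step n0 by simp
    moreover have "Suc ((k + i) mod ?n) mod ?n = (k + Suc i mod ?n) mod ?n"
      by (simp add: mod_Suc_eq mod_add_right_eq)
    ultimately show "(rotate k xs ! i, rotate k xs ! (Suc i mod length (rotate k xs))) \<in> R"
      using nth_rotate[OF i, of k] nth_rotate[of "Suc i mod ?n" xs k] n0 by simp
  qed (use xs in simp_all)
qed

lemma wgraph_iso_weighted_cycle:
  assumes g: "gfan R \<Gamma>" and xs: "distinct xs" "set xs = Domain R"
    and step: "\<And>i. i < length xs \<Longrightarrow> (xs ! i, xs ! (Suc i mod length xs)) \<in> R"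
    and ws: "ws = map (weight \<Gamma>) xs"
  shows "wgraph_iso (weighted_cycle ws) \<Gamma>"
proof -
  interpret circ_fan R using gfanD(1)[OF g] .
  have n: "length xs > 0" using xs arc_exists by (metis DomainI length_pos_if_in_set)
  have "iso_via (\<lambda>i. xs ! i) (weighted_cycle ws) \<Gamma>"
    unfolding iso_via_def
  proof (intro conjI ballI)
    show "bij_betw ((!) xs) (wverts (weighted_cycle ws)) (wverts \<Gamma>)"
      using xs gfanD(2)[OF g] by (intro bij_betw_nth) (simp_all add: weighted_cycle_def ws)
    show "weight \<Gamma> (xs ! v) = weight (weighted_cycle ws) v" if "v \<in> wverts (weighted_cycle ws)" for v
      using that by (simp add: weighted_cycle_def ws)
    have "(\<lambda>e. (!) xs ` e) ` wedges (weighted_cycle ws) = {{xs ! i, xs ! (Suc i mod length xs)} | i. i < length xs}"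
      unfolding weighted_cycle_def ws by (simp add: setcompr_eq_image image_image)
    also have "\<dots> = {{u, v} | u v. (u, v) \<in> R}"
    proof (intro equalityI subsetI)
      fix e assume "e \<in> {{xs ! i, xs ! (Suc i mod length xs)} | i. i < length xs}"
      then show "e \<in> {{u, v} | u v. (u, v) \<in> R}" using step by blast
    next
      fix e assume "e \<in> {{u, v} | u v. (u, v) \<in> R}"
      then obtain u v where uv: "e = {u, v}" "(u, v) \<in> R" by blast
      then have "u \<in> set xs" using xs by blast
      then obtain i where i: "i < length xs" "u = xs ! i" by (metis in_set_conv_nth)
      then have "v = xs ! (Suc i mod length xs)" using step succ_unique uv by blast
      then show "e \<in> {{xs ! i, xs ! (Suc i mod length xs)} | i. i < length xs}" using i uv by blast
    qed
    finally show "wedges \<Gamma> = (\<lambda>e. (!) xs ` e) ` wedges (weighted_cycle ws)"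
      using gfanD(3)[OF g] by simp
  qed
  then show ?thesis unfolding wgraph_iso_iff by blast
qed

section \<open>Graphs with a single weight \<open>-1\<close>\<close>

lemma node_sum:
  assumes "node \<Gamma> m" "gfan R \<Gamma>" "(u, m) \<in> R" "(m, v) \<in> R"
  shows "m = u + v" "u \<noteq> v"
proof -
  interpret circ_fan R using gfanD(1)[OF assms(2)] .
  obtain u' v' where "(u', m) \<in> R" "(m, v') \<in> R" "m = u' + v'" "u' \<noteq> v'"
    by (rule node_neighbours[OF assms(1,2)])
  then show "m = u + v" "u \<noteq> v"
    using pred_unique[OF assms(3)] succ_unique[OF assms(4)] by simp_all
qed

text \<open>The contraction has five vertices, hence a weight \<open>-1\<close>, which must sit at
  \<open>u\<close> or \<open>v\<close>; \<open>five_cycle_exceptional\<close> then fixes all weights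
  up to \<open>A\<close>. The conditions on \<open>A\<close> say that neither \<open>w\<close> nor
  \<open>t\<close> has weight \<open>-1\<close>.\<close>

lemma six_node:
  assumes nd: "node \<Gamma> m" and g: "gfan R \<Gamma>" and n: "card (wverts \<Gamma>) = 6"
  obtains A v w z t u where "distinct [m, v, w, z, t, u]" "set [m, v, w, z, t, u] = Domain R"
    "(m, v) \<in> R" "(v, w) \<in> R" "(w, z) \<in> R" "(z, t) \<in> R" "(t, u) \<in> R" "(u, m) \<in> R"
    "map (weight \<Gamma>) [m, v, w, z, t, u] = [- 1, - 2, A, 0, - A - 1, - 2]" "A \<noteq> 0" "A \<noteq> - 1"
proof -
  interpret circ_fan R using gfanD(1)[OF g] .
  have VD: "wverts \<Gamma> = Domain R" using gfanD(2)[OF g] .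
  obtain xs where xs: "distinct xs" "set xs = Domain R" "xs ! 0 = m" "length xs = card (Domain R)"
    and step: "\<And>i. i < length xs \<Longrightarrow> (xs ! i, xs ! (Suc i mod length xs)) \<in> R"
    using arc_list_from[of m] nodeD(4)[OF nd] VD by metis
  have l: "length xs = 6" using xs(4) n VD by simp
  then obtain v w z t u where xs_eq: "xs = [m, v, w, z, t, u]"
    using xs(3) by (auto simp: length_Suc_conv eval_nat_numeral)
  have arcs: "(m, v) \<in> R" "(v, w) \<in> R" "(w, z) \<in> R" "(z, t) \<in> R" "(t, u) \<in> R" "(u, m) \<in> R"
    using step[of 0] step[of 1] step[of 2] step[of 3] step[of 4] step[of 5] unfolding xs_eq by simp_all
  have dist: "distinct [m, v, w, z, t, u]" and setxs: "set [m, v, w, z, t, u] = Domain R"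
    using xs(1,2) unfolding xs_eq by simp_all
  have m: "m = u + v" using node_sum[OF nd g arcs(6,1)] by simp
  obtain S \<Gamma>0 where g0: "gfan S \<Gamma>0" "(u, v) \<in> S" "wverts \<Gamma>0 = wverts \<Gamma> - {m}" "blow_up u v \<Gamma>0 = \<Gamma>"
    and w0: "weight \<Gamma>0 = (weight \<Gamma>)(u := weight \<Gamma> u + 1, v := weight \<Gamma> v + 1)"
    and keep: "\<forall>a b. a \<noteq> m \<longrightarrow> b \<noteq> m \<longrightarrow> (a, b) \<in> R \<longrightarrow> (a, b) \<in> S"
    by (rule gfan_contract[OF g arcs(6,1) m])
  interpret S: circ_fan S using gfanD(1)[OF g0(1)] .
  have D0: "Domain S = Domain R - {m}" using g0(3) gfanD(2)[OF g0(1)] VD by simp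
  have ne: "v \<noteq> m" "w \<noteq> m" "z \<noteq> m" "t \<noteq> m" "u \<noteq> m" using dist by auto
  have S_arcs: "(v, w) \<in> S" "(w, z) \<in> S" "(z, t) \<in> S" "(t, u) \<in> S"
    using keep ne arcs by blast+
  have "card (Domain S) = 5"
    using n VD card_Diff_singleton[of m "Domain R"] nodeD(4)[OF nd] unfolding D0 by simp
  then obtain y where y: "y \<in> Domain S" "S.exc y" using S.exceptional_exists by fastforce
  have y1: "weight \<Gamma>0 y = - 1" using S.exc_iff[OF g0(1) y(1)] y(2) by simp
  have "y = u \<or> y = v"
  proof (rule ccontr)
    assume "\<not> ?thesis"
    then have "weight \<Gamma> y = - 1" using y1 w0 by simp
    then show False using nodeD(6)[OF nd, of y] y(1) D0 VD by blast
  qed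
  then have uv: "det2 t v = 1 \<or> det2 u w = 1"
    using y1 gfanD(4)[OF g0(1) S_arcs(4) g0(2)] gfanD(4)[OF g0(1) g0(2) S_arcs(1)] by auto
  have inR: "w \<in> wverts \<Gamma>" "t \<in> wverts \<Gamma>" using inV[OF arcs(3)] inV[OF arcs(5)] VD by simp_all
  have ww: "weight \<Gamma> w = - det2 v z" and wt: "weight \<Gamma> t = - det2 z u"
    using gfanD(4)[OF g arcs(2,3)] gfanD(4)[OF g arcs(4,5)] by simp_all
  have n1: "weight \<Gamma> w \<noteq> - 1" "weight \<Gamma> t \<noteq> - 1"
    using nodeD(6)[OF nd inR(1)] nodeD(6)[OF nd inR(2)] ne by blast+
  have five: "det2 t v = 1 \<and> det2 u w = 1 \<and> det2 w t = 0 \<and> det2 v z = 1 - det2 z u"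
    by (rule five_cycle_exceptional)
      (use uv n1 ww wt S.det[OF g0(2)] S_arcs[THEN S.det] in simp_all)
  define A where "A = weight \<Gamma> w"
  have wv: "weight \<Gamma> v = - 2" using gfanD(4)[OF g arcs(1,2)] five det[OF arcs(2)] m by simp
  have wu: "weight \<Gamma> u = - 2" using gfanD(4)[OF g arcs(5,6)] five det[OF arcs(5)] m by simp
  have wz: "weight \<Gamma> z = 0" using gfanD(4)[OF g arcs(3,4)] five by simp
  have wt': "weight \<Gamma> t = - A - 1" using wt ww five A_def by simp
  have "map (weight \<Gamma>) [m, v, w, z, t, u] = [- 1, - 2, A, 0, - A - 1, - 2]"
    using wv wu wz wt' nodeD(5)[OF nd] A_def by simp
  then show thesis
    by (rule that[OF dist setxs arcs]) (use n1 wt' A_def in simp_all)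
qed

text \<open>Passing from the parent, its vertex of weight \<open>-1\<close> becomes a neighbour of
  weight \<open>-2\<close>, while the other neighbour had weight at most \<open>-2\<close> by
  induction and drops to at most \<open>-3\<close>. So equality is possible only in the base case of
  six vertices, where both weights are \<open>-2\<close>.\<close>

lemma node_neighbour_weights:
  assumes "node \<Gamma> m" "gfan R \<Gamma>" "(u, m) \<in> R" "(m, v) \<in> R"
  shows "weight \<Gamma> u \<le> - 2 \<and> weight \<Gamma> v \<le> - 2 \<and> (weight \<Gamma> u = weight \<Gamma> v \<longrightarrow> card (wverts \<Gamma>) = 6)"
  using assms
proof (induction "card (wverts \<Gamma>)" arbitrary: \<Gamma> m R u v rule: less_induct)
  case less
  note nd = less.prems(1) and g = less.prems(2) and um = less.prems(3) and mv = less.prems(4)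
  interpret circ_fan R using gfanD(1)[OF g] .
  note m = node_sum[OF nd g um mv]
  show ?case
  proof (cases "card (wverts \<Gamma>) = 6")
    case True
    obtain A v' w z t u' where "(m, v') \<in> R" "(u', m) \<in> R"
      "map (weight \<Gamma>) [m, v', w, z, t, u'] = [- 1, - 2, A, 0, - A - 1, - 2]"
      by (rule six_node[OF nd g True])
    then show ?thesis
      using pred_unique[OF um] succ_unique[OF mv] True by simp
  next
    case False
    then have n: "7 \<le> card (wverts \<Gamma>)" using nodeD(2)[OF nd] by simp
    obtain S \<Gamma>0 m0 where S: "gfan S \<Gamma>0" "(u, v) \<in> S" "node \<Gamma>0 m0" "m0 = u \<or> m0 = v" "blow_up u v \<Gamma>0 = \<Gamma>"
      "card (wverts \<Gamma>) = Suc (card (wverts \<Gamma>0))"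
      by (rule node_parent[OF nd g um mv m(1) n])
    interpret S: circ_fan S using gfanD(1)[OF S(1)] .
    have lt: "card (wverts \<Gamma>0) < card (wverts \<Gamma>)" using S(6) by simp
    note ne = blowableD(7,8)[OF gfan_blowable[OF S(1,2)]]
    have w: "weight \<Gamma> u = weight \<Gamma>0 u - 1" "weight \<Gamma> v = weight \<Gamma>0 v - 1"
      unfolding S(5)[symmetric] using m(2) ne by simp_all
    show ?thesis
      using S(4)
    proof
      assume m0: "m0 = u"
      obtain t where "(t, u) \<in> S" using S.predE S.inV[OF S(2)] by blast
      then have "weight \<Gamma>0 v \<le> - 2"
        using less.hyps[OF lt S(3,1), of t v] S(2) m0 by simp
      then show ?thesis using w nodeD(5)[OF S(3)] m0 by simp
    next
      assume m0: "m0 = v"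
      obtain t where "(v, t) \<in> S" using S.inV[OF S(2)] by blast
      then have "weight \<Gamma>0 u \<le> - 2"
        using less.hyps[OF lt S(3,1), of u t] S(2) m0 by simp
      then show ?thesis using w nodeD(5)[OF S(3)] m0 by simp
    qed
  qed
qed

text \<open>A swap needs equal weights, hence six vertices. It would then send \<open>t\<close>, the
  other neighbour of \<open>u\<close>, to \<open>y\<close>, the other neighbour of \<open>v\<close>,
  but their weights \<open>- A - 1\<close> and \<open>A\<close> have different parity.\<close>

lemma node_neighbours_not_swapped:
  assumes nd: "node \<Gamma> m" and g: "gfan R \<Gamma>" and um: "(u, m) \<in> R" and mv: "(m, v) \<in> R"
    and f: "iso_via f \<Gamma> \<Gamma>"
  shows "f u \<noteq> v"
proof
  assume fu: "f u = v"
  interpret circ_fan R using gfanD(1)[OF g] .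
  have V: "u \<in> wverts \<Gamma>" "m \<in> wverts \<Gamma>" using inV[OF um] gfanD(2)[OF g] by simp_all
  have fm: "f m = m" using iso_via_minus_ones[OF f] nodeD(3)[OF nd] by blast
  have w: "weight \<Gamma> (f x) = weight \<Gamma> x" if "x \<in> wverts \<Gamma>" for x
    using f that by (simp add: iso_via_def)
  have "weight \<Gamma> u = weight \<Gamma> v" using w[OF V(1)] fu by simp
  then have "card (wverts \<Gamma>) = 6" using node_neighbour_weights[OF nd g um mv] by blast
  then obtain A v' y z t u' where six: "distinct [m, v', y, z, t, u']" "(m, v') \<in> R" "(v', y) \<in> R" "(t, u') \<in> R" "(u', m) \<in> R"
    "map (weight \<Gamma>) [m, v', y, z, t, u'] = [- 1, - 2, A, 0, - A - 1, - 2]"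
    by (rule six_node[OF nd g])
  have u: "u' = u" and v: "v' = v" using six pred_unique[OF um] succ_unique[OF mv] by blast+
  have t: "t \<in> wverts \<Gamma>" using inV[OF six(4)] gfanD(2)[OF g] by simp
  have "{f t, v} \<in> wedges \<Gamma>"
    using iso_via_edge[OF f, of t u] gfan_edge_iff[OF g, of t u] six(4) u fu by simp
  then have "(f t, v) \<in> R \<or> (v, f t) \<in> R" using gfan_edge_iff[OF g] by blast
  then have "f t = m \<or> f t = y" using pred_unique[OF mv] succ_unique[OF six(3)] v by blast
  then show False
  proof
    assume "f t = m"
    then have "t = m" using iso_via_inj[OF f t V(2)] fm by simp
    then show False using six(1) by simp
  next
    assume "f t = y"
    then have "weight \<Gamma> y = weight \<Gamma> t" using w[OF t] by simp
    then have "A = - A - 1" using six(6) by simp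
    then show False by presburger
  qed
qed

section \<open>The six-cycles of the roots\<close>

lemma six_cycle_simps:
  "wverts (weighted_cycle [x0, x1, x2, x3, x4, x5]) = {0, 1, 2, 3, 4, 5}"
  "wedges (weighted_cycle [x0, x1, x2, x3, x4, x5]) = {{0, 1}, {1, 2}, {2, 3}, {3, 4}, {4, 5}, {5, 0}}"
proof -
  have L: "length [x0, x1, x2, x3, x4, x5] = 6" by simp
  have I: "{..<6::nat} = {0, 1, 2, 3, 4, 5}" by auto
  then show "wverts (weighted_cycle [x0, x1, x2, x3, x4, x5]) = {0, 1, 2, 3, 4, 5}"
    by (simp only: weighted_cycle_def wgraph.select_convs L)
  have "wedges (weighted_cycle [x0, x1, x2, x3, x4, x5]) = (\<lambda>i. {i, Suc i mod 6}) ` {..<6}"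
    unfolding weighted_cycle_def wgraph.select_convs L by blast
  then show "wedges (weighted_cycle [x0, x1, x2, x3, x4, x5]) = {{0, 1}, {1, 2}, {2, 3}, {3, 4}, {4, 5}, {5, 0}}"
    unfolding I image_insert image_empty by (simp flip: numeral_2_eq_2)
qed

lemma weighted_cycle_edges_sub: "e \<in> wedges (weighted_cycle ws) \<Longrightarrow> e \<subseteq> wverts (weighted_cycle ws)"
  by (auto simp: weighted_cycle_def intro: mod_less_divisor)

lemma six_cycle_reflection:
  "wgraph_iso (weighted_cycle [x0, x1, x2, x3, x4, x5]) (weighted_cycle [x0, x5, x4, x3, x2, x1])"
proof -
  define f :: "nat \<Rightarrow> nat" where "f i = (6 - i) mod 6" for i
  have f: "f 0 = 0" "f 1 = 5" "f 2 = 4" "f 3 = 3" "f 4 = 2" "f 5 = 1" by (simp_all add: f_def)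
  have "iso_via f (weighted_cycle [x0, x1, x2, x3, x4, x5]) (weighted_cycle [x0, x5, x4, x3, x2, x1])"
    unfolding iso_via_def six_cycle_simps
  proof (intro conjI)
    show "bij_betw f {0, 1, 2, 3, 4, 5} {0, 1, 2, 3, 4, 5}"
      unfolding bij_betw_def using f by (simp add: inj_on_def) auto
    show "{{0, 1}, {1, 2}, {2, 3}, {3, 4}, {4, 5}, {5, 0}} =
        (\<lambda>e. f ` e) ` {{0, 1}, {1, 2}, {2, 3}, {3, 4}, {4, 5}, {5, 0}}"
      unfolding image_insert image_empty f by (simp add: insert_commute)
    show "\<forall>v\<in>{0, 1, 2, 3, 4, 5}. weight (weighted_cycle [x0, x5, x4, x3, x2, x1]) (f v) =
        weight (weighted_cycle [x0, x1, x2, x3, x4, x5]) v"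
      using f by (simp add: weighted_cycle_def)
  qed
  then show ?thesis unfolding wgraph_iso_iff by blast
qed

text \<open>Read in the opposite direction, the weights with parameter \<open>A\<close> are those
  with parameter \<open>- A - 1\<close>. As \<open>A\<close> is neither 0 nor \<open>-1\<close>, one
  of the two parameters is positive.\<close>

lemma six_node_in_Gamma_class:
  assumes nd: "node \<Gamma> m" and n: "card (wverts \<Gamma>) = 6"
  shows "\<exists>a\<ge>1. \<Gamma> \<in> Gamma_class a"
proof -
  obtain R where g: "gfan R \<Gamma>" using nodeD(1)[OF nd] weighted_circular_graph_iff_gfan by blast
  obtain A v w z t u where six: "distinct [m, v, w, z, t, u]" "set [m, v, w, z, t, u] = Domain R"
    "(m, v) \<in> R" "(v, w) \<in> R" "(w, z) \<in> R" "(z, t) \<in> R" "(t, u) \<in> R" "(u, m) \<in> R"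
    "map (weight \<Gamma>) [m, v, w, z, t, u] = [- 1, - 2, A, 0, - A - 1, - 2]" "A \<noteq> 0" "A \<noteq> - 1"
    by (rule six_node[OF nd g n])
  have "wgraph_iso (weighted_cycle [- 1, - 2, A, 0, - A - 1, - 2]) \<Gamma>"
  proof (rule wgraph_iso_weighted_cycle[OF g six(1,2)])
    fix i assume "i < length [m, v, w, z, t, u]"
    then have "i = 0 \<or> i = 1 \<or> i = 2 \<or> i = 3 \<or> i = 4 \<or> i = 5" by auto
    then show "([m, v, w, z, t, u] ! i, [m, v, w, z, t, u] ! (Suc i mod length [m, v, w, z, t, u])) \<in> R"
      using six(3-8) by (elim disjE) simp_all
  qed (use six(9) in simp)
  then have iso: "wgraph_iso \<Gamma> (weighted_cycle [- 1, - 2, A, 0, - A - 1, - 2])"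
    by (rule wgraph_iso_sym) (rule weighted_cycle_edges_sub)
  show ?thesis
  proof (cases "A \<ge> 1")
    case True
    then show ?thesis using iso nodeD(1)[OF nd] unfolding Gamma_class_def by blast
  next
    case False
    have "wgraph_iso \<Gamma> (weighted_cycle [- 1, - 2, - A - 1, 0, A, - 2])"
      by (rule wgraph_iso_trans[OF iso six_cycle_reflection])
    then have "\<Gamma> \<in> Gamma_class (- A - 1)"
      using nodeD(1)[OF nd] unfolding Gamma_class_def by simp
    then show ?thesis using False six(10,11) by (intro exI[of _ "- A - 1"]) simp
  qed
qed

text \<open>For \<open>a \<ge> 1\<close> neither \<open>a\<close> nor \<open>- a - 1\<close> equals
  \<open>-1\<close>, so the first entry of the list is its only \<open>-1\<close>.\<close>

lemma Gamma_class_node: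
  assumes "a \<ge> 1" "\<Gamma> \<in> Gamma_class a"
  obtains m where "node \<Gamma> m" "card (wverts \<Gamma>) = 6"
proof -
  let ?W = "weighted_cycle [- 1, - 2, a, 0, - a - 1, - 2]"
  obtain f where f: "iso_via f \<Gamma> ?W" and w: "weighted_circular_graph \<Gamma>"
    using assms(2) unfolding Gamma_class_def wgraph_iso_iff by blast
  have "{x \<in> wverts ?W. weight ?W x = - 1} = {0}"
    unfolding six_cycle_simps using assms(1) by (auto simp: weighted_cycle_def)
  then have "card {x \<in> wverts \<Gamma>. weight \<Gamma> x = - 1} = 1"
    using iso_via_minus_one_card(1)[OF f] by simp
  then obtain m where m: "{x \<in> wverts \<Gamma>. weight \<Gamma> x = - 1} = {m}" by (rule card_1_singletonE)
  have "card (wverts \<Gamma>) = 6"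
    using iso_via_minus_one_card(2)[OF f] unfolding six_cycle_simps by simp
  then show thesis using that w m unfolding node_def by simp
qed

text \<open>The parameter can be read off as the only positive weight.\<close>

lemma Gamma_class_inj:
  assumes "\<Gamma> \<in> Gamma_class a" "\<Gamma> \<in> Gamma_class b" "a \<ge> 1" "b \<ge> 1"
  shows "a = b"
proof -
  have vals: "weight \<Gamma> ` wverts \<Gamma> = {- 1, - 2, c, 0, - c - 1}" if c: "\<Gamma> \<in> Gamma_class c" for c
  proof -
    let ?W = "weighted_cycle [- 1, - 2, c, 0, - c - 1, - 2]"
    obtain f where f: "iso_via f \<Gamma> ?W" using c unfolding Gamma_class_def wgraph_iso_iff by blast
    have "weight \<Gamma> ` wverts \<Gamma> = (\<lambda>x. weight ?W (f x)) ` wverts \<Gamma>"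
      using f by (intro image_cong refl) (simp add: iso_via_def)
    also have "\<dots> = weight ?W ` f ` wverts \<Gamma>" by (simp add: image_image)
    also have "f ` wverts \<Gamma> = wverts ?W" using f by (simp add: iso_via_def bij_betw_def)
    also have "weight ?W ` wverts ?W = {- 1, - 2, c, 0, - c - 1}"
      unfolding six_cycle_simps by (simp add: weighted_cycle_def insert_commute)
    finally show ?thesis .
  qed
  have "a \<in> {- 1, - 2, b, 0, - b - 1}" using vals[OF assms(1)] vals[OF assms(2)] by auto
  then show ?thesis using assms(3,4) by auto
qed

section \<open>Realising the weights of the roots by fans\<close>

lemma gfan_exists:
  assumes "circ_fan R"
  shows "\<exists>\<Gamma>. gfan R \<Gamma>"
proof -
  interpret circ_fan R by fact
  define wt where "wt z = (SOME k. \<exists>u w. (u, z) \<in> R \<and> (z, w) \<in> R \<and> k = - det2 u w)" for z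
  have wt: "wt z = - det2 u w" if uz: "(u, z) \<in> R" and zw: "(z, w) \<in> R" for u z w
  proof -
    have "\<exists>u w. (u, z) \<in> R \<and> (z, w) \<in> R \<and> wt z = - det2 u w"
      unfolding wt_def by (rule someI_ex) (use uz zw in blast)
    then show ?thesis using pred_unique[OF uz] succ_unique[OF zw] by blast
  qed
  have "gfan R \<lparr>wverts = Domain R, wedges = {{u, v} | u v. (u, v) \<in> R}, weight = wt\<rparr>"
    unfolding gfan_def using wt assms by simp
  then show ?thesis by blast
qed

text \<open>Each half-open cone is cut out by explicit sign conditions on the coordinates, so
  disjointness is a finite check.\<close>

lemma circ_fan_Hirzebruch:
  "circ_fan {((1, 0), (0, 1)), ((0, 1), (- 1, k)), ((- 1, k), (0, - 1)), ((0, - 1), (1, 0))}" (is "circ_fan ?R")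
proof
  show "finite ?R" "?R \<noteq> {}" by simp_all
  show "Range ?R = Domain ?R" by (simp add: insert_commute)
  show "det2 u v = 1" if "(u, v) \<in> ?R" for u v
    using that by (auto simp: det2_def)
  have H: "p \<in> hcone (1, 0) (0, 1) \<longleftrightarrow> 0 \<le> snd p \<and> 0 < fst p"
    "p \<in> hcone (0, 1) (- 1, k) \<longleftrightarrow> fst p \<le> 0 \<and> 0 < fst p * of_int k + snd p"
    "p \<in> hcone (- 1, k) (0, - 1) \<longleftrightarrow> fst p * of_int k + snd p \<le> 0 \<and> fst p < 0"
    "p \<in> hcone (0, - 1) (1, 0) \<longleftrightarrow> 0 \<le> fst p \<and> snd p < 0" for p
    by (auto simp: hcone_def cross_def real_pt_def algebra_simps)
  fix u v u' v' p assume R: "(u, v) \<in> ?R" "(u', v') \<in> ?R" and p: "p \<in> hcone u v" "p \<in> hcone u' v'"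
  have "(u, v) = ((1, 0), (0, 1)) \<or> (u, v) = ((0, 1), (- 1, k)) \<or> (u, v) = ((- 1, k), (0, - 1)) \<or> (u, v) = ((0, - 1), (1, 0))"
    "(u', v') = ((1, 0), (0, 1)) \<or> (u', v') = ((0, 1), (- 1, k)) \<or> (u', v') = ((- 1, k), (0, - 1)) \<or> (u', v') = ((0, - 1), (1, 0))"
    using R by simp_all
  then show "u = u' \<and> v = v'"
    using p H[of p] by (elim disjE) (simp_all, (cases "fst p = 0", simp_all)+)
qed

text \<open>The Hirzebruch fan with generators \<open>v, w, z, t\<close> and parameter \<open>- a\<close>, blown up twice: \<open>u\<close> subdivides the
  cone of \<open>t\<close> and \<open>v\<close>, then \<open>m\<close> the cone of \<open>u\<close> and \<open>v\<close>.\<close>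

lemma Gamma_class_nonempty: "\<exists>\<Gamma>. \<Gamma> \<in> Gamma_class a"
proof -
  define v w z t u m :: lattice where "v = (1, 0)" and "w = (0, 1)" and "z = (- 1, - a)" and "t = (0, - 1)"
    and "u = (1, - 1)" and "m = (2, - 1)"
  note defs = v_def w_def z_def t_def u_def m_def
  define R where "R = {(v, w), (w, z), (z, t), (t, v)}"
  have "circ_fan R" unfolding R_def defs by (rule circ_fan_Hirzebruch)
  then obtain \<Gamma>4 where g4: "gfan R \<Gamma>4" using gfan_exists by blast
  have tv: "t + v = u" and uv: "u + v = m" by (simp_all add: defs)
  have g5: "gfan (blow_arcs t v R) (blow_up t v \<Gamma>4)"
    by (rule gfan_blow_up[OF g4]) (simp add: R_def)
  have g6: "gfan (blow_arcs u v (blow_arcs t v R)) (blow_up u v (blow_up t v \<Gamma>4))" (is "gfan ?R6 ?G")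
    by (rule gfan_blow_up[OF g5]) (simp add: blow_arcs_def tv)
  have dist: "distinct [m, v, w, z, t, u]" by (simp add: defs)
  have arcs: "(m, v) \<in> ?R6" "(v, w) \<in> ?R6" "(w, z) \<in> ?R6" "(z, t) \<in> ?R6" "(t, u) \<in> ?R6" "(u, m) \<in> ?R6"
    using dist unfolding blow_arcs_def tv uv R_def by auto
  have R6: "?R6 \<subseteq> {(m, v), (v, w), (w, z), (z, t), (t, u), (u, m)}"
    unfolding blow_arcs_def tv uv R_def by blast
  have dom: "set [m, v, w, z, t, u] = Domain ?R6"
  proof (intro equalityI)
    show "set [m, v, w, z, t, u] \<subseteq> Domain ?R6" using arcs by (simp add: DomainI)
    show "Domain ?R6 \<subseteq> set [m, v, w, z, t, u]" using Domain_mono[OF R6] by simp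
  qed
  have "wgraph_iso (weighted_cycle [- 1, - 2, a, 0, - a - 1, - 2]) ?G"
  proof (rule wgraph_iso_weighted_cycle[OF g6 dist dom])
    fix i assume "i < length [m, v, w, z, t, u]"
    then have "i = 0 \<or> i = 1 \<or> i = 2 \<or> i = 3 \<or> i = 4 \<or> i = 5" by auto
    then show "([m, v, w, z, t, u] ! i, [m, v, w, z, t, u] ! (Suc i mod length [m, v, w, z, t, u])) \<in> ?R6"
      using arcs by (elim disjE) simp_all
  next
    have "weight ?G m = - det2 u v" "weight ?G v = - det2 m w" "weight ?G w = - det2 v z" "weight ?G z = - det2 w t"
      "weight ?G t = - det2 z u" "weight ?G u = - det2 t m"
      using gfanD(4)[OF g6] arcs by blast+
    then show "[- 1, - 2, a, 0, - a - 1, - 2] = map (weight ?G) [m, v, w, z, t, u]"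
      by (simp add: det2_def defs)
  qed
  then have "wgraph_iso ?G (weighted_cycle [- 1, - 2, a, 0, - a - 1, - 2])"
    by (rule wgraph_iso_sym) (rule weighted_cycle_edges_sub)
  then show ?thesis
    using gfan_imp_weighted_circular_graph[OF g6] unfolding Gamma_class_def by blast
qed

section \<open>Isomorphism classes\<close>

definition iso_class :: "lattice wgraph \<Rightarrow> lattice wgraph set" where
  "iso_class \<Gamma> = {\<Gamma>'. weighted_circular_graph \<Gamma>' \<and> wgraph_iso \<Gamma> \<Gamma>'}"

lemma wcg_edges_sub: "weighted_circular_graph \<Gamma> \<Longrightarrow> e \<in> wedges \<Gamma> \<Longrightarrow> e \<subseteq> wverts \<Gamma>"
  using gfan_edges_sub weighted_circular_graph_iff_gfan by blast

lemma wcg_iso_sym: "weighted_circular_graph \<Gamma> \<Longrightarrow> wgraph_iso \<Gamma> \<Gamma>' \<Longrightarrow> wgraph_iso \<Gamma>' \<Gamma>"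
  by (rule wgraph_iso_sym) (simp_all only: wcg_edges_sub)

lemma iso_class_eq:
  assumes "weighted_circular_graph \<Gamma>" "wgraph_iso \<Gamma> \<Gamma>'"
  shows "iso_class \<Gamma> = iso_class \<Gamma>'"
  using wgraph_iso_trans[OF assms(2)] wgraph_iso_trans[OF wcg_iso_sym[OF assms]] unfolding iso_class_def by blast

lemma iso_class_self: "weighted_circular_graph \<Gamma> \<Longrightarrow> \<Gamma> \<in> iso_class \<Gamma>"
  unfolding iso_class_def using wgraph_iso_refl by blast

lemma iso_class_eqD:
  assumes "iso_class \<Gamma> = iso_class \<Gamma>'" "weighted_circular_graph \<Gamma>'"
  shows "wgraph_iso \<Gamma> \<Gamma>'"
  using iso_class_self[OF assms(2)] unfolding assms(1)[symmetric] by (simp add: iso_class_def)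

lemma node_iso:
  assumes "node \<Gamma> m" "weighted_circular_graph \<Gamma>'" "iso_via f \<Gamma> \<Gamma>'"
  shows "node \<Gamma>' (f m)"
proof -
  have "card {x \<in> wverts \<Gamma>'. weight \<Gamma>' x = - 1} = 1"
    using iso_via_minus_one_card(1)[OF assms(3)] nodeD(3)[OF assms(1)] by simp
  then obtain m' where m': "{x \<in> wverts \<Gamma>'. weight \<Gamma>' x = - 1} = {m'}" by (rule card_1_singletonE)
  then have "f m = m'" using iso_via_minus_ones[OF assms(3) nodeD(3)[OF assms(1)]] by blast
  then show ?thesis
    using m' assms(2) nodeD(2)[OF assms(1)] iso_via_minus_one_card(2)[OF assms(3)] unfolding node_def by simp
qed

lemma node_blow_up_new:
  assumes "node (blow_up u v \<Gamma>) m"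
  shows "m = u + v"
proof -
  have "u + v \<in> wverts (blow_up u v \<Gamma>)" "weight (blow_up u v \<Gamma>) (u + v) = - 1" by simp_all
  then show ?thesis using nodeD(6)[OF assms] by metis
qed

lemma OT_nodes_eq: "OT_nodes = {iso_class \<Gamma> | \<Gamma> m. node \<Gamma> m}"
proof -
  let ?N = "{\<Gamma>. weighted_circular_graph \<Gamma> \<and> 6 \<le> card (wverts \<Gamma>) \<and> card {v \<in> wverts \<Gamma>. weight \<Gamma> v = - 1} = 1}"
  have N: "\<Gamma> \<in> ?N \<longleftrightarrow> (\<exists>m. node \<Gamma> m)" for \<Gamma>
    unfolding node_def by (simp add: card_1_singleton_iff)
  have cls: "wcg_iso_rel `` {\<Gamma>} = iso_class \<Gamma>" if "\<Gamma> \<in> ?N" for \<Gamma>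
    using that unfolding wcg_iso_rel_def iso_class_def by (simp add: Image_singleton)
  have "OT_nodes = (\<lambda>\<Gamma>. wcg_iso_rel `` {\<Gamma>}) ` ?N"
    unfolding OT_nodes_def quotient_def by (simp add: UNION_singleton_eq_range)
  also have "\<dots> = iso_class ` ?N" by (intro image_cong refl cls)
  also have "\<dots> = {iso_class \<Gamma> | \<Gamma> m. node \<Gamma> m}"
    using N by (simp add: image_def set_eq_iff) blast
  finally show ?thesis .
qed

lemma OT_nodes_member:
  assumes "C \<in> OT_nodes" "\<Gamma> \<in> C"
  shows "C = iso_class \<Gamma>" "\<exists>m. node \<Gamma> m"
proof -
  obtain \<Gamma>1 m where C: "C = iso_class \<Gamma>1" and m: "node \<Gamma>1 m" using assms(1) unfolding OT_nodes_eq by blast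
  have iso: "weighted_circular_graph \<Gamma>" "wgraph_iso \<Gamma>1 \<Gamma>" using assms(2) unfolding C iso_class_def by simp_all
  show "C = iso_class \<Gamma>" unfolding C by (rule iso_class_eq[OF nodeD(1)[OF m] iso(2)])
  obtain f where "iso_via f \<Gamma>1 \<Gamma>" using iso(2) unfolding wgraph_iso_iff by blast
  then show "\<exists>m. node \<Gamma> m" using node_iso[OF m iso(1)] by blast
qed

section \<open>Arcs between isomorphism classes\<close>

text \<open>An arc with its representative exposed: \<open>D\<close> is the class of this very
  blow-up, whose only weight \<open>-1\<close> is at the new vertex.\<close>

definition OT_step :: "lattice wgraph \<Rightarrow> lattice \<Rightarrow> lattice \<Rightarrow> lattice wgraph set \<Rightarrow> lattice wgraph set \<Rightarrow> bool" where
  "OT_step \<Gamma> u v C D \<longleftrightarrow> (\<exists>m. node \<Gamma> m) \<and> {u, v} \<in> wedges \<Gamma> \<and> node (blow_up u v \<Gamma>) (u + v) \<and>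
     C = iso_class \<Gamma> \<and> D = iso_class (blow_up u v \<Gamma>)"

lemma OT_arc_iff: "(C, D) \<in> parcs OT \<longleftrightarrow> (\<exists>\<Gamma> u v. OT_step \<Gamma> u v C D)"
proof
  assume "(C, D) \<in> parcs OT"
  then obtain \<Gamma> u v where *: "C \<in> OT_nodes" "D \<in> OT_nodes" "\<Gamma> \<in> C" "{u, v} \<in> wedges \<Gamma>" "blow_up u v \<Gamma> \<in> D"
    unfolding OT_def by (simp only: pair_pre_digraph.select_convs mem_Collect_eq prod.case) blast
  have n: "node (blow_up u v \<Gamma>) (u + v)"
    using OT_nodes_member(2)[OF *(2,5)] node_blow_up_new by metis
  have "OT_step \<Gamma> u v C D"
    unfolding OT_step_def
    by (intro conjI OT_nodes_member[OF *(1,3)] OT_nodes_member(1)[OF *(2,5)] *(4) n)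
  then show "\<exists>\<Gamma> u v. OT_step \<Gamma> u v C D" by blast
next
  assume "\<exists>\<Gamma> u v. OT_step \<Gamma> u v C D"
  then obtain \<Gamma> u v m where *: "node \<Gamma> m" "{u, v} \<in> wedges \<Gamma>" "node (blow_up u v \<Gamma>) (u + v)"
    "C = iso_class \<Gamma>" "D = iso_class (blow_up u v \<Gamma>)" unfolding OT_step_def by blast
  have CD: "C \<in> OT_nodes" "D \<in> OT_nodes" unfolding OT_nodes_eq using * by blast+
  have in': "\<Gamma> \<in> C" "blow_up u v \<Gamma> \<in> D"
    unfolding * using iso_class_self nodeD(1) *(1,3) by blast+
  have "C \<in> OT_nodes \<and> D \<in> OT_nodes \<and> (\<exists>\<Gamma>\<in>C. \<exists>u v. {u, v} \<in> wedges \<Gamma> \<and> blow_up u v \<Gamma> \<in> D)"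
    by (intro conjI CD bexI[OF _ in'(1)] exI[of _ u] exI[of _ v] *(2) in'(2))
  then show "(C, D) \<in> parcs OT" unfolding OT_def by simp
qed

lemma node_blowable: "node \<Gamma> m \<Longrightarrow> {u, v} \<in> wedges \<Gamma> \<Longrightarrow> blowable u v \<Gamma>"
  using gfan_blowable_edge nodeD(1) weighted_circular_graph_iff_gfan by blast

text \<open>In both blow-ups the new vertex is the only one of weight \<open>-1\<close>, so an
  isomorphism matches the new vertices and \<open>iso_contract\<close> applies.\<close>

lemma blow_up_iso_contract:
  assumes nd: "node \<Gamma> m" "node \<Gamma>' m'" and e: "{u, v} \<in> wedges \<Gamma>" "{u', v'} \<in> wedges \<Gamma>'"
    and b: "node (blow_up u v \<Gamma>) (u + v)" "node (blow_up u' v' \<Gamma>') (u' + v')"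
    and eq: "iso_class (blow_up u v \<Gamma>) = iso_class (blow_up u' v' \<Gamma>')"
  obtains f where "iso_via f \<Gamma> \<Gamma>'" "{f u, f v} = {u', v'}"
proof -
  have "wgraph_iso (blow_up u v \<Gamma>) (blow_up u' v' \<Gamma>')"
    by (rule iso_class_eqD[OF eq nodeD(1)[OF b(2)]])
  then obtain f where f: "iso_via f (blow_up u v \<Gamma>) (blow_up u' v' \<Gamma>')" unfolding wgraph_iso_iff by blast
  have new: "f (u + v) = u' + v'"
    by (rule iso_via_minus_ones[OF f nodeD(3)[OF b(1)] nodeD(3)[OF b(2)]])
  show thesis
    by (rule that[OF iso_contract[OF f node_blowable[OF nd(1) e(1)] node_blowable[OF nd(2) e(2)] new]])
qed

lemma OT_parent_unique:
  assumes "(C, D) \<in> parcs OT" "(C', D) \<in> parcs OT"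
  shows "C = C'"
proof -
  obtain \<Gamma> u v where 1: "OT_step \<Gamma> u v C D" using assms(1) OT_arc_iff by blast
  obtain \<Gamma>' u' v' where 2: "OT_step \<Gamma>' u' v' C' D" using assms(2) OT_arc_iff by blast
  obtain m where s: "node \<Gamma> m" "{u, v} \<in> wedges \<Gamma>" "node (blow_up u v \<Gamma>) (u + v)" "C = iso_class \<Gamma>"
    "D = iso_class (blow_up u v \<Gamma>)"
    using 1 unfolding OT_step_def by blast
  obtain m' where s': "node \<Gamma>' m'" "{u', v'} \<in> wedges \<Gamma>'" "node (blow_up u' v' \<Gamma>') (u' + v')" "C' = iso_class \<Gamma>'"
    "D = iso_class (blow_up u' v' \<Gamma>')"
    using 2 unfolding OT_step_def by blast
  have eq: "iso_class (blow_up u v \<Gamma>) = iso_class (blow_up u' v' \<Gamma>')" using s(5) s'(5) by simp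
  obtain f where "iso_via f \<Gamma> \<Gamma>'"
    by (rule blow_up_iso_contract[OF s(1) s'(1) s(2) s'(2) s(3) s'(3) eq])
  then have "wgraph_iso \<Gamma> \<Gamma>'" unfolding wgraph_iso_iff by blast
  then show ?thesis using iso_class_eq[OF nodeD(1)[OF s(1)]] s(4) s'(4) by simp
qed

text \<open>A further \<open>-1\<close> could only come from an end of the edge with weight 0. But
  one end is \<open>m\<close>, which drops to \<open>-2\<close>, and the other has weight at most
  \<open>-2\<close> by \<open>node_neighbour_weights\<close>.\<close>

lemma node_blow_up:
  assumes nd: "node \<Gamma> m" and g: "gfan R \<Gamma>" and uv: "(u, v) \<in> R" and m: "m = u \<or> m = v"
  shows "node (blow_up u v \<Gamma>) (u + v)"
proof -
  interpret circ_fan R using gfanD(1)[OF g] .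
  let ?G = "blow_up u v \<Gamma>"
  note bl = blowableD[OF gfan_blowable[OF g uv]]
  have fin: "finite (wverts \<Gamma>)" using finV gfanD(2)[OF g] by simp
  have wcg: "weighted_circular_graph ?G" by (rule gfan_imp_weighted_circular_graph[OF gfan_blow_up[OF g uv]])
  have card: "6 \<le> card (wverts ?G)" using nodeD(2)[OF nd] fin bl(3) by simp
  have nb: "weight \<Gamma> x \<noteq> 0" if x: "x = u \<or> x = v" for x
    using m
  proof
    assume mu: "m = u"
    obtain t where "(t, u) \<in> R" using predE inV[OF uv] by blast
    then have "weight \<Gamma> v \<le> - 2" using node_neighbour_weights[OF nd g, of t v] uv mu by simp
    then show ?thesis using x mu nodeD(5)[OF nd] by auto
  next
    assume mv: "m = v"
    obtain t where "(v, t) \<in> R" using succE inV[OF uv] by blast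
    then have "weight \<Gamma> u \<le> - 2" using node_neighbour_weights[OF nd g, of u t] uv mv by simp
    then show ?thesis using x mv nodeD(5)[OF nd] by auto
  qed
  have "x = u + v" if x: "x \<in> wverts ?G" "weight ?G x = - 1" for x
  proof (rule ccontr)
    assume ne: "x \<noteq> u + v"
    then have xV: "x \<in> wverts \<Gamma>" using x(1) by simp
    show False
    proof (cases "x = u \<or> x = v")
      case True
      then have "weight ?G x = weight \<Gamma> x - 1" using bl(2,7,8) by (elim disjE) simp_all
      then show False using x(2) nb[OF True] by simp
    next
      case False
      then have "weight \<Gamma> x = - 1" using x(2) ne by simp
      then show False using nodeD(6)[OF nd xV] m False by blast
    qed
  qed
  moreover have "u + v \<in> wverts ?G" "weight ?G (u + v) = - 1" by simp_all
  ultimately have "{x \<in> wverts ?G. weight ?G x = - 1} = {u + v}" by blast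
  then show ?thesis unfolding node_def using wcg card by simp
qed

text \<open>Otherwise \<open>m\<close> would keep its weight \<open>-1\<close> beside the new
  vertex.\<close>

lemma blow_up_at_minus_one:
  assumes nd: "node \<Gamma> m" and e: "{a, b} \<in> wedges \<Gamma>" and nb: "node (blow_up a b \<Gamma>) (a + b)"
  shows "a = m \<or> b = m"
proof (rule ccontr)
  assume no: "\<not> ?thesis"
  note bl = blowableD[OF node_blowable[OF nd e]]
  have "m \<noteq> a + b" using bl(3) nodeD(4)[OF nd] by metis
  moreover have "m \<in> wverts (blow_up a b \<Gamma>)" "weight (blow_up a b \<Gamma>) m = - 1"
    using no nodeD(4,5)[OF nd] \<open>m \<noteq> a + b\<close> by auto
  ultimately show False using nodeD(6)[OF nb] by blast
qed

lemma OT_children: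
  assumes nd: "node \<Gamma> m" and g: "gfan R \<Gamma>" and um: "(u, m) \<in> R" and mv: "(m, v) \<in> R"
  shows "{D. (iso_class \<Gamma>, D) \<in> parcs OT} = {iso_class (blow_up u m \<Gamma>), iso_class (blow_up m v \<Gamma>)}"
    "iso_class (blow_up u m \<Gamma>) \<noteq> iso_class (blow_up m v \<Gamma>)"
proof -
  interpret circ_fan R using gfanD(1)[OF g] .
  have e: "{u, m} \<in> wedges \<Gamma>" "{m, v} \<in> wedges \<Gamma>" using gfan_edge_iff[OF g] um mv by blast+
  have n: "node (blow_up u m \<Gamma>) (u + m)" "node (blow_up m v \<Gamma>) (m + v)"
    using node_blow_up[OF nd g um] node_blow_up[OF nd g mv] by simp_all
  show "{D. (iso_class \<Gamma>, D) \<in> parcs OT} = {iso_class (blow_up u m \<Gamma>), iso_class (blow_up m v \<Gamma>)}"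
  proof (intro equalityI subsetI)
    fix D assume "D \<in> {iso_class (blow_up u m \<Gamma>), iso_class (blow_up m v \<Gamma>)}"
    then have "OT_step \<Gamma> u m (iso_class \<Gamma>) D \<or> OT_step \<Gamma> m v (iso_class \<Gamma>) D"
      unfolding OT_step_def using nd e n by blast
    then show "D \<in> {D. (iso_class \<Gamma>, D) \<in> parcs OT}" using OT_arc_iff by blast
  next
    fix D assume "D \<in> {D. (iso_class \<Gamma>, D) \<in> parcs OT}"
    then obtain \<Gamma>' a b m' where s: "node \<Gamma>' m'" "{a, b} \<in> wedges \<Gamma>'" "node (blow_up a b \<Gamma>') (a + b)"
      "iso_class \<Gamma> = iso_class \<Gamma>'" "D = iso_class (blow_up a b \<Gamma>')"
      unfolding mem_Collect_eq OT_arc_iff OT_step_def by blast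
    have "wgraph_iso \<Gamma>' \<Gamma>" by (rule iso_class_eqD[OF s(4)[symmetric] nodeD(1)[OF nd]])
    then obtain f where f: "iso_via f \<Gamma>' \<Gamma>" unfolding wgraph_iso_iff by blast
    have fm: "f m' = m" by (rule iso_via_minus_ones[OF f nodeD(3)[OF s(1)] nodeD(3)[OF nd]])
    have fe: "{f a, f b} \<in> wedges \<Gamma>" by (rule iso_via_edge[OF f s(2)])
    have bl: "blowable (f a) (f b) \<Gamma>" by (rule node_blowable[OF nd fe])
    \<comment> \<open>The arc may be witnessed by another graph of the class; \<open>f\<close>
      carries its blow-up to a blow-up of \<open>\<Gamma>\<close>.\<close>
    have D: "D = iso_class (blow_up (f a) (f b) \<Gamma>)"
      unfolding s(5)
      by (rule iso_class_eq[OF nodeD(1)[OF s(3)] blow_up_iso[OF f node_blowable[OF s(1,2)] bl]])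
    have "f a = m \<or> f b = m" using blow_up_at_minus_one[OF s(1-3)] fm by blast
    moreover have "(f a, f b) \<in> R \<or> (f b, f a) \<in> R" using gfan_edge_iff[OF g] fe by blast
    ultimately have "{f a, f b} = {u, m} \<or> {f a, f b} = {m, v}"
      using pred_unique[OF um] succ_unique[OF mv] by blast
    then show "D \<in> {iso_class (blow_up u m \<Gamma>), iso_class (blow_up m v \<Gamma>)}"
    proof
      assume "{f a, f b} = {u, m}"
      then have "blow_up (f a) (f b) \<Gamma> = blow_up u m \<Gamma>"
        by (rule blow_up_eq_if_same_edge[OF blowableD(2)[OF bl]])
      then show ?thesis using D by simp
    next
      assume "{f a, f b} = {m, v}"
      then have "blow_up (f a) (f b) \<Gamma> = blow_up m v \<Gamma>"
        by (rule blow_up_eq_if_same_edge[OF blowableD(2)[OF bl]])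
      then show ?thesis using D by simp
    qed
  qed
  show "iso_class (blow_up u m \<Gamma>) \<noteq> iso_class (blow_up m v \<Gamma>)"
  proof
    assume eq: "iso_class (blow_up u m \<Gamma>) = iso_class (blow_up m v \<Gamma>)"
    \<comment> \<open>An isomorphism of the two children comes from an automorphism of
      \<open>\<Gamma>\<close> that fixes \<open>m\<close> and takes \<open>u\<close> to
      \<open>v\<close>.\<close>
    obtain f where f: "iso_via f \<Gamma> \<Gamma>" "{f u, f m} = {m, v}"
      by (rule blow_up_iso_contract[OF nd nd e n eq])
    have "f m = m" by (rule iso_via_minus_ones[OF f(1) nodeD(3)[OF nd] nodeD(3)[OF nd]])
    moreover have "m \<noteq> v" using det[OF mv] det2_eq_1_nonzero by blast
    ultimately have "f u = v" using f(2) by (simp add: doubleton_eq_iff)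
    then show False using node_neighbours_not_swapped[OF nd g um mv f(1)] by simp
  qed
qed

lemma OT_two_children:
  assumes "C \<in> OT_nodes"
  shows "card {D. (C, D) \<in> parcs OT} = 2"
proof -
  obtain \<Gamma> m where nd: "node \<Gamma> m" and C: "C = iso_class \<Gamma>" using assms unfolding OT_nodes_eq by blast
  obtain R where g: "gfan R \<Gamma>" using nodeD(1)[OF nd] weighted_circular_graph_iff_gfan by blast
  obtain u v where "(u, m) \<in> R" "(m, v) \<in> R" by (rule node_neighbours[OF nd g])
  note ch = OT_children[OF nd g this]
  show ?thesis unfolding C ch(1) using ch(2) by simp
qed

section \<open>Roots and reachability\<close>

lemma Gamma_class_iso_class:
  assumes "\<Gamma> \<in> Gamma_class a"
  shows "Gamma_class a = iso_class \<Gamma>"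
proof -
  let ?W = "weighted_cycle [- 1, - 2, a, 0, - a - 1, - 2]"
  have G: "weighted_circular_graph \<Gamma>" "wgraph_iso \<Gamma> ?W" using assms unfolding Gamma_class_def by simp_all
  have W: "wgraph_iso ?W \<Gamma>" by (rule wgraph_iso_sym[OF G(2)]) (rule wcg_edges_sub[OF G(1)])
  have "wgraph_iso \<Gamma>' ?W \<longleftrightarrow> wgraph_iso \<Gamma> \<Gamma>'" if wcg: "weighted_circular_graph \<Gamma>'" for \<Gamma>'
  proof
    assume "wgraph_iso \<Gamma>' ?W"
    then have "wgraph_iso ?W \<Gamma>'" by (rule wgraph_iso_sym) (rule wcg_edges_sub[OF wcg])
    then show "wgraph_iso \<Gamma> \<Gamma>'" by (rule wgraph_iso_trans[OF G(2)])
  next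
    assume "wgraph_iso \<Gamma> \<Gamma>'"
    from wcg_iso_sym[OF G(1) this] show "wgraph_iso \<Gamma>' ?W" by (rule wgraph_iso_trans[OF _ G(2)])
  qed
  then show ?thesis unfolding Gamma_class_def iso_class_def by blast
qed

lemma Gamma_class_in_OT: "a \<ge> 1 \<Longrightarrow> Gamma_class a \<in> OT_nodes"
proof -
  assume a: "a \<ge> 1"
  obtain \<Gamma> where G: "\<Gamma> \<in> Gamma_class a" using Gamma_class_nonempty by blast
  obtain m where "node \<Gamma> m" by (rule Gamma_class_node[OF a G])
  then show ?thesis unfolding OT_nodes_eq Gamma_class_iso_class[OF G] by blast
qed

text \<open>A parent is a node and has at least six vertices, so its blow-up has at least
  seven.\<close>

lemma Gamma_class_root:
  assumes a: "a \<ge> 1"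
  shows "(C, Gamma_class a) \<notin> parcs OT"
proof
  assume "(C, Gamma_class a) \<in> parcs OT"
  then obtain \<Gamma> u v m where s: "node \<Gamma> m" "{u, v} \<in> wedges \<Gamma>" "node (blow_up u v \<Gamma>) (u + v)"
    "Gamma_class a = iso_class (blow_up u v \<Gamma>)"
    unfolding OT_arc_iff OT_step_def by blast
  have "blow_up u v \<Gamma> \<in> Gamma_class a" unfolding s(4) by (rule iso_class_self[OF nodeD(1)[OF s(3)]])
  then have "card (wverts (blow_up u v \<Gamma>)) = 6" by (rule Gamma_class_node[OF a])
  moreover have "finite (wverts \<Gamma>)" using nodeD(2)[OF s(1)] by (metis card.infinite not_numeral_le_zero)
  ultimately show False using nodeD(2)[OF s(1)] blowableD(3)[OF node_blowable[OF s(1,2)]] by simp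
qed

lemma OT_reachable:
  assumes "node \<Gamma> m"
  shows "\<exists>a\<ge>1. (Gamma_class a, iso_class \<Gamma>) \<in> (parcs OT)\<^sup>*"
  using assms
proof (induction "card (wverts \<Gamma>)" arbitrary: \<Gamma> m rule: less_induct)
  case less
  note nd = less.prems
  show ?case
  proof (cases "card (wverts \<Gamma>) = 6")
    case True
    then obtain a where a: "a \<ge> 1" "\<Gamma> \<in> Gamma_class a" using six_node_in_Gamma_class[OF nd] by blast
    show ?thesis using a(1) Gamma_class_iso_class[OF a(2)] by (intro exI[of _ a]) simp
  next
    case False
    then have n: "7 \<le> card (wverts \<Gamma>)" using nodeD(2)[OF nd] by simp
    obtain R where g: "gfan R \<Gamma>" using nodeD(1)[OF nd] weighted_circular_graph_iff_gfan by blast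
    obtain u v where uv: "(u, m) \<in> R" "(m, v) \<in> R" "m = u + v" by (rule node_neighbours[OF nd g])
    obtain S \<Gamma>0 m0 where S: "gfan S \<Gamma>0" "(u, v) \<in> S" "node \<Gamma>0 m0" "blow_up u v \<Gamma>0 = \<Gamma>"
      "card (wverts \<Gamma>) = Suc (card (wverts \<Gamma>0))"
      by (rule node_parent[OF nd g uv n])
    have "{u, v} \<in> wedges \<Gamma>0" using gfan_edge_iff[OF S(1)] S(2) by blast
    then have "OT_step \<Gamma>0 u v (iso_class \<Gamma>0) (iso_class \<Gamma>)"
      unfolding OT_step_def S(4) using S(3) nd uv(3) by blast
    then have arc: "(iso_class \<Gamma>0, iso_class \<Gamma>) \<in> parcs OT" unfolding OT_arc_iff by blast
    have "card (wverts \<Gamma>0) < card (wverts \<Gamma>)" using S(5) by simp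
    from less.hyps[OF this S(3)] obtain a where "a \<ge> 1" "(Gamma_class a, iso_class \<Gamma>0) \<in> (parcs OT)\<^sup>*" by blast
    then show ?thesis using rtrancl_into_rtrancl[OF _ arc] by blast
  qed
qed

section \<open>Trees from relations with unique predecessors\<close>

lemma cas_snoc:
  "pre_digraph.cas (with_proj T) u (p @ [e]) v \<longleftrightarrow> pre_digraph.cas (with_proj T) u p (fst e) \<and> snd e = v"
  by (induction p arbitrary: u) (auto simp: pre_digraph.cas.simps)

definition reach_tree :: "'a rel \<Rightarrow> 'a \<Rightarrow> 'a pair_pre_digraph" where
  "reach_tree E r = \<lparr>pverts = {v. (r, v) \<in> E\<^sup>*}, parcs = {(x, y). (r, x) \<in> E\<^sup>* \<and> (x, y) \<in> E}\<rparr>"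

text \<open>It is predecessors that are unique, so two walks to the same vertex are compared from
  their last arcs backwards. As the root has no predecessor, neither walk can be exhausted before
  the other.\<close>

lemma infinite_complete_binary_tree_reach_tree:
  assumes uniq: "\<And>x y z. (x, z) \<in> E \<Longrightarrow> (y, z) \<in> E \<Longrightarrow> x = y"
    and root: "\<And>x. (x, r) \<notin> E"
    and two: "\<And>v. (r, v) \<in> E\<^sup>* \<Longrightarrow> card {c. (v, c) \<in> E} = 2"
  shows "infinite_complete_binary_tree (reach_tree E r) r"
  unfolding infinite_complete_binary_tree_def
proof (intro conjI ballI)
  let ?T = "reach_tree E r"
  have T: "pverts ?T = {v. (r, v) \<in> E\<^sup>*}" "parcs ?T = {(x, y). (r, x) \<in> E\<^sup>* \<and> (x, y) \<in> E}"
    by (simp_all add: reach_tree_def)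
  show "pair_wf_digraph ?T"
    by unfold_locales (auto simp: T)
  show r: "r \<in> pverts ?T" by (simp add: T)
  show "card {c. (v, c) \<in> parcs ?T} = 2" if "v \<in> pverts ?T" for v
    using two[of v] that by (simp add: T)
  have awalk: "pre_digraph.awalk (with_proj ?T) r p v \<longleftrightarrow> set p \<subseteq> parcs ?T \<and> pre_digraph.cas (with_proj ?T) r p v" for p v
    using r by (simp add: pre_digraph.awalk_def)
  have unique: "p = q" if "pre_digraph.awalk (with_proj ?T) r p v" "pre_digraph.awalk (with_proj ?T) r q v" for p q v
    using that
  proof (induction p arbitrary: q v rule: rev_induct)
    case Nil
    then have v: "v = r" by (simp add: awalk pre_digraph.cas.simps)
    show ?case
    proof (cases q rule: rev_cases)
      case (snoc q' e)
      then have "e \<in> E" "snd e = r" using Nil v by (auto simp: awalk cas_snoc T)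
      then show ?thesis using root by (metis prod.collapse)
    qed simp
  next
    case (snoc e p)
    have e: "e \<in> E" "snd e = v" and p: "pre_digraph.awalk (with_proj ?T) r p (fst e)"
      using snoc.prems(1) by (auto simp: awalk cas_snoc T)
    show ?case
    proof (cases q rule: rev_cases)
      case Nil
      then have "v = r" using snoc.prems(2) by (simp add: awalk pre_digraph.cas.simps)
      then show ?thesis using e root by (metis prod.collapse)
    next
      case (snoc q' e')
      then have e': "e' \<in> E" "snd e' = v" and q: "pre_digraph.awalk (with_proj ?T) r q' (fst e')"
        using snoc.prems(2) by (auto simp: awalk cas_snoc T)
      have "fst e = fst e'" using uniq[of "fst e" v "fst e'"] e e' by (metis prod.collapse)
      then have "e = e'" using e(2) e'(2) by (simp add: prod_eq_iff)
      then show ?thesis using snoc.IH[of "fst e" q'] p q snoc by simp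
    qed
  qed
  show "\<exists>!p. pre_digraph.awalk (with_proj ?T) r p v" if "v \<in> pverts ?T" for v
  proof -
    have "(r, v) \<in> E\<^sup>*" using that by (simp add: T)
    then have "\<exists>p. pre_digraph.awalk (with_proj ?T) r p v"
    proof (induction rule: rtrancl_induct)
      case base
      show ?case by (intro exI[of _ "[]"]) (simp add: awalk pre_digraph.cas.simps)
    next
      case (step y z)
      then obtain p where "pre_digraph.awalk (with_proj ?T) r p y" by blast
      then have "pre_digraph.awalk (with_proj ?T) r (p @ [(y, z)]) z"
        using step(1,2) by (simp add: awalk cas_snoc T)
      then show ?case by blast
    qed
    then show ?thesis using unique by blast
  qed
qed

text \<open>Going backwards from \<open>v\<close> there is no choice, and the way back ends as soon
  as it meets a vertex without predecessor; so it cannot reach two of them.\<close>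

lemma common_descendant_roots:
  assumes uniq: "\<And>x y z. (x, z) \<in> E \<Longrightarrow> (y, z) \<in> E \<Longrightarrow> x = y"
    and root: "\<And>x. (x, r) \<notin> E" "\<And>x. (x, s) \<notin> E"
    and "(r, v) \<in> E\<^sup>*" "(s, v) \<in> E\<^sup>*"
  shows "r = s"
  using assms(4,5)
proof (induction rule: rtrancl_induct)
  case base
  then show ?case using root(1) by (metis rtranclE)
next
  case (step y z)
  then show ?case using root(2) uniq by (metis rtranclE)
qed

theorem corollary2p10:
  shows "\<exists>T :: int \<Rightarrow> lattice wgraph set pair_pre_digraph.
    (\<forall>a\<ge>1. infinite_complete_binary_tree (T a) (Gamma_class a)) \<and>
    disjoint_family_on (\<lambda>a. pverts (T a)) {1..} \<and>
    pverts OT = (\<Union>a\<in>{1..}. pverts (T a)) \<and>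
    parcs OT = (\<Union>a\<in>{1..}. parcs (T a))"
proof (intro exI[of _ "\<lambda>a. reach_tree (parcs OT) (Gamma_class a)"] conjI allI impI)
  let ?E = "parcs OT"
  have nodes: "v \<in> OT_nodes" if "a \<ge> 1" "(Gamma_class a, v) \<in> ?E\<^sup>*" for a v
    using that(2)
  proof (induction rule: rtrancl_induct)
    case base
    show ?case by (rule Gamma_class_in_OT[OF that(1)])
  next
    case (step y z)
    then show ?case by (simp add: OT_def)
  qed
  have reach: "\<exists>a\<ge>1. (Gamma_class a, C) \<in> ?E\<^sup>*" if "C \<in> OT_nodes" for C
    using that OT_reachable unfolding OT_nodes_eq by blast
  show "infinite_complete_binary_tree (reach_tree ?E (Gamma_class a)) (Gamma_class a)" if a: "a \<ge> 1" for a
    by (rule infinite_complete_binary_tree_reach_tree[OF OT_parent_unique Gamma_class_root[OF a]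
          OT_two_children[OF nodes[OF a]]])
  show "disjoint_family_on (\<lambda>a. pverts (reach_tree ?E (Gamma_class a))) {1..}"
    unfolding disjoint_family_on_def
  proof (intro ballI impI)
    fix a b :: int assume ab: "a \<in> {1..}" "b \<in> {1..}" "a \<noteq> b"
    then have a: "a \<ge> 1" and b: "b \<ge> 1" by simp_all
    \<comment> \<open>A common descendant identifies the two classes, and a graph in this nonempty
      class determines its parameter.\<close>
    have False if v: "(Gamma_class a, v) \<in> ?E\<^sup>*" "(Gamma_class b, v) \<in> ?E\<^sup>*" for v
    proof -
      have "Gamma_class a = Gamma_class b"
        by (rule common_descendant_roots[OF OT_parent_unique Gamma_class_root[OF a] Gamma_class_root[OF b] v])
      then show False
        using Gamma_class_nonempty[of a] Gamma_class_inj[OF _ _ a b] ab(3) by blast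
    qed
    then show "pverts (reach_tree ?E (Gamma_class a)) \<inter> pverts (reach_tree ?E (Gamma_class b)) = {}"
      by (auto simp: reach_tree_def)
  qed
  show "pverts OT = (\<Union>a\<in>{1..}. pverts (reach_tree ?E (Gamma_class a)))"
  proof -
    have "C \<in> OT_nodes \<longleftrightarrow> (\<exists>a\<in>{1..}. (Gamma_class a, C) \<in> ?E\<^sup>*)" for C
      using nodes reach by (metis atLeast_iff)
    moreover have "pverts OT = OT_nodes" by (simp add: OT_def)
    ultimately show ?thesis by (intro set_eqI) (simp add: reach_tree_def)
  qed
  show "parcs OT = (\<Union>a\<in>{1..}. parcs (reach_tree ?E (Gamma_class a)))"
  proof (intro equalityI subrelI)
    fix C D assume CD: "(C, D) \<in> ?E"
    then have "C \<in> OT_nodes" by (simp add: OT_def)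
    then obtain a where "a \<ge> 1" "(Gamma_class a, C) \<in> ?E\<^sup>*" using reach by blast
    then show "(C, D) \<in> (\<Union>a\<in>{1..}. parcs (reach_tree ?E (Gamma_class a)))"
      using CD by (auto simp: reach_tree_def)
  next
    fix C D assume "(C, D) \<in> (\<Union>a\<in>{1..}. parcs (reach_tree ?E (Gamma_class a)))"
    then show "(C, D) \<in> ?E" by (auto simp: reach_tree_def)
  qed
qed

end
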